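(* Let $u_0,v_0\in L^\infty(\Lambda)\cap BV(\Lambda)$ be $\Lambda$-periodic, and let $u$ and $v$ be two periodic entropy solutions (in the sense defined in the context) of the initial value problem $\partial_t u+\partial_x\cdot f(u)=\mathcal{L}^\mu[u]$ in $D_T$ with initial data $u_0$ and $v_0$, respectively. Then, for a.e. $t\in(0,T)$, $$\|u(\cdot,t)-v(\cdot,t)\|_{L^1(\Lambda)}\leq\|u_0-v_0\|_{L^1(\Lambda)}.$$
   Context: Let $d\ge1$, $T>0$, $\Lambda=(0,2\pi)^d$, $D_T=\Lambda\times(0,T)$. A function is $\Lambda$-periodic if it is $2\pi$-periodic in each space coordinate; a subscript $p$ on a function space indicates $\Lambda$-periodicity in the space variables. $\partial_x=(\partial_1,\dots,\partial_d)$ is the spatial gradient. Standing assumptions. $f=(f_1,\dots,f_d)$ with $f_j\in C^s(\mathbb{R})$ for an integer $s>4+[d/2]$ ($[\cdot]$ is the integer part). $\mu\ge0$ is a Radon measure on $\mathbb{R}^d\setminus\{0\}$ with $\int_{|z|>0}|z|^2\wedge1\,d\mu(z)<\infty$, where $a\wedge b=\min(a,b)$. The initial datum belongs to $L^\infty(\Lambda)\cap BV(\Lambda)$ and is $\Lambda$-periodic. The initial value problem is $\partial_tu+\partial_x\cdot f(u)=\mathcal{L}^\mu[u]$ in $D_T$, $u(x,0)=u_0(x)$ in $\Lambda$, where $$\mathcal{L}^\mu[\phi](x)=\int_{|z|>0}\phi(x+z)-\phi(x)-z\cdot\partial_x\phi(x)\mathbf{1}_{|z|<1}\,d\mu(z).$$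 For $r>0$ set $$\mathcal{L}^{*,\mu}_r[\phi](x)=\int_{|z|\le r}\phi(x-z)-\phi(x)+z\cdot\partial_x\phi(x)\mathbf{1}_{|z|<1}\,d\mu(z),$$ $$\mathcal{L}^{\mu,r}[\phi](x)=\int_{|z|>r}\phi(x+z)-\phi(x)\,d\mu(z),\qquad \gamma_\mu^r=\int_{r<|z|<1}z\,d\mu(z)$$ (with $\gamma_\mu^r=0$ if $r>1$), and $\eta(u,k)=|u-k|$, $\eta'(u,k)=\mathrm{sgn}(u-k)$, $q_j(u,k)=\eta'(u,k)(f_j(u)-f_j(k))$, $q=(q_1,\dots,q_d)$. Definition. $u$ is a periodic entropy solution of the initial value problem with datum $u_0$ if: (i) $u\in C([0,T];L^\infty_p(\mathbb{R}^d))$; (ii) for all $k\in\mathbb{R}$, all $r>0$, and all nonnegative $\varphi\in C_p^\infty(\mathbb{R}^d\times(0,T))$ (smooth, $\Lambda$-periodic in $x$) with compact support in time in $(0,T)$, $$\iint_{D_T}\eta(u,k)\partial_t\varphi+q(u,k)\cdot\partial_x\varphi+\eta(u,k)\mathcal{L}^{*,\mu}_r[\varphi]+\eta'(u,k)\mathcal{L}^{\mu,r}[u]\varphi+\eta(u,k)\gamma_\mu^r\cdot\partial_x\varphi\;dx\,dt\ge0;$$ (iii) $\mathrm{esslim}_{t\to0}\|u(\cdot,t)-u_0\|_{L^1(\Lambda)}=0$. *)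

theory Defs
  imports "HOL-Probability.Probability"
begin

text \<open>Intended for open \<open>S\<close> only: the derivatives are taken at \<open>x\<close>, not within \<open>S\<close>.\<close>

primrec Ck_on :: "nat \<Rightarrow> 'a::euclidean_space set \<Rightarrow> ('a \<Rightarrow> real) \<Rightarrow> bool" where
  "Ck_on 0 S g \<longleftrightarrow> continuous_on S g"
| "Ck_on (Suc k) S g \<longleftrightarrow>
     (\<forall>x\<in>S. g differentiable (at x)) \<and>
     (\<forall>b\<in>Basis. Ck_on k S (\<lambda>x. frechet_derivative g (at x) b))"

definition smooth_on :: "'a::euclidean_space set \<Rightarrow> ('a \<Rightarrow> real) \<Rightarrow> bool" where
  "smooth_on S g \<longleftrightarrow> (\<forall>k. Ck_on k S g)"

definition grad :: "(real^'d \<Rightarrow> real) \<Rightarrow> real^'d \<Rightarrow> real^'d" where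
  "grad g x = (\<chi> i. frechet_derivative g (at x) (axis i 1))"

definition divergence :: "(real^'d \<Rightarrow> real^'d) \<Rightarrow> real^'d \<Rightarrow> real" where
  "divergence \<psi> x = (\<Sum>i\<in>UNIV. frechet_derivative (\<lambda>y. \<psi> y $ i) (at x) (axis i 1))"

definition Lam :: "(real^'d) set" where
  "Lam = {x. \<forall>i. 0 < x $ i \<and> x $ i < 2 * pi}"

text \<open>
  Elements of Lebesgue spaces are given by representatives, so periodicity is required
  almost everywhere only.
\<close>

definition ae_periodic :: "(real^'d \<Rightarrow> real) \<Rightarrow> bool" where
  "ae_periodic g \<longleftrightarrow> (\<forall>i. AE x in lborel. g (x + axis i (2 * pi)) = g x)"

definition Linf_norm :: "'a measure \<Rightarrow> ('a \<Rightarrow> real) \<Rightarrow> ennreal" where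
  "Linf_norm M g = esssup M (\<lambda>x. ennreal \<bar>g x\<bar>)"

definition in_Linf :: "'a measure \<Rightarrow> ('a \<Rightarrow> real) \<Rightarrow> bool" where
  "in_Linf M g \<longleftrightarrow> g \<in> borel_measurable M \<and> Linf_norm M g < \<infinity>"

definition L1_norm :: "'a measure \<Rightarrow> ('a \<Rightarrow> real) \<Rightarrow> ennreal" where
  "L1_norm M g = (\<integral>\<^sup>+ x. ennreal \<bar>g x\<bar> \<partial>M)"

definition BV_test :: "(real^'d) set \<Rightarrow> (real^'d \<Rightarrow> real^'d) \<Rightarrow> bool" where
  "BV_test S \<psi> \<longleftrightarrow>
     (\<forall>i. Ck_on 1 UNIV (\<lambda>x. \<psi> x $ i)) \<and>
     (\<exists>K. compact K \<and> K \<subseteq> S \<and> (\<forall>x. x \<notin> K \<longrightarrow> \<psi> x = 0)) \<and>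
     (\<forall>x. norm (\<psi> x) \<le> 1)"

definition in_BV :: "(real^'d) set \<Rightarrow> (real^'d \<Rightarrow> real) \<Rightarrow> bool" where
  "in_BV S g \<longleftrightarrow> integrable (lebesgue_on S) g \<and>
     bdd_above {integral\<^sup>L (lebesgue_on S) (\<lambda>x. g x * divergence \<psi> x) | \<psi>. BV_test S \<psi>}"

definition initial_datum :: "(real^'d \<Rightarrow> real) \<Rightarrow> bool" where
  "initial_datum g \<longleftrightarrow> in_Linf (lebesgue_on Lam) g \<and> in_BV Lam g \<and> ae_periodic g"

text \<open>
  \<open>u \<in> C([0,T]; L\<^sup>\<infinity>\<^sub>p(\<real>\<^sup>d))\<close>, with respect to the \<open>L\<^sup>\<infinity>\<close> norm. Every such
  class has a jointly Borel measurable representative, and \<open>u\<close> is taken to be one: then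
  \<open>z \<mapsto> u (x + z) t\<close> is Borel measurable for every \<open>x\<close> and \<open>t \<in> [0,T]\<close>, so that it can
  be integrated against an arbitrary, possibly singular, Borel measure. By Fubini's theorem,
  the choice of the Borel representative does not affect the entropy inequality below.
\<close>

definition C_Linf_per :: "real \<Rightarrow> (real^'d \<Rightarrow> real \<Rightarrow> real) \<Rightarrow> bool" where
  "C_Linf_per T u \<longleftrightarrow>
     (\<lambda>(x, t). u x t) \<in> borel_measurable (restrict_space borel (UNIV \<times> {0..T})) \<and>
     (\<forall>t\<in>{0..T}. in_Linf lborel (\<lambda>x. u x t) \<and> ae_periodic (\<lambda>x. u x t)) \<and>
     (\<forall>t\<in>{0..T}. ((\<lambda>s. Linf_norm lborel (\<lambda>x. u x s - u x t)) \<longlongrightarrow> 0) (at t within {0..T}))"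

definition ess_tendsto_0 :: "real \<Rightarrow> (real \<Rightarrow> 'b::topological_space) \<Rightarrow> 'b \<Rightarrow> bool" where
  "ess_tendsto_0 T g l \<longleftrightarrow>
     (\<exists>N\<in>null_sets lborel. (g \<longlongrightarrow> l) (at 0 within ({0<..<T} - N)))"

definition radon_on :: "'a::topological_space set \<Rightarrow> 'a measure \<Rightarrow> bool" where
  "radon_on S \<mu> \<longleftrightarrow>
     sets \<mu> = sets (restrict_space borel S) \<and>
     (\<forall>K. compact K \<and> K \<subseteq> S \<longrightarrow> emeasure \<mu> K < \<infinity>) \<and>
     (\<forall>A\<in>sets \<mu>. emeasure \<mu> A = (SUP K\<in>{K. compact K \<and> K \<subseteq> A}. emeasure \<mu> K))"

text \<open>
  The space of \<open>\<mu>\<close> is the punctured space, so integrals over \<open>\<mu>\<close> exclude \<open>z = 0\<close>.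
\<close>

definition levy_measure :: "(real^'d) measure \<Rightarrow> bool" where
  "levy_measure \<mu> \<longleftrightarrow> radon_on (- {0}) \<mu> \<and>
     (\<integral>\<^sup>+ z. ennreal (min ((norm z)\<^sup>2) 1) \<partial>\<mu>) < \<infinity>"

definition levy_adj :: "(real^'d) measure \<Rightarrow> real \<Rightarrow> (real^'d \<Rightarrow> real) \<Rightarrow> real^'d \<Rightarrow> real" where
  "levy_adj \<mu> r g x =
     (LINT z:{z. norm z \<le> r}|\<mu>.
        g (x - z) - g x + (z \<bullet> grad g x) * of_bool (norm z < 1))"

definition levy_far :: "(real^'d) measure \<Rightarrow> real \<Rightarrow> (real^'d \<Rightarrow> real) \<Rightarrow> real^'d \<Rightarrow> real" where
  "levy_far \<mu> r g x = (LINT z:{z. norm z > r}|\<mu>. g (x + z) - g x)"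

definition gamma_drift :: "(real^'d) measure \<Rightarrow> real \<Rightarrow> real^'d" where
  "gamma_drift \<mu> r = (LINT z:{z. r < norm z \<and> norm z < 1}|\<mu>. z)"

definition eta :: "real \<Rightarrow> real \<Rightarrow> real" where
  "eta u k = \<bar>u - k\<bar>"

definition eta' :: "real \<Rightarrow> real \<Rightarrow> real" where
  "eta' u k = sgn (u - k)"

definition qflux :: "(real \<Rightarrow> real^'d) \<Rightarrow> real \<Rightarrow> real \<Rightarrow> real^'d" where
  "qflux f u k = (\<chi> j. eta' u k * (f u $ j - f k $ j))"

text \<open>
  Only the values of \<open>\<phi> x t\<close> with \<open>0 < t < T\<close> are relevant.
\<close>

definition entropy_test :: "real \<Rightarrow> (real^'d \<Rightarrow> real \<Rightarrow> real) \<Rightarrow> bool" where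
  "entropy_test T \<phi> \<longleftrightarrow>
     smooth_on (UNIV \<times> {0<..<T}) (\<lambda>(x, t). \<phi> x t) \<and>
     (\<forall>x. \<forall>t\<in>{0<..<T}. 0 \<le> \<phi> x t \<and> (\<forall>i. \<phi> (x + axis i (2 * pi)) t = \<phi> x t)) \<and>
     (\<exists>K. compact K \<and> K \<subseteq> {0<..<T} \<and> (\<forall>x. \<forall>t\<in>{0<..<T} - K. \<phi> x t = 0))"

definition entropy_integrand ::
  "(real \<Rightarrow> real^'d) \<Rightarrow> (real^'d) measure \<Rightarrow> real \<Rightarrow> real \<Rightarrow> (real^'d \<Rightarrow> real \<Rightarrow> real) \<Rightarrow>
   (real^'d \<Rightarrow> real \<Rightarrow> real) \<Rightarrow> real^'d \<Rightarrow> real \<Rightarrow> real" where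
  "entropy_integrand f \<mu> k r \<phi> u x t =
     eta (u x t) k * deriv (\<lambda>s. \<phi> x s) t
     + qflux f (u x t) k \<bullet> grad (\<lambda>y. \<phi> y t) x
     + eta (u x t) k * levy_adj \<mu> r (\<lambda>y. \<phi> y t) x
     + eta' (u x t) k * levy_far \<mu> r (\<lambda>y. u y t) x * \<phi> x t
     + eta (u x t) k * (gamma_drift \<mu> r \<bullet> grad (\<lambda>y. \<phi> y t) x)"

definition periodic_entropy_solution ::
  "(real \<Rightarrow> real^'d) \<Rightarrow> (real^'d) measure \<Rightarrow> real \<Rightarrow> (real^'d \<Rightarrow> real) \<Rightarrow>
   (real^'d \<Rightarrow> real \<Rightarrow> real) \<Rightarrow> bool" where
  "periodic_entropy_solution f \<mu> T u\<^sub>0 u \<longleftrightarrow>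
     C_Linf_per T u \<and>
     (\<forall>k r \<phi>. 0 < r \<longrightarrow> entropy_test T \<phi> \<longrightarrow>
        0 \<le> (LINT (x, t):(Lam \<times> {0<..<T})|lborel. entropy_integrand f \<mu> k r \<phi> u x t)) \<and>
     ess_tendsto_0 T (\<lambda>t. L1_norm (lebesgue_on Lam) (\<lambda>x. u x t - u\<^sub>0 x)) 0"

end

theory Submission
  imports Defs
begin

text \<open>The proof is Kruzkov's doubling of the variables for the nonlocal operator.

Take a smooth periodic even kernel \<open>\<omega> \<ge> 0\<close> on space and a smooth symmetric \<open>\<psi> \<ge> 0\<close> on pairs of
times. In the entropy inequality of \<open>u\<close> at \<open>(x, t)\<close> choose the constant \<open>k = v(y, s)\<close> and the test
function \<open>\<omega>(x - y) \<psi>(t, s)\<close>, in that of \<open>v\<close> at \<open>(y, s)\<close> choose \<open>k = u(x, t)\<close> and the same function of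
\<open>(y, s)\<close>; integrate each over the remaining variables and add. The fluxes cancel, because
\<open>q(a, b) = q(b, a)\<close> and \<open>\<omega>\<close> has an odd gradient, and so do the drift terms. The singular parts of
the operator are at most \<open>C \<integral>\<^bsub>|z| \<le> r\<^esub> |z|\<^sup>2 d\<mu>\<close> by Taylor's formula, hence tend to \<open>0\<close> with \<open>r\<close> as
long as \<open>\<omega>\<close> stays fixed. For the far parts,
\<open>sgn(a - b) ((a' - a) - (b' - b)) \<le> |a' - b'| - |a - b|\<close> with \<open>a' = u(x + z, t)\<close> and
\<open>b' = v(y + z, s)\<close>; integrated against \<open>\<omega>(x - y)\<close> over two periodicity cells the bound is \<open>0\<close>, since
shifting \<open>x\<close> and \<open>y\<close> by the same \<open>z\<close> changes neither \<open>x - y\<close> nor the integral of a periodic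
function. What remains (lemma \<open>doubling_inequality\<close>, and \<open>r \<rightarrow> 0\<close> in \<open>kernel_contraction\<close>) is
\<open>0 \<le> \<integral>\<integral> |u(x, t) - v(y, s)| \<omega>(x - y) (\<partial>\<^sub>t + \<partial>\<^sub>s) \<psi>(t, s)\<close>.

Time comes first. Both solutions are continuous in time with values in \<open>L\<^sup>\<infinity>\<close>, so a \<open>\<psi>\<close>
concentrated near the diagonal for which \<open>(\<partial>\<^sub>t + \<partial>\<^sub>s) \<psi>\<close> is a bump at \<open>(c\<^sub>1, c\<^sub>1)\<close> minus the same
bump at \<open>(c\<^sub>2, c\<^sub>2)\<close> gives, for every fixed kernel,
\<open>\<integral>\<integral> |u(x, c\<^sub>2) - v(y, c\<^sub>2)| \<omega>(x - y) \<le> \<integral>\<integral> |u(x, c\<^sub>1) - v(y, c\<^sub>1)| \<omega>(x - y)\<close> (\<open>time_localisation\<close>).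
Only then does \<open>\<omega>\<close> concentrate at the origin, at two fixed times: continuity of translations in
\<open>L\<^sup>1\<close> (\<open>translation_continuous_L1\<close>, \<open>kernel_distance_concentrates\<close>) turns this into
\<open>\<parallel>u(c\<^sub>2) - v(c\<^sub>2)\<parallel> \<le> \<parallel>u(c\<^sub>1) - v(c\<^sub>1)\<parallel>\<close> in \<open>L\<^sup>1\<close> of the cell, and \<open>c\<^sub>1 \<rightarrow> 0\<close> along the initial condition
finishes the proof.

A solution is first replaced by a Borel representative that is bounded and periodic at every
point. This leaves the entropy inequality unchanged, and all integrands of the doubling
argument become bounded Borel functions on finite measure spaces, where Fubini's theorem applies
without further ado.\<close>

section \<open>Smooth functions\<close>

lemma frechet_derivative_transform_open:
  fixes g h :: "'a::euclidean_space \<Rightarrow> real"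
  assumes "open S" "x \<in> S" "\<And>y. y \<in> S \<Longrightarrow> g y = h y"
  shows "g differentiable (at x) \<longleftrightarrow> h differentiable (at x)"
    and "frechet_derivative g (at x) = frechet_derivative h (at x)"
proof -
  have eq: "(g has_derivative D) (at x) \<longleftrightarrow> (h has_derivative D) (at x)" for D
    using assms has_derivative_transform_within_open[of _ _ _ UNIV S] by metis
  then show "g differentiable (at x) \<longleftrightarrow> h differentiable (at x)"
    by (simp add: differentiable_def)
  show "frechet_derivative g (at x) = frechet_derivative h (at x)"
    by (simp add: frechet_derivative_def eq)
qed

lemma Ck_on_cong:
  assumes "open S" "\<And>x. x \<in> S \<Longrightarrow> g x = h x"
  shows "Ck_on k S g \<longleftrightarrow> Ck_on k S h"
  using assms(2)
proof (induction k arbitrary: g h)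
  case 0
  then show ?case by (simp cong: continuous_on_cong)
next
  case (Suc k)
  note eq = frechet_derivative_transform_open[OF assms(1) _ Suc.prems]
  have "Ck_on k S (\<lambda>x. frechet_derivative g (at x) b) \<longleftrightarrow>
      Ck_on k S (\<lambda>x. frechet_derivative h (at x) b)" for b
    by (rule Suc.IH) (simp add: eq(2))
  then show ?case by (simp add: eq(1))
qed

lemma Ck_on_Suc_imp_Ck_on: "Ck_on (Suc k) S g \<Longrightarrow> Ck_on k S g"
proof (induction k arbitrary: g)
  case 0
  then show ?case
    by (auto intro!: continuous_at_imp_continuous_on differentiable_imp_continuous_within)
next
  case (Suc k)
  then show ?case by (metis Ck_on.simps(2))
qed

lemma Ck_on_antimono: "Ck_on m S g \<Longrightarrow> k \<le> m \<Longrightarrow> Ck_on k S g"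
  by (induction m) (auto simp: le_Suc_eq simp del: Ck_on.simps(2) dest: Ck_on_Suc_imp_Ck_on)

lemma smooth_on_Suc_iff:
  "smooth_on S g \<longleftrightarrow> (\<forall>x\<in>S. g differentiable (at x)) \<and>
     (\<forall>b\<in>Basis. smooth_on S (\<lambda>x. frechet_derivative g (at x) b))"
proof -
  have "smooth_on S g \<longleftrightarrow> (\<forall>k. Ck_on (Suc k) S g)"
    unfolding smooth_on_def using Ck_on_Suc_imp_Ck_on by blast
  then show ?thesis by (auto simp: smooth_on_def)
qed

lemma smooth_on_differentiable: "smooth_on S g \<Longrightarrow> x \<in> S \<Longrightarrow> g differentiable (at x)"
  using smooth_on_Suc_iff by blast

lemma smooth_on_partial:
  "smooth_on S g \<Longrightarrow> b \<in> Basis \<Longrightarrow> smooth_on S (\<lambda>x. frechet_derivative g (at x) b)"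
  using smooth_on_Suc_iff by blast

lemma smooth_on_continuous_on: "smooth_on S g \<Longrightarrow> continuous_on S g"
  unfolding smooth_on_def by (metis Ck_on.simps(1))

lemma smooth_on_cong:
  "open S \<Longrightarrow> (\<And>x. x \<in> S \<Longrightarrow> g x = h x) \<Longrightarrow> smooth_on S g \<longleftrightarrow> smooth_on S h"
  unfolding smooth_on_def using Ck_on_cong by blast

lemma smooth_on_const: "smooth_on S (\<lambda>x. c)"
proof -
  have "Ck_on k S (\<lambda>x. c)" for k
  proof (induction k arbitrary: c)
    case (Suc k)
    show ?case using Suc.IH[of 0] by (simp add: frechet_derivative_const)
  qed simp
  then show ?thesis by (simp add: smooth_on_def)
qed

lemma smooth_on_inner: "smooth_on S (\<lambda>x. x \<bullet> a)"
proof -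
  have "((\<lambda>x. x \<bullet> a) has_derivative (\<lambda>x. x \<bullet> a)) (at x)" for x
    by (auto intro!: derivative_eq_intros)
  then have "frechet_derivative (\<lambda>x. x \<bullet> a) (at x) = (\<lambda>x. x \<bullet> a)" for x
    using frechet_derivative_at by metis
  then show ?thesis
    by (subst smooth_on_Suc_iff) (auto intro!: smooth_on_const)
qed

lemma Ck_on_add:
  assumes S: "open S"
  shows "Ck_on k S g \<Longrightarrow> Ck_on k S h \<Longrightarrow> Ck_on k S (\<lambda>x. g x + h x)"
proof (induction k arbitrary: g h)
  case 0
  then show ?case by (auto intro: continuous_intros)
next
  case (Suc k)
  have "((\<lambda>x. g x + h x) has_derivative
      (\<lambda>b. frechet_derivative g (at x) b + frechet_derivative h (at x) b)) (at x)" if "x \<in> S" for x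
    using Suc.prems that by (auto intro!: derivative_eq_intros simp: frechet_derivative_works[symmetric])
  note der = this
  then have "(\<lambda>x. g x + h x) differentiable (at x)" if "x \<in> S" for x
    using that by (auto simp: differentiable_def)
  moreover have "Ck_on k S (\<lambda>x. frechet_derivative (\<lambda>x. g x + h x) (at x) b)" if "b \<in> Basis" for b
  proof (subst Ck_on_cong[OF S])
    show "frechet_derivative (\<lambda>x. g x + h x) (at x) b
      = frechet_derivative g (at x) b + frechet_derivative h (at x) b" if "x \<in> S" for x
      by (simp add: frechet_derivative_at[OF der[OF that], symmetric])
  qed (use Suc that in auto)
  ultimately show ?case by simp
qed

lemma smooth_on_add:
  "open S \<Longrightarrow> smooth_on S g \<Longrightarrow> smooth_on S h \<Longrightarrow> smooth_on S (\<lambda>x. g x + h x)"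
  unfolding smooth_on_def using Ck_on_add by blast

lemma Ck_on_mult:
  assumes S: "open S"
  shows "Ck_on k S g \<Longrightarrow> Ck_on k S h \<Longrightarrow> Ck_on k S (\<lambda>x. g x * h x)"
proof (induction k arbitrary: g h)
  case 0
  then show ?case by (auto intro: continuous_intros)
next
  case (Suc k)
  have "((\<lambda>x. g x * h x) has_derivative
      (\<lambda>b. g x * frechet_derivative h (at x) b + frechet_derivative g (at x) b * h x)) (at x)"
    if "x \<in> S" for x
    using Suc.prems that
    by (auto intro!: has_derivative_mult simp: frechet_derivative_works[symmetric])
  note der = this
  then have "(\<lambda>x. g x * h x) differentiable (at x)" if "x \<in> S" for x
    using that by (auto simp: differentiable_def)
  moreover have "Ck_on k S (\<lambda>x. frechet_derivative (\<lambda>x. g x * h x) (at x) b)" if "b \<in> Basis" for b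
  proof (subst Ck_on_cong[OF S])
    show "frechet_derivative (\<lambda>x. g x * h x) (at x) b
      = g x * frechet_derivative h (at x) b + frechet_derivative g (at x) b * h x" if "x \<in> S" for x
      by (simp add: frechet_derivative_at[OF der[OF that], symmetric])
    show "Ck_on k S (\<lambda>x. g x * frechet_derivative h (at x) b + frechet_derivative g (at x) b * h x)"
      using Suc.prems that Ck_on_Suc_imp_Ck_on[of k S g] Ck_on_Suc_imp_Ck_on[of k S h]
      by (intro Ck_on_add[OF S] Suc.IH) auto
  qed
  ultimately show ?case by simp
qed

lemma smooth_on_mult:
  "open S \<Longrightarrow> smooth_on S g \<Longrightarrow> smooth_on S h \<Longrightarrow> smooth_on S (\<lambda>x. g x * h x)"
  unfolding smooth_on_def using Ck_on_mult by blast

lemma smooth_on_prod: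
  "open S \<Longrightarrow> (\<And>i. i \<in> I \<Longrightarrow> smooth_on S (g i)) \<Longrightarrow> smooth_on S (\<lambda>x. \<Prod>i\<in>I. g i x)"
proof (induction I rule: infinite_finite_induct)
  case (insert i I)
  then show ?case by (simp add: smooth_on_mult)
qed (auto intro: smooth_on_const)

text \<open>The chain rule for a function of one real variable that is given by the sequence of its
derivatives. The induction has to run through the whole sequence, because each differentiation
replaces \<open>D m\<close> by \<open>D (Suc m)\<close>.\<close>

lemma smooth_on_compose_real:
  fixes D :: "nat \<Rightarrow> real \<Rightarrow> real"
  assumes S: "open S" and D: "\<And>m x. (D m has_real_derivative D (Suc m) x) (at x)"
    and h: "smooth_on S h"
  shows "smooth_on S (\<lambda>x. D m (h x))"
proof -
  have "Ck_on k S (\<lambda>x. D m (h x))" for k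
  proof (induction k arbitrary: m)
    case 0
    have "continuous_on UNIV (D m)"
      using D by (auto intro!: continuous_at_imp_continuous_on DERIV_isCont)
    then show ?case
      using smooth_on_continuous_on[OF h] by (auto intro: continuous_on_compose2)
  next
    case (Suc k)
    have "((\<lambda>x. D m (h x)) has_derivative (\<lambda>b. frechet_derivative h (at x) b * D (Suc m) (h x))) (at x)"
      if "x \<in> S" for x
    proof -
      have "(h has_derivative frechet_derivative h (at x)) (at x)"
        using smooth_on_differentiable[OF h that] by (simp add: frechet_derivative_works)
      from has_derivative_compose[OF this, of "D m" "\<lambda>b. b * D (Suc m) (h x)"] D[of m "h x"] show ?thesis
        by (simp add: has_field_derivative_def mult.commute[of _ "D (Suc m) (h x)"])
    qed
    note der = this
    then have "(\<lambda>x. D m (h x)) differentiable (at x)" if "x \<in> S" for x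
      using that by (auto simp: differentiable_def)
    moreover have "Ck_on k S (\<lambda>x. frechet_derivative (\<lambda>x. D m (h x)) (at x) b)" if "b \<in> Basis" for b
    proof (subst Ck_on_cong[OF S])
      show "frechet_derivative (\<lambda>x. D m (h x)) (at x) b = frechet_derivative h (at x) b * D (Suc m) (h x)"
        if "x \<in> S" for x
        by (simp add: frechet_derivative_at[OF der[OF that], symmetric])
      show "Ck_on k S (\<lambda>x. frechet_derivative h (at x) b * D (Suc m) (h x))"
        using smooth_on_partial[OF h that] Suc.IH
        by (intro Ck_on_mult[OF S]) (auto simp: smooth_on_def)
    qed
    ultimately show ?case by simp
  qed
  then show ?thesis by (simp add: smooth_on_def)
qed

lemma smooth_on_cos:
  assumes "open S" "smooth_on S h"
  shows "smooth_on S (\<lambda>x. cos (h x))"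
proof -
  have "((\<lambda>x. cos (x + real m * (pi/2))) has_real_derivative cos (x + real (Suc m) * (pi/2))) (at x)" for m x
  proof -
    have "x + real (Suc m) * (pi/2) = (x + real m * (pi/2)) + pi/2" by (simp add: algebra_simps)
    then have "cos (x + real (Suc m) * (pi/2)) = - sin (x + real m * (pi/2))"
      by (simp only: cos_add cos_pi_half sin_pi_half)
    then show ?thesis by (auto intro!: derivative_eq_intros)
  qed
  from smooth_on_compose_real[OF assms(1), of "\<lambda>m x. cos (x + real m * (pi/2))", OF this assms(2), of 0]
  show ?thesis by simp
qed

section \<open>A smooth cutoff\<close>

text \<open>The functions \<open>p(1/x) e\<^sup>-\<^sup>1\<^sup>/\<^sup>x\<close> on the positive half-line, continued by zero: this class is closed
under differentiation, which makes its members smooth at the origin.\<close>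

definition flat_exp :: "real poly \<Rightarrow> real \<Rightarrow> real" where
  "flat_exp p x = (if x > 0 then poly p (1 / x) * exp (- (1 / x)) else 0)"

lemma flat_exp_tendsto_0: "(flat_exp p \<longlongrightarrow> 0) (at 0)"
proof -
  have *: "((\<lambda>y. poly p y / exp y) \<longlongrightarrow> 0) at_top"
    unfolding poly_altdef sum_divide_distrib times_divide_eq_right[symmetric]
    by (intro tendsto_null_sum tendsto_mult_right_zero tendsto_power_div_exp_0)
  have "((\<lambda>x. poly p (inverse x) / exp (inverse x)) \<longlongrightarrow> 0) (at_right 0)"
    using filterlim_compose[OF * filterlim_inverse_at_top_right] .
  then have "(flat_exp p \<longlongrightarrow> 0) (at_right 0)"
    by (rule tendsto_cong[THEN iffD1, rotated])
      (auto simp: eventually_at_filter flat_exp_def exp_minus field_simps)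
  moreover have "(flat_exp p \<longlongrightarrow> 0) (at_left 0)"
    by (rule tendsto_eventually) (auto simp: eventually_at_filter flat_exp_def)
  ultimately show ?thesis by (simp add: filterlim_split_at)
qed

text \<open>At the origin the difference quotient of \<open>flat_exp p\<close> is \<open>flat_exp ([:0, 1:] * p)\<close>, which tends to
zero; elsewhere this is the product rule.\<close>

lemma flat_exp_derivative:
  "(flat_exp p has_real_derivative flat_exp ([:0, 0, 1:] * (p - pderiv p)) x) (at x)"
proof (cases x "0 :: real" rule: linorder_cases)
  case equal
  have "(flat_exp p has_real_derivative 0) (at 0)"
  proof -
    have "((\<lambda>h. (flat_exp p (0 + h) - flat_exp p 0) / h) \<longlongrightarrow> 0) (at 0)"
      by (rule tendsto_cong[THEN iffD1, OF _ flat_exp_tendsto_0[of "[:0, 1:] * p"]])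
        (auto simp: flat_exp_def eventually_at_filter)
    then show ?thesis by (simp add: DERIV_def)
  qed
  then show ?thesis using equal by (simp add: flat_exp_def)
next
  case greater
  have "((\<lambda>x. poly p (1 / x) * exp (- (1 / x))) has_real_derivative
      flat_exp ([:0, 0, 1:] * (p - pderiv p)) x) (at x)"
    using greater
    by (auto intro!: derivative_eq_intros poly_DERIV[THEN DERIV_chain2]
        simp: flat_exp_def field_simps power2_eq_square)
  then show ?thesis
    by (rule has_field_derivative_transform_within[OF _ greater]) (auto simp: flat_exp_def dist_real_def)
next
  case less
  have "((\<lambda>x. 0) has_real_derivative 0) (at x)" by simp
  then have "(flat_exp p has_real_derivative 0) (at x)"
    by (rule has_field_derivative_transform_within[where d = "-x"])
      (use less in \<open>auto simp: flat_exp_def dist_real_def\<close>)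
  then show ?thesis using less by (simp add: flat_exp_def)
qed

definition cutoff :: "real \<Rightarrow> real" where
  "cutoff = flat_exp 1"

lemma cutoff_nonneg: "0 \<le> cutoff x" and cutoff_pos_iff: "0 < cutoff x \<longleftrightarrow> 0 < x"
  and cutoff_eq_0_iff: "cutoff x = 0 \<longleftrightarrow> x \<le> 0"
  by (auto simp: cutoff_def flat_exp_def)

lemma smooth_on_cutoff:
  assumes "open S" "smooth_on S h"
  shows "smooth_on S (\<lambda>x. cutoff (h x))"
proof -
  define D where "D m = flat_exp (((\<lambda>p. [:0, 0, 1:] * (p - pderiv p)) ^^ m) 1)" for m
  have "(D m has_real_derivative D (Suc m) x) (at x)" for m x
    using flat_exp_derivative by (simp add: D_def)
  from smooth_on_compose_real[OF assms(1), of D, OF this assms(2), of 0]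
  show ?thesis by (simp add: D_def cutoff_def)
qed

section \<open>Periodic functions and mollifiers\<close>

definition periodic :: "(real^'d \<Rightarrow> 'b) \<Rightarrow> bool" where
  "periodic g \<longleftrightarrow> (\<forall>x i. g (x + axis i (2 * pi)) = g x)"

definition lattice_vec :: "int^'d \<Rightarrow> real^'d" where
  "lattice_vec n = (\<chi> i. 2 * pi * of_int (n $ i))"

lemma lattice_vec_minus: "lattice_vec (- n) = - lattice_vec n"
  by (simp add: lattice_vec_def vec_eq_iff)

text \<open>One induction principle serves pointwise periodicity and periodicity almost everywhere: in both
cases the admissible shifts are closed under adding and subtracting a period.\<close>

lemma lattice_induct [case_names zero plus minus]:
  fixes P :: "real^'d \<Rightarrow> bool"
  assumes "P 0" and plus: "\<And>a i. P a \<Longrightarrow> P (a + axis i (2 * pi))"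
    and minus: "\<And>a i. P a \<Longrightarrow> P (a - axis i (2 * pi))"
  shows "P (lattice_vec n)"
proof -
  have axis_add: "axis i (a + b) = (axis i a + axis i b :: real^'d)"
    and axis_diff: "axis i (a - b) = (axis i a - axis i b :: real^'d)" for i a b
    by (simp_all add: vec_eq_iff axis_def)
  have multiple: "P (a + axis i (2 * pi * of_int k))" if a: "P a" for a i k
  proof (induction k rule: int_induct[of _ 0])
    case base
    have "axis i 0 = (0 :: real^'d)" by (simp add: vec_eq_iff axis_def)
    then show ?case using a by (simp only: of_int_0 mult_zero_right add_0_right)
  next
    case (step1 k)
    have "a + axis i (2 * pi * of_int (k + 1)) = a + axis i (2 * pi * of_int k) + axis i (2 * pi)"
      by (simp only: of_int_add of_int_1 distrib_left mult_1_right axis_add add.assoc)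
    then show ?case using plus[OF step1(2), of i] by (simp only:)
  next
    case (step2 k)
    have "a + axis i (2 * pi * of_int (k - 1)) = a + axis i (2 * pi * of_int k) - axis i (2 * pi)"
      by (simp only: of_int_diff of_int_1 right_diff_distrib mult_1_right axis_diff add_diff_eq)
    then show ?case using minus[OF step2(2), of i] by (simp only:)
  qed
  have "P (\<Sum>i\<in>A. axis i (2 * pi * of_int (n $ i)))" for A
  proof (induction A rule: infinite_finite_induct)
    case (insert i A)
    then show ?case using multiple[OF insert.IH, of i "n $ i"] by (simp add: add.commute)
  qed (simp_all add: assms(1))
  moreover have "(\<Sum>i\<in>UNIV. axis i (2 * pi * of_int (n $ i))) = lattice_vec n"
    by (simp add: vec_eq_iff lattice_vec_def axis_def sum_component)
  ultimately show ?thesis by metis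
qed

lemma periodic_lattice:
  assumes "periodic g" shows "g (x + lattice_vec n) = g x"
proof -
  have per: "g (y + axis i (2 * pi)) = g y" for y i
    using assms by (simp add: periodic_def)
  show ?thesis
  proof (induction rule: lattice_induct[where P = "\<lambda>a. g (x + a) = g x"])
    case (plus a i)
    then show ?case using per[of "x + a" i] by (simp add: add.assoc)
  next
    case (minus a i)
    then show ?case using per[of "x + (a - axis i (2 * pi))" i] by (simp add: algebra_simps)
  qed simp
qed

definition floor_vec :: "real^'d \<Rightarrow> int^'d" where
  "floor_vec x = (\<chi> i. \<lfloor>x $ i / (2 * pi)\<rfloor>)"

text \<open>The representative of \<open>x\<close> modulo the lattice in the half-open cell.\<close>

definition wrap :: "real^'d \<Rightarrow> real^'d" where
  "wrap x = x - lattice_vec (floor_vec x)"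

definition half_open_cell :: "(real^'d) set" where
  "half_open_cell = {x. \<forall>i. 0 \<le> x $ i \<and> x $ i < 2 * pi}"

lemma wrap_nth: "wrap x $ i = 2 * pi * frac (x $ i / (2 * pi))"
  by (simp add: wrap_def lattice_vec_def floor_vec_def frac_def algebra_simps)

lemma wrap_in_half_open_cell: "wrap x \<in> half_open_cell"
  using frac_lt_1 by (auto simp: half_open_cell_def wrap_nth)

lemma nth_measurable [measurable]: "(\<lambda>x :: real^'d. x $ i) \<in> borel_measurable borel"
  by (intro borel_measurable_continuous_onI continuous_intros)

lemma measurable_vecI:
  fixes g :: "'a \<Rightarrow> real^'d"
  assumes "\<And>i. (\<lambda>x. g x $ i) \<in> borel_measurable M"
  shows "g \<in> borel_measurable M"
  by (rule borel_measurable_euclidean_space[THEN iffD2]) (auto simp: Basis_vec_def inner_axis assms)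

lemma wrap_measurable [measurable]: "(wrap :: real^'d \<Rightarrow> real^'d) \<in> borel_measurable borel"
proof (rule measurable_vecI)
  fix i
  have "(\<lambda>x::real^'d. 2 * pi * (x $ i / (2 * pi) - of_int \<lfloor>x $ i / (2 * pi)\<rfloor>)) \<in> borel_measurable borel"
    by measurable
  then show "(\<lambda>x::real^'d. wrap x $ i) \<in> borel_measurable borel"
    by (simp only: wrap_nth frac_def)
qed

lemma periodic_wrap: "periodic (wrap :: real^'d \<Rightarrow> real^'d)"
proof -
  have "axis i (2 * pi) $ j / (2 * pi) = of_int (if i = j then 1 else 0)" for i j :: 'd
    by (simp add: axis_def)
  then have "frac (x $ j / (2 * pi) + axis i (2 * pi) $ j / (2 * pi)) = frac (x $ j / (2 * pi))"
    for x :: "real^'d" and i j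
    by (simp only: frac_add_of_int_right)
  then show ?thesis
    by (simp add: periodic_def vec_eq_iff wrap_nth add_divide_distrib)
qed

lemma periodic_eq_wrap: "periodic g \<Longrightarrow> g x = g (wrap x)"
  using periodic_lattice[of g x "- floor_vec x"] by (simp add: wrap_def lattice_vec_minus)

lemma periodic_bounded_if_continuous:
  fixes g :: "real^'d \<Rightarrow> 'b::real_normed_vector"
  assumes "periodic g" "continuous_on UNIV g"
  shows "\<exists>C\<ge>0. \<forall>x. norm (g x) \<le> C"
proof -
  have "compact (g ` cbox 0 (\<chi> i. 2 * pi))"
    using assms(2) by (intro compact_continuous_image compact_cbox) (auto intro: continuous_on_subset)
  then obtain C where C: "\<And>y. y \<in> g ` cbox 0 (\<chi> i. 2 * pi) \<Longrightarrow> norm y \<le> C"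
    by (meson bounded_iff compact_imp_bounded)
  have "wrap x \<in> cbox 0 (\<chi> i. 2 * pi)" for x
    using wrap_in_half_open_cell[of x] by (simp add: half_open_cell_def mem_box_cart less_imp_le)
  then have "norm (g x) \<le> C" for x using C periodic_eq_wrap[OF assms(1), of x] by auto
  then show ?thesis by (meson norm_ge_zero order_trans)
qed

lemma frechet_derivative_shift:
  fixes g :: "'a::real_normed_vector \<Rightarrow> 'b::real_normed_vector"
  shows "frechet_derivative (\<lambda>x. g (x + a)) (at x) = frechet_derivative g (at (x + a))"
proof -
  have "((\<lambda>x. g (x + a)) has_derivative D) (at x)"
    if D: "(g has_derivative D) (at (x + a))" for g :: "'a \<Rightarrow> 'b" and D x a
  proof -
    have "((\<lambda>x. x + a) has_derivative (\<lambda>x. x)) (at x)" by (auto intro!: derivative_eq_intros)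
    from has_derivative_compose[OF this D] show ?thesis .
  qed
  note shift = this
  have "((\<lambda>x. g (x + a)) has_derivative D) (at x) \<longleftrightarrow> (g has_derivative D) (at (x + a))" for D
  proof
    assume "((\<lambda>x. g (x + a)) has_derivative D) (at x)"
    then have "((\<lambda>x. g (x + a)) has_derivative D) (at ((x + a) + - a))" by simp
    from shift[OF this] show "(g has_derivative D) (at (x + a))" by simp
  qed (rule shift)
  then show ?thesis by (simp add: frechet_derivative_def)
qed

lemma periodic_frechet_derivative:
  "periodic g \<Longrightarrow> periodic (\<lambda>x. frechet_derivative g (at x) b)"
  by (simp add: periodic_def frechet_derivative_shift[symmetric])

lemma axis_in_Basis: "(axis i 1 :: real^'d) \<in> Basis"
  by (auto simp: Basis_vec_def)

lemma frechet_derivative_eq_grad: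
  assumes "g differentiable (at x)"
  shows "frechet_derivative g (at x) b = grad g x \<bullet> b"
proof -
  have lin: "linear (frechet_derivative g (at x))"
    using assms by (simp add: frechet_derivative_works has_derivative_linear)
  have "b = (\<Sum>i\<in>UNIV. (b $ i) *\<^sub>R axis i 1)"
    using basis_expansion[of b] by (simp add: scalar_mult_eq_scaleR)
  then have "frechet_derivative g (at x) b = frechet_derivative g (at x) (\<Sum>i\<in>UNIV. (b $ i) *\<^sub>R axis i 1)"
    by simp
  also have "\<dots> = grad g x \<bullet> b"
    by (simp add: linear_sum[OF lin] linear_scale[OF lin] inner_vec_def grad_def mult.commute)
  finally show ?thesis .
qed

lemma grad_eqI:
  assumes "(g has_derivative (\<lambda>b. v \<bullet> b)) (at x)" shows "grad g x = v"
  using frechet_derivative_at[OF assms, symmetric] by (simp add: grad_def vec_eq_iff inner_axis)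

lemma has_derivative_grad:
  "g differentiable (at x) \<Longrightarrow> (g has_derivative (\<lambda>b. grad g x \<bullet> b)) (at x)"
  by (simp add: frechet_derivative_eq_grad[symmetric] frechet_derivative_works[symmetric])

lemma grad_continuous: "smooth_on UNIV g \<Longrightarrow> continuous_on UNIV (grad g)"
  unfolding grad_def
  by (intro continuous_on_vec_lambda smooth_on_continuous_on smooth_on_partial) (auto simp: axis_in_Basis)

lemma periodic_grad: "periodic g \<Longrightarrow> periodic (grad g)"
  unfolding grad_def periodic_def by (auto simp: vec_eq_iff periodic_frechet_derivative[unfolded periodic_def])

lemma grad_bounded:
  assumes "smooth_on UNIV g" "periodic g"
  shows "\<exists>C\<ge>0. \<forall>x. norm (grad g x) \<le> C"
  by (intro periodic_bounded_if_continuous periodic_grad grad_continuous assms)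

lemma smooth_periodic_lipschitz:
  assumes "smooth_on UNIV g" "periodic g"
  shows "\<exists>C\<ge>0. \<forall>x y. \<bar>g x - g y\<bar> \<le> C * norm (x - y)"
proof -
  obtain C where C: "C \<ge> 0" "\<And>x. norm (grad g x) \<le> C" using grad_bounded[OF assms] by blast
  have "norm (g x - g y) \<le> C * norm (x - y)" for x y
  proof (rule differentiable_bound[of UNIV g "\<lambda>x b. grad g x \<bullet> b"])
    show "(g has_derivative (\<lambda>b. grad g x \<bullet> b)) (at x within UNIV)" for x
      using has_derivative_grad smooth_on_differentiable[OF assms(1)] by blast
    show "onorm (\<lambda>b. grad g x \<bullet> b) \<le> C" for x
      by (rule onorm_le) (metis C(2) Cauchy_Schwarz_ineq2 mult_right_mono norm_ge_zero order_trans real_norm_def)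
  qed auto
  then show ?thesis using C(1) by auto
qed

lemma grad_lipschitz:
  fixes g :: "real^'d \<Rightarrow> real"
  assumes "smooth_on UNIV g" "periodic g"
  shows "\<exists>C\<ge>0. \<forall>x y. norm (grad g x - grad g y) \<le> C * norm (x - y)"
proof -
  have "\<exists>C\<ge>0. \<forall>x y. \<bar>grad g x $ i - grad g y $ i\<bar> \<le> C * norm (x - y)" for i
    using smooth_periodic_lipschitz[OF smooth_on_partial[OF assms(1)] periodic_frechet_derivative[OF assms(2)]]
    by (simp add: grad_def axis_in_Basis)
  then obtain C where C: "\<And>i. C i \<ge> 0" "\<And>i x y. \<bar>grad g x $ i - grad g y $ i\<bar> \<le> C i * norm (x - y)"
    by metis
  have "norm (grad g x - grad g y) \<le> (\<Sum>i\<in>UNIV. C i) * norm (x - y)" for x y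
  proof -
    have "norm (grad g x - grad g y) \<le> (\<Sum>i\<in>UNIV. \<bar>grad g x $ i - grad g y $ i\<bar>)"
      using norm_le_l1_cart[of "grad g x - grad g y"] by simp
    also have "\<dots> \<le> (\<Sum>i\<in>UNIV. C i * norm (x - y))" by (intro sum_mono C(2))
    finally show ?thesis by (simp add: sum_distrib_right)
  qed
  then show ?thesis using C(1) by (meson sum_nonneg)
qed

text \<open>The mean value inequality for \<open>y \<mapsto> g y - grad g x \<bullet> y\<close>, whose gradient at \<open>y\<close> is bounded by a
multiple of \<open>|y - x|\<close> because \<open>grad g\<close> is Lipschitz. This is what makes the singular part of the
Levy operator converge.\<close>

lemma second_order_taylor:
  fixes g :: "real^'d \<Rightarrow> real"
  assumes "smooth_on UNIV g" "periodic g"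
  shows "\<exists>C\<ge>0. \<forall>x z. \<bar>g (x - z) - g x + z \<bullet> grad g x\<bar> \<le> C * (norm z)\<^sup>2"
proof -
  obtain C where C: "C \<ge> 0" "\<And>x y. norm (grad g x - grad g y) \<le> C * norm (x - y)"
    using grad_lipschitz[OF assms] by blast
  have "\<bar>g (x - z) - g x + z \<bullet> grad g x\<bar> \<le> C * (norm z)\<^sup>2" for x z
  proof -
    define F where "F y = g y - grad g x \<bullet> y" for y
    have "norm (F (x - z) - F x) \<le> (C * norm z) * norm ((x - z) - x)"
    proof (rule differentiable_bound[of "cball x (norm z)" F "\<lambda>y b. (grad g y - grad g x) \<bullet> b"])
      show "(F has_derivative (\<lambda>b. (grad g y - grad g x) \<bullet> b)) (at y within cball x (norm z))" for y
        unfolding F_def inner_diff_left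
        by (rule has_derivative_at_withinI) (intro has_derivative_diff has_derivative_grad
            has_derivative_inner_right has_derivative_ident smooth_on_differentiable[OF assms(1)] UNIV_I)
      fix y assume "y \<in> cball x (norm z)"
      then have "norm (grad g y - grad g x) \<le> C * norm z"
        using C(2)[of y x] mult_left_mono[OF _ C(1), of "norm (y - x)" "norm z"]
        by (simp add: dist_norm norm_minus_commute)
      then show "onorm (\<lambda>b. (grad g y - grad g x) \<bullet> b) \<le> C * norm z"
        by (intro onorm_le)
          (metis Cauchy_Schwarz_ineq2 mult_right_mono norm_ge_zero order_trans real_norm_def)
    qed (auto simp: dist_norm)
    moreover have "F (x - z) - F x = g (x - z) - g x + z \<bullet> grad g x"
      by (simp add: F_def inner_diff_right inner_commute)
    ultimately show ?thesis by (simp add: power2_eq_square mult.assoc)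
  qed
  then show ?thesis using C(1) by blast
qed

locale mollifier =
  fixes \<omega> :: "real^'d \<Rightarrow> real"
  assumes smooth: "smooth_on UNIV \<omega>" and periodic: "periodic \<omega>"
    and even: "\<And>x. \<omega> (- x) = \<omega> x" and nonneg: "\<And>x. 0 \<le> \<omega> x"
begin

lemma continuous: "continuous_on UNIV \<omega>"
  by (rule smooth_on_continuous_on[OF smooth])

lemma measurable [measurable]: "\<omega> \<in> borel_measurable borel"
  by (rule borel_measurable_continuous_onI[OF continuous])

lemma grad_measurable [measurable]: "grad \<omega> \<in> borel_measurable borel"
  by (rule borel_measurable_continuous_onI[OF grad_continuous[OF smooth]])

lemma bounded: "\<exists>C\<ge>0. \<forall>x. \<bar>\<omega> x\<bar> \<le> C"
  using periodic_bounded_if_continuous[OF periodic continuous] by simp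

lemma grad_odd: "grad \<omega> (- x) = - grad \<omega> x"
proof -
  have "((\<lambda>x. \<omega> (- x)) has_derivative (\<lambda>b. grad \<omega> (- x) \<bullet> (- b))) (at x)"
    using has_derivative_compose[OF has_derivative_minus[OF has_derivative_ident]
        has_derivative_grad[OF smooth_on_differentiable[OF smooth UNIV_I]]] .
  then have "(\<omega> has_derivative (\<lambda>b. (- grad \<omega> (- x)) \<bullet> b)) (at x)" by (simp add: even)
  from grad_eqI[OF this] show ?thesis by simp
qed

end

text \<open>A smooth periodic kernel that vanishes unless every coordinate is within \<open>\<delta>\<close> of a multiple of
\<open>2 * pi\<close>. Composing the cutoff with the cosine builds in periodicity and symmetry, so that no
sum over the lattice is needed.\<close>

definition cos_kernel :: "real \<Rightarrow> real^'d \<Rightarrow> real" where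
  "cos_kernel \<delta> x = (\<Prod>i\<in>UNIV. cutoff (cos (x $ i) - cos \<delta>))"

lemma mollifier_cos_kernel: "mollifier (cos_kernel \<delta>)"
proof
  have "smooth_on UNIV (\<lambda>x::real^'d. x $ i)" for i
    using smooth_on_inner[of UNIV "axis i 1 :: real^'d"] by (simp add: inner_axis)
  then show "smooth_on UNIV (cos_kernel \<delta> :: real^'d \<Rightarrow> real)"
    unfolding cos_kernel_def diff_conv_add_uminus
    by (intro smooth_on_prod smooth_on_cutoff smooth_on_add smooth_on_cos smooth_on_const open_UNIV)
  show "periodic (cos_kernel \<delta> :: real^'d \<Rightarrow> real)"
    by (auto simp: periodic_def cos_kernel_def axis_def intro!: prod.cong)
qed (auto simp: cos_kernel_def prod_nonneg cutoff_nonneg)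

lemma cos_kernel_pos: "0 < \<delta> \<Longrightarrow> \<delta> < pi \<Longrightarrow> 0 < cos_kernel \<delta> 0"
  unfolding cos_kernel_def using cos_monotone_0_pi[of 0 \<delta>]
  by (intro prod_pos) (auto simp: cutoff_pos_iff)

lemma cos_kernel_support:
  assumes "0 < \<delta>" "\<delta> < pi" "cos_kernel \<delta> x \<noteq> 0" "\<bar>x $ i\<bar> \<le> pi"
  shows "\<bar>x $ i\<bar> < \<delta>"
proof (rule ccontr)
  assume "\<not> \<bar>x $ i\<bar> < \<delta>"
  then have "cos \<bar>x $ i\<bar> \<le> cos \<delta>" using assms by (intro cos_monotone_0_pi_le) auto
  then have "cutoff (cos (x $ i) - cos \<delta>) = 0" by (simp add: cutoff_eq_0_iff)
  then show False using assms(3) unfolding cos_kernel_def by (simp add: prod_zero_iff)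
qed

section \<open>Integration over the periodicity cell\<close>

text \<open>Lebesgue measure on the cell is taken as a density, not as a restriction: its measurable sets
are then all Borel sets, and shifted arguments stay in the space of the measure.\<close>

definition cell_measure :: "(real^'d) measure" where
  "cell_measure = density lborel (indicator Lam)"

definition time_measure :: "real \<Rightarrow> real measure" where
  "time_measure T = density lborel (indicator {0<..<T})"

definition cylinder_measure :: "real \<Rightarrow> ((real^'d) \<times> real) measure" where
  "cylinder_measure T = cell_measure \<Otimes>\<^sub>M time_measure T"

abbreviation doubled_measure :: "real \<Rightarrow> (((real^'d) \<times> real) \<times> (real^'d) \<times> real) measure" where
  "doubled_measure T \<equiv> cylinder_measure T \<Otimes>\<^sub>M cylinder_measure T"

abbreviation jointly_borel :: "('a::topological_space \<Rightarrow> 'b::topological_space \<Rightarrow> real) \<Rightarrow> bool" where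
  "jointly_borel g \<equiv> (\<lambda>p. g (fst p) (snd p)) \<in> borel_measurable (borel \<Otimes>\<^sub>M borel)"

lemma sets_cell_measure [simp, measurable_cong]: "sets cell_measure = sets borel"
  and space_cell_measure [simp]: "space cell_measure = UNIV"
  and sets_time_measure [simp, measurable_cong]: "sets (time_measure T) = sets borel"
  and space_time_measure [simp]: "space (time_measure T) = UNIV"
  by (simp_all add: cell_measure_def time_measure_def)

lemma sets_cylinder_measure [measurable_cong]: "sets (cylinder_measure T) = sets (borel \<Otimes>\<^sub>M borel)"
  and space_cylinder_measure [simp]: "space (cylinder_measure T) = UNIV"
  unfolding cylinder_measure_def by (auto intro!: sets_pair_measure_cong simp: space_pair_measure)

lemma Lam_eq_box: "Lam = box 0 (\<chi> i. 2 * pi)"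
  by (auto simp: Lam_def mem_box_cart)

lemma Lam_sets [measurable]: "Lam \<in> sets borel"
  by (simp add: Lam_eq_box)

lemma finite_measure_cell: "finite_measure (cell_measure :: (real^'d) measure)"
proof (rule finite_measureI)
  have "emeasure lborel (Lam :: (real^'d) set) < \<infinity>"
    unfolding Lam_eq_box by (rule emeasure_bounded_finite[OF bounded_box])
  then show "emeasure cell_measure (space cell_measure :: (real^'d) set) \<noteq> \<infinity>"
    by (simp add: cell_measure_def emeasure_density)
qed

lemma finite_measure_time: "finite_measure (time_measure T)"
proof (rule finite_measureI)
  have "emeasure lborel {0<..<T} < \<infinity>" by (rule emeasure_bounded_finite) simp
  then show "emeasure (time_measure T) (space (time_measure T)) \<noteq> \<infinity>"
    by (simp add: time_measure_def emeasure_density)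
qed

lemma finite_measure_cylinder: "finite_measure (cylinder_measure T)"
  unfolding cylinder_measure_def
  by (intro finite_measure_pair_measure finite_measure_cell finite_measure_time)

interpretation cell: finite_measure cell_measure by (rule finite_measure_cell)
interpretation time: finite_measure "time_measure T" for T by (rule finite_measure_time)
interpretation cylinder: finite_measure "cylinder_measure T" for T by (rule finite_measure_cylinder)
interpretation cell_time: pair_sigma_finite cell_measure "time_measure T" for T ..

lemma cell_measure_pos: "0 < measure cell_measure (UNIV :: (real^'d) set)"
proof -
  have "emeasure lborel (Lam :: (real^'d) set) \<noteq> 0"
  proof
    assume "emeasure lborel (Lam :: (real^'d) set) = 0"
    then have "Lam \<in> null_sets (lborel :: (real^'d) measure)" by (simp add: null_sets_def)
    then have "negligible (Lam :: (real^'d) set)"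
      by (simp add: negligible_iff_null_sets null_sets_completionI)
    moreover have "open (Lam :: (real^'d) set)" "(\<chi> i. pi) \<in> (Lam :: (real^'d) set)"
      by (auto simp: Lam_eq_box mem_box_cart)
    ultimately show False using open_not_negligible[of "Lam :: (real^'d) set"] by blast
  qed
  then have "emeasure cell_measure (UNIV :: (real^'d) set) \<noteq> 0"
    by (simp add: cell_measure_def emeasure_density)
  then show ?thesis by (simp add: cell.emeasure_eq_measure zero_less_measure_iff)
qed

lemma cylinder_measure_eq:
  "cylinder_measure T = density lborel (indicator (Lam \<times> {0<..<T}) :: ((real^'d) \<times> real) \<Rightarrow> ennreal)"
proof -
  have "(cylinder_measure T :: ((real^'d) \<times> real) measure) = density (lborel \<Otimes>\<^sub>M lborel)
      (\<lambda>(x, y). indicator Lam x * indicator {0<..<T} y :: ennreal)"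
    unfolding cylinder_measure_def cell_measure_def time_measure_def
    by (intro pair_measure_density lborel.sigma_finite_measure_axioms
        finite_measure.axioms(1)[OF finite_measure_time[unfolded time_measure_def]]) auto
  moreover have "(\<lambda>(x :: real^'d, y). indicator Lam x * indicator {0<..<T} y :: ennreal) = indicator (Lam \<times> {0<..<T})"
    by (auto simp: fun_eq_iff indicator_def)
  ultimately show ?thesis by (simp add: lborel_prod)
qed

lemma integral_cylinder:
  fixes g :: "(real^'d) \<times> real \<Rightarrow> real"
  assumes "g \<in> borel_measurable (borel \<Otimes>\<^sub>M borel)"
  shows "integral\<^sup>L (cylinder_measure T) g = (LINT p:(Lam \<times> {0<..<T})|lborel. g p)"
proof -
  have "(indicator (Lam \<times> {0<..<T}) :: (real^'d) \<times> real \<Rightarrow> real) \<in> borel_measurable lborel"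
    by (intro borel_measurable_indicator) (simp add: borel_prod[symmetric])
  then show ?thesis
    using integral_density[of g lborel "indicator (Lam \<times> {0<..<T})"] assms
    by (simp add: borel_prod cylinder_measure_eq set_lebesgue_integral_def ennreal_indicator)
qed

lemma half_open_cell_measurable [measurable]: "half_open_cell \<in> sets borel"
proof -
  have "half_open_cell = {x \<in> space borel. \<forall>i. 0 \<le> x $ i \<and> x $ i < 2 * pi}"
    by (simp add: half_open_cell_def)
  also have "\<dots> \<in> sets borel" by measurable
  finally show ?thesis .
qed

lemma cell_measure_half_open: "cell_measure = density lborel (indicator half_open_cell)"
  unfolding cell_measure_def
proof (rule density_cong)
  have "(cbox 0 (\<chi> i. 2 * pi) - box 0 (\<chi> i. 2 * pi) :: (real^'d) set) \<in> null_sets lborel"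
    using negligible_frontier_interval[of "0 :: real^'d" "\<chi> i. 2 * pi"]
    by (simp add: negligible_iff_null_sets null_sets_completion_iff)
  then have "AE x::real^'d in lborel. x \<notin> cbox 0 (\<chi> i. 2 * pi) - box 0 (\<chi> i. 2 * pi)"
    by (rule AE_not_in)
  then show "AE x::real^'d in lborel. indicator Lam x = (indicator half_open_cell x :: ennreal)"
    by (rule AE_mp) (auto intro!: AE_I2 simp: indicator_def Lam_def half_open_cell_def mem_box_cart
        less_imp_le dest: less_imp_le split: if_splits)
qed auto

text \<open>Every point has exactly one lattice translate in the half-open cell.\<close>

lemma half_open_cell_tiling:
  "(\<integral>\<^sup>+ n. indicator half_open_cell (x + lattice_vec n) \<partial>count_space UNIV) = 1"
proof -
  have "x + lattice_vec n \<in> half_open_cell \<longleftrightarrow> n = - floor_vec x" for n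
  proof -
    have "0 \<le> x $ i + 2 * pi * of_int (n $ i) \<and> x $ i + 2 * pi * of_int (n $ i) < 2 * pi
        \<longleftrightarrow> n $ i = - \<lfloor>x $ i / (2 * pi)\<rfloor>" for i
    proof -
      have "0 \<le> x $ i + 2 * pi * of_int (n $ i) \<and> x $ i + 2 * pi * of_int (n $ i) < 2 * pi
        \<longleftrightarrow> of_int (- (n $ i)) \<le> x $ i / (2 * pi) \<and> x $ i / (2 * pi) < of_int (- (n $ i)) + 1"
        by (subst pos_le_divide_eq, simp, subst pos_divide_less_eq, simp) (auto simp: algebra_simps)
      also have "\<dots> \<longleftrightarrow> \<lfloor>x $ i / (2 * pi)\<rfloor> = - (n $ i)"
        by (simp add: floor_eq_iff)
      finally show ?thesis by auto
    qed
    then show ?thesis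
      by (simp add: half_open_cell_def lattice_vec_def floor_vec_def vec_eq_iff)
  qed
  then have "indicator half_open_cell (x + lattice_vec n) = (indicator {- floor_vec x} n :: ennreal)" for n
    by (simp add: indicator_def)
  then show ?thesis by simp
qed

lemma nn_integral_lborel_shift:
  fixes g :: "'a::euclidean_space \<Rightarrow> ennreal"
  assumes "g \<in> borel_measurable borel"
  shows "(\<integral>\<^sup>+ x. g (x + a) \<partial>lborel) = (\<integral>\<^sup>+ x. g x \<partial>lborel)"
proof -
  have "(\<integral>\<^sup>+ x. g x \<partial>lborel) = (\<integral>\<^sup>+ x. g x \<partial>distr lborel borel ((+) a))"
    by (simp add: lborel_distr_plus)
  also have "\<dots> = (\<integral>\<^sup>+ x. g (x + a) \<partial>lborel)"
    using assms by (subst nn_integral_distr) (auto simp: add.commute)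
  finally show ?thesis by simp
qed

text \<open>Write the shifted cell as the disjoint union of its pieces in the lattice translates of the
cell and move every piece back by its lattice vector: periodicity does not notice, and the
pieces tile the cell. Both the cutting and the reassembling are \<open>half_open_cell_tiling\<close>.\<close>

lemma nn_integral_cell_shift:
  fixes g :: "real^'d \<Rightarrow> ennreal"
  assumes [measurable]: "g \<in> borel_measurable borel" and g: "periodic g"
  shows "(\<integral>\<^sup>+ x. g (x + z) \<partial>cell_measure) = (\<integral>\<^sup>+ x. g x \<partial>cell_measure)"
proof -
  let ?Q = "indicator half_open_cell :: real^'d \<Rightarrow> ennreal"
  let ?C = "count_space (UNIV :: (int^'d) set)"
  interpret C: sigma_finite_measure ?C by (rule sigma_finite_measure_count_space)
  interpret CL: pair_sigma_finite ?C "lborel :: (real^'d) measure" ..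
  have cell: "(\<integral>\<^sup>+ x. h x \<partial>cell_measure) = (\<integral>\<^sup>+ x. ?Q x * h x \<partial>lborel)"
    if "h \<in> borel_measurable borel" for h :: "real^'d \<Rightarrow> ennreal"
    unfolding cell_measure_half_open using that by (subst nn_integral_density) auto
  have "(\<integral>\<^sup>+ x. g (x + z) \<partial>cell_measure) = (\<integral>\<^sup>+ x. ?Q x * g (x + z) \<partial>lborel)"
    by (subst cell) auto
  also have "\<dots> = (\<integral>\<^sup>+ x. ?Q (x - z) * g x \<partial>lborel)"
    using nn_integral_lborel_shift[of "\<lambda>x. ?Q (x - z) * g x" z] by simp
  also have "\<dots> = (\<integral>\<^sup>+ x. (\<integral>\<^sup>+ n. ?Q (x - z) * g x * ?Q (x + lattice_vec n) \<partial>?C) \<partial>lborel)"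
    by (simp add: nn_integral_cmult half_open_cell_tiling)
  also have "\<dots> = (\<integral>\<^sup>+ n. (\<integral>\<^sup>+ x. ?Q (x - z) * g x * ?Q (x + lattice_vec n) \<partial>lborel) \<partial>?C)"
    by (rule CL.Fubini') (simp add: measurable_pair_measure_countable1)
  also have "\<dots> = (\<integral>\<^sup>+ n. (\<integral>\<^sup>+ x. ?Q x * g x * ?Q ((x - z) + lattice_vec (- n)) \<partial>lborel) \<partial>?C)"
  proof (rule nn_integral_cong)
    fix n
    have "g (x - lattice_vec n) = g x" for x
      using periodic_lattice[OF g, of x "- n"] by (simp add: lattice_vec_minus)
    then show "(\<integral>\<^sup>+ x. ?Q (x - z) * g x * ?Q (x + lattice_vec n) \<partial>lborel)
      = (\<integral>\<^sup>+ x. ?Q x * g x * ?Q ((x - z) + lattice_vec (- n)) \<partial>lborel)"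
      using nn_integral_lborel_shift[of "\<lambda>x. ?Q (x - z) * g x * ?Q (x + lattice_vec n)" "- lattice_vec n"]
      by (simp add: lattice_vec_minus mult_ac algebra_simps)
  qed
  also have "\<dots> = (\<integral>\<^sup>+ n. (\<integral>\<^sup>+ x. ?Q x * g x * ?Q ((x - z) + lattice_vec n) \<partial>lborel) \<partial>?C)"
    using nn_integral_bij_count_space[of uminus UNIV UNIV
        "\<lambda>n. \<integral>\<^sup>+ x. ?Q x * g x * ?Q ((x - z) + lattice_vec n) \<partial>lborel"]
    by (simp add: bij_uminus)
  also have "\<dots> = (\<integral>\<^sup>+ x. (\<integral>\<^sup>+ n. ?Q x * g x * ?Q ((x - z) + lattice_vec n) \<partial>?C) \<partial>lborel)"
    by (rule CL.Fubini'[symmetric]) (simp add: measurable_pair_measure_countable1)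
  also have "\<dots> = (\<integral>\<^sup>+ x. ?Q x * g x \<partial>lborel)"
    by (simp add: nn_integral_cmult half_open_cell_tiling)
  also have "\<dots> = (\<integral>\<^sup>+ x. g x \<partial>cell_measure)" by (subst cell) auto
  finally show ?thesis .
qed

lemma integral_cell_shift:
  fixes g :: "real^'d \<Rightarrow> real"
  assumes [measurable]: "g \<in> borel_measurable borel" and "periodic g" "\<And>x. 0 \<le> g x"
  shows "(\<integral>x. g (x + z) \<partial>cell_measure) = (\<integral>x. g x \<partial>cell_measure)"
  using nn_integral_cell_shift[of "\<lambda>x. ennreal (g x)" z] assms
  by (simp add: integral_eq_nn_integral periodic_def)

lemma integral_cylinder_shift:
  fixes g :: "(real^'d) \<times> real \<Rightarrow> real"
  assumes [measurable]: "g \<in> borel_measurable (borel \<Otimes>\<^sub>M borel)" and per: "\<And>t. periodic (\<lambda>x. g (x, t))"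
    and nonneg: "\<And>p. 0 \<le> g p"
  shows "(\<integral>p. g (fst p + z, snd p) \<partial>cylinder_measure T) = (\<integral>p. g p \<partial>cylinder_measure T)"
proof -
  have "(\<integral>\<^sup>+ p. ennreal (g (fst p + z, snd p)) \<partial>cylinder_measure T)
      = (\<integral>\<^sup>+ t. \<integral>\<^sup>+ x. ennreal (g (x + z, t)) \<partial>cell_measure \<partial>time_measure T)"
    unfolding cylinder_measure_def by (subst cell_time.nn_integral_snd[symmetric]) auto
  also have "\<dots> = (\<integral>\<^sup>+ t. \<integral>\<^sup>+ x. ennreal (g (x, t)) \<partial>cell_measure \<partial>time_measure T)"
    using per by (intro nn_integral_cong nn_integral_cell_shift) (auto simp: periodic_def)
  also have "\<dots> = (\<integral>\<^sup>+ p. ennreal (g p) \<partial>cylinder_measure T)"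
    unfolding cylinder_measure_def by (subst cell_time.nn_integral_snd[symmetric]) auto
  finally show ?thesis
    using nonneg by (simp add: integral_eq_nn_integral)
qed

text \<open>On finite measure spaces a bound on the integrand is the only condition that Fubini's theorem
leaves to be checked.\<close>

lemma fubini_bounded:
  fixes g :: "'a \<times> 'b \<Rightarrow> real"
  assumes M: "finite_measure M" and N: "finite_measure N"
    and g [measurable]: "g \<in> borel_measurable (M \<Otimes>\<^sub>M N)" and bound: "\<And>p. \<bar>g p\<bar> \<le> C"
  shows "integrable (M \<Otimes>\<^sub>M N) g"
    and "(\<integral>x. \<integral>y. g (x, y) \<partial>N \<partial>M) = integral\<^sup>L (M \<Otimes>\<^sub>M N) g"
    and "(\<integral>y. \<integral>x. g (x, y) \<partial>M \<partial>N) = integral\<^sup>L (M \<Otimes>\<^sub>M N) g"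
proof -
  interpret M: finite_measure M by fact
  interpret N: finite_measure N by fact
  interpret MN: pair_sigma_finite M N ..
  interpret P: finite_measure "M \<Otimes>\<^sub>M N" by (rule finite_measure_pair_measure[OF N M])
  show *: "integrable (M \<Otimes>\<^sub>M N) g" by (rule P.integrable_const_bound[of _ C]) (auto simp: bound)
  show "(\<integral>x. \<integral>y. g (x, y) \<partial>N \<partial>M) = integral\<^sup>L (M \<Otimes>\<^sub>M N) g" by (rule MN.integral_fst'[OF *])
  show "(\<integral>y. \<integral>x. g (x, y) \<partial>M \<partial>N) = integral\<^sup>L (M \<Otimes>\<^sub>M N) g"
    using MN.integral_snd[of "\<lambda>x y. g (x, y)"] * by simp
qed

section \<open>Translations in the mean\<close>

text \<open>A bounded Borel function is the limit almost everywhere of continuous functions, which may be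
truncated to the same bound, so dominated convergence makes one of them close to it in \<open>L\<^sup>1\<close> of a
ball around the cell; on that ball the continuous function is uniformly continuous.\<close>

lemma translation_continuous_L1:
  fixes V :: "real^'d \<Rightarrow> real"
  assumes V [measurable]: "V \<in> borel_measurable borel" and bound: "\<And>x. \<bar>V x\<bar> \<le> M" and "0 < \<epsilon>"
  shows "\<exists>\<delta>>0. \<forall>h. norm h < \<delta> \<longrightarrow> (\<integral>x. \<bar>V (x + h) - V x\<bar> \<partial>cell_measure) \<le> \<epsilon>"
proof -
  have "bounded (Lam :: (real^'d) set)" by (simp add: Lam_eq_box)
  then obtain R where R: "\<And>x::real^'d. x \<in> Lam \<Longrightarrow> norm x \<le> R" by (auto simp: bounded_iff)
  define B :: "(real^'d) measure" where "B = density lborel (indicator (ball 0 (R + 1)))"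
  have [measurable]: "ball 0 (R + 1) \<in> sets (borel :: (real^'d) measure)" by simp
  have sets_B [measurable_cong]: "sets B = sets borel" by (simp add: B_def)
  interpret B: finite_measure B
  proof (rule finite_measureI)
    have "emeasure lborel (ball 0 (R + 1) :: (real^'d) set) < \<infinity>"
      by (rule emeasure_bounded_finite[OF bounded_ball])
    moreover have "emeasure B (space B) = emeasure lborel (ball 0 (R + 1) :: (real^'d) set)"
      unfolding B_def by (subst emeasure_density) (auto intro!: borel_measurable_indicator)
    ultimately show "emeasure B (space B) \<noteq> \<infinity>" by simp
  qed
  have M: "0 \<le> M" using bound[of 0] by simp
  have "V measurable_on UNIV"
    using V by (intro lebesgue_measurable_imp_measurable_on measurable_completion) auto
  then obtain N g where N: "negligible N" and g: "\<And>n. continuous_on UNIV (g n)"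
    and lim: "\<And>x. x \<notin> N \<Longrightarrow> (\<lambda>n. g n x) \<longlonglongrightarrow> V x"
    unfolding measurable_on_def by (auto simp only: UNIV_I if_True)
  define G where "G n x = max (- M) (min M (g n x))" for n x
  have G_cont: "continuous_on UNIV (G n)" for n
    unfolding G_def using g by (intro continuous_intros)
  have G_meas [measurable]: "G n \<in> borel_measurable borel" for n
    by (rule borel_measurable_continuous_onI[OF G_cont])
  have G_bound: "\<bar>G n x\<bar> \<le> M" for n x using M by (auto simp: G_def)
  have diff_bound: "\<bar>G n x - V x\<bar> \<le> 2 * M" for n x
    using G_bound[of n x] bound[of x] by linarith
  have "AE x in lebesgue. x \<notin> N"
    using N by (intro AE_not_in) (simp add: negligible_iff_null_sets)
  then have "AE x in lborel. x \<notin> N" by (simp add: AE_completion_iff)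
  then have aeN: "AE x in B. x \<notin> N" unfolding B_def by (subst AE_density) auto
  have "(\<lambda>n. \<integral>x. \<bar>G n x - V x\<bar> \<partial>B) \<longlonglongrightarrow> (\<integral>x. 0 \<partial>B)"
  proof (rule integral_dominated_convergence[where w = "\<lambda>_. 2 * M"])
    show "AE x in B. (\<lambda>n. \<bar>G n x - V x\<bar>) \<longlonglongrightarrow> 0"
      using aeN
    proof (rule AE_mp, intro AE_I2 impI)
      fix x assume "x \<notin> N"
      then have "(\<lambda>n. \<bar>G n x - V x\<bar>) \<longlonglongrightarrow> \<bar>max (- M) (min M (V x)) - V x\<bar>"
        unfolding G_def by (intro tendsto_intros lim)
      moreover have "max (- M) (min M (V x)) = V x" using bound[of x] by (auto simp: max_def min_def)
      ultimately show "(\<lambda>n. \<bar>G n x - V x\<bar>) \<longlonglongrightarrow> 0" by simp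
    qed
  qed (auto simp: diff_bound)
  then have "\<forall>\<^sub>F n in sequentially. (\<integral>x. \<bar>G n x - V x\<bar> \<partial>B) < \<epsilon> / 3"
    using \<open>0 < \<epsilon>\<close> by (intro order_tendstoD(2)) auto
  then obtain n where n: "(\<integral>x. \<bar>G n x - V x\<bar> \<partial>B) < \<epsilon> / 3"
    by (auto simp: eventually_sequentially)
  have approx: "(\<integral>x. \<bar>G n (x + h) - V (x + h)\<bar> \<partial>cell_measure) \<le> \<epsilon> / 3" if h: "norm h < 1" for h
  proof -
    have "(\<integral>\<^sup>+ x. ennreal \<bar>G n (x + h) - V (x + h)\<bar> \<partial>cell_measure)
        = (\<integral>\<^sup>+ x. indicator Lam x * ennreal \<bar>G n (x + h) - V (x + h)\<bar> \<partial>lborel)"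
      unfolding cell_measure_def by (rule nn_integral_density) auto
    also have "\<dots> \<le> (\<integral>\<^sup>+ x. indicator (ball 0 (R + 1)) (x + h) * ennreal \<bar>G n (x + h) - V (x + h)\<bar> \<partial>lborel)"
    proof (rule nn_integral_mono)
      fix x
      have "x + h \<in> ball 0 (R + 1)" if "x \<in> Lam"
        using R[OF that] h norm_triangle_ineq[of x h] by simp
      then show "indicator Lam x * ennreal \<bar>G n (x + h) - V (x + h)\<bar>
        \<le> indicator (ball 0 (R + 1)) (x + h) * ennreal \<bar>G n (x + h) - V (x + h)\<bar>"
        by (cases "x \<in> Lam") auto
    qed
    also have "\<dots> = (\<integral>\<^sup>+ x. indicator (ball 0 (R + 1)) x * ennreal \<bar>G n x - V x\<bar> \<partial>lborel)"
      by (rule nn_integral_lborel_shift) auto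
    also have "\<dots> = (\<integral>\<^sup>+ x. ennreal \<bar>G n x - V x\<bar> \<partial>B)"
      unfolding B_def by (rule nn_integral_density[symmetric]) auto
    also have "\<dots> = ennreal (\<integral>x. \<bar>G n x - V x\<bar> \<partial>B)"
      by (intro nn_integral_eq_integral B.integrable_const_bound[of _ "2 * M"]) (auto simp: diff_bound)
    also have "\<dots> \<le> ennreal (\<epsilon> / 3)" using n by (intro ennreal_leI) simp
    finally have "enn2real (\<integral>\<^sup>+ x. ennreal \<bar>G n (x + h) - V (x + h)\<bar> \<partial>cell_measure) \<le> \<epsilon> / 3"
      using \<open>0 < \<epsilon>\<close> by (intro enn2real_leI) auto
    then show ?thesis by (subst integral_eq_nn_integral) auto
  qed
  define m where "m = measure cell_measure (UNIV :: (real^'d) set)"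
  have m: "0 < m" unfolding m_def by (rule cell_measure_pos)
  have "uniformly_continuous_on (cball 0 (R + 1)) (G n)"
    using G_cont[of n] by (intro compact_uniformly_continuous) (auto intro: continuous_on_subset)
  moreover have "0 < \<epsilon> / (3 * m)" using m \<open>0 < \<epsilon>\<close> by simp
  ultimately obtain d where d: "0 < d"
    "\<And>x y. x \<in> cball 0 (R + 1) \<Longrightarrow> y \<in> cball 0 (R + 1) \<Longrightarrow> dist y x < d \<Longrightarrow> dist (G n y) (G n x) < \<epsilon> / (3 * m)"
    unfolding uniformly_continuous_on_def by metis
  have ae_Lam: "AE x in cell_measure. x \<in> (Lam :: (real^'d) set)"
    unfolding cell_measure_def by (subst AE_density) (auto intro!: AE_I2 simp: indicator_def)
  show ?thesis
  proof (intro exI conjI allI impI)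
    show "0 < min 1 d" using d by simp
    fix h :: "real^'d" assume h: "norm h < min 1 d"
    have int: "integrable cell_measure F" if "F \<in> borel_measurable borel" "\<And>x. \<bar>F x\<bar> \<le> 2 * M"
      for F :: "real^'d \<Rightarrow> real"
      using that by (intro cell.integrable_const_bound[of _ "2 * M"]) auto
    have I1: "integrable cell_measure (\<lambda>x. \<bar>G n (x + h) - V (x + h)\<bar>)"
      by (rule int) (auto simp: diff_bound)
    have I2: "integrable cell_measure (\<lambda>x. \<bar>G n x - V x\<bar>)"
      by (rule int) (auto simp: diff_bound)
    have I3: "integrable cell_measure (\<lambda>x. \<bar>V (x + h) - V x\<bar>)"
    proof (rule int)
      show "\<bar>\<bar>V (x + h) - V x\<bar>\<bar> \<le> 2 * M" for x
        using bound[of "x + h"] bound[of x] by linarith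
    qed auto
    have "(\<integral>x. \<bar>V (x + h) - V x\<bar> \<partial>cell_measure)
      \<le> (\<integral>x. \<bar>G n (x + h) - V (x + h)\<bar> + \<bar>G n x - V x\<bar> + \<epsilon> / (3 * m) \<partial>cell_measure)"
    proof (rule integral_mono_AE)
      show "AE x in cell_measure. \<bar>V (x + h) - V x\<bar>
          \<le> \<bar>G n (x + h) - V (x + h)\<bar> + \<bar>G n x - V x\<bar> + \<epsilon> / (3 * m)"
        using ae_Lam
      proof (rule AE_mp, intro AE_I2 impI)
        fix x :: "real^'d" assume "x \<in> Lam"
        then have "x \<in> cball 0 (R + 1)" "x + h \<in> cball 0 (R + 1)" "dist (x + h) x < d"
          unfolding mem_cball_0 dist_norm using R[of x] h norm_triangle_ineq[of x h] by auto
        then have "\<bar>G n (x + h) - G n x\<bar> < \<epsilon> / (3 * m)"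
          using d(2)[of x "x + h"] by (simp only: dist_real_def)
        then show "\<bar>V (x + h) - V x\<bar> \<le> \<bar>G n (x + h) - V (x + h)\<bar> + \<bar>G n x - V x\<bar> + \<epsilon> / (3 * m)"
          by linarith
      qed
    qed (use I1 I2 I3 in auto)
    also have "\<dots> = (\<integral>x. \<bar>G n (x + h) - V (x + h)\<bar> \<partial>cell_measure)
        + (\<integral>x. \<bar>G n x - V x\<bar> \<partial>cell_measure) + m * (\<epsilon> / (3 * m))"
      using I1 I2 by (simp add: m_def)
    also have "\<dots> \<le> \<epsilon> / 3 + \<epsilon> / 3 + \<epsilon> / 3"
      using approx[of h] approx[of 0] h m by (intro add_mono) auto
    finally show "(\<integral>x. \<bar>V (x + h) - V x\<bar> \<partial>cell_measure) \<le> \<epsilon>" by simp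
  qed
qed

section \<open>Levy measures\<close>

definition far_part :: "(real^'d) measure \<Rightarrow> real \<Rightarrow> (real^'d) measure" where
  "far_part \<mu> r = density \<mu> (indicator {z. r < norm z})"

definition near_moment :: "(real^'d) measure \<Rightarrow> real \<Rightarrow> real" where
  "near_moment \<mu> r = (\<integral>z. indicator {z. norm z \<le> r} z * (norm z)\<^sup>2 \<partial>\<mu>)"

text \<open>The measure of the problem lives on the punctured space. Pushed forward to the whole space it
becomes a Borel measure, so that all integrands are Borel functions of all their variables;
\<open>levy_operators_distr\<close> shows that the operators do not change.\<close>

locale levy =
  fixes \<mu> :: "(real^'d) measure"
  assumes sets_levy [simp, measurable_cong]: "sets \<mu> = sets borel"
    and finite_levy: "(\<integral>\<^sup>+ z. ennreal (min ((norm z)\<^sup>2) 1) \<partial>\<mu>) < \<infinity>"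
    and origin: "emeasure \<mu> {0} = 0"
begin

lemma space_levy [simp]: "space \<mu> = UNIV"
  using sets_eq_imp_space_eq[OF sets_levy] by simp

text \<open>Markov's inequality: \<open>min (r\<^sup>2) 1\<close> bounds the integrand \<open>min (|z|\<^sup>2) 1\<close> from below on this set.\<close>

lemma emeasure_far_finite:
  assumes "0 < r" shows "emeasure \<mu> {z. r < norm z} < \<infinity>"
proof -
  define c where "c = min (r\<^sup>2) 1"
  have c: "0 < c" using assms by (simp add: c_def)
  have "ennreal c * emeasure \<mu> {z. r < norm z} = (\<integral>\<^sup>+ z. ennreal c * indicator {z. r < norm z} z \<partial>\<mu>)"
    by (rule nn_integral_cmult_indicator[symmetric]) simp
  also have "\<dots> \<le> (\<integral>\<^sup>+ z. ennreal (min ((norm z)\<^sup>2) 1) \<partial>\<mu>)"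
  proof (rule nn_integral_mono)
    fix z :: "real^'d"
    have "c \<le> min ((norm z)\<^sup>2) 1" if "r < norm z"
      unfolding c_def using that assms by (intro min.mono power_mono) auto
    then show "ennreal c * indicator {z. r < norm z} z \<le> ennreal (min ((norm z)\<^sup>2) 1)"
      by (auto simp: indicator_def intro: ennreal_leI)
  qed
  finally have "ennreal c * emeasure \<mu> {z. r < norm z} < \<infinity>" using finite_levy by simp
  then show ?thesis using c by (auto simp: ennreal_mult_less_top)
qed

sublocale sigma_finite_measure \<mu>
proof
  let ?A = "insert {0} (range (\<lambda>n. {z. 1 / real (Suc n) < norm z}))"
  show "\<exists>A. countable A \<and> A \<subseteq> sets \<mu> \<and> \<Union> A = space \<mu> \<and> (\<forall>a\<in>A. emeasure \<mu> a \<noteq> \<infinity>)"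
  proof (intro exI conjI)
    show "\<Union> ?A = space \<mu>"
    proof -
      have "\<exists>n. 1 / real (Suc n) < norm z" if "z \<noteq> 0" for z :: "real^'d"
        using reals_Archimedean[of "norm z"] that by (auto simp: inverse_eq_divide)
      then show ?thesis by auto
    qed
    show "\<forall>a\<in>?A. emeasure \<mu> a \<noteq> \<infinity>"
      using origin emeasure_far_finite by (auto simp: less_top[symmetric])
    show "?A \<subseteq> sets \<mu>" by auto
  qed auto
qed

lemma sets_far_part [simp, measurable_cong]: "sets (far_part \<mu> r) = sets borel"
  by (simp add: far_part_def)

lemma space_far_part [simp]: "space (far_part \<mu> r) = UNIV"
  by (simp add: far_part_def)

lemma finite_measure_far_part: "0 < r \<Longrightarrow> finite_measure (far_part \<mu> r)"
  using emeasure_far_finite[of r]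
  by (intro finite_measureI) (simp add: far_part_def emeasure_density)

lemma levy_far_eq:
  assumes [measurable]: "g \<in> borel_measurable borel"
  shows "levy_far \<mu> r g x = (\<integral>z. g (x + z) - g x \<partial>far_part \<mu> r)"
proof -
  have "(\<integral>z. g (x + z) - g x \<partial>density \<mu> (\<lambda>z. ennreal (indicat_real {z. r < norm z} z)))
      = (\<integral>z. indicat_real {z. r < norm z} z *\<^sub>R (g (x + z) - g x) \<partial>\<mu>)"
    by (rule integral_density) auto
  then show ?thesis by (simp add: levy_far_def far_part_def set_lebesgue_integral_def ennreal_indicator)
qed

lemma integrable_min: "integrable \<mu> (\<lambda>z. min ((norm z)\<^sup>2) 1)"
  using finite_levy by (intro integrableI_bounded) auto

lemma integrable_near_moment:
  assumes "r < 1" shows "integrable \<mu> (\<lambda>z. indicator {z. norm z \<le> r} z * (norm z)\<^sup>2)"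
proof (rule Bochner_Integration.integrable_bound[OF integrable_min])
  have "(norm z)\<^sup>2 \<le> 1" if "norm z \<le> r" for z :: "real^'d"
    using that assms power_le_one[of "norm z" 2] by simp
  then show "AE z in \<mu>. norm (indicator {z. norm z \<le> r} z * (norm z)\<^sup>2) \<le> norm (min ((norm z)\<^sup>2) 1)"
    by (auto simp: indicator_def)
qed auto

text \<open>Dominated convergence: for each \<open>z \<noteq> 0\<close> the integrand vanishes once the radius is below \<open>|z|\<close>.\<close>

lemma near_moment_tendsto_0: "(\<lambda>n. near_moment \<mu> (1 / real (n + 2))) \<longlonglongrightarrow> 0"
proof -
  have "(\<lambda>n. near_moment \<mu> (1 / real (n + 2))) \<longlonglongrightarrow> (\<integral>z. 0 \<partial>\<mu>)"
    unfolding near_moment_def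
  proof (rule integral_dominated_convergence[OF _ _ integrable_min])
    show "AE z in \<mu>. (\<lambda>n. indicator {z. norm z \<le> 1 / real (n + 2)} z * (norm z)\<^sup>2) \<longlonglongrightarrow> 0"
    proof (rule AE_I2)
      fix z :: "real^'d"
      show "(\<lambda>n. indicator {z. norm z \<le> 1 / real (n + 2)} z * (norm z)\<^sup>2) \<longlonglongrightarrow> 0"
      proof (cases "z = 0")
        case False
        then obtain N where N: "1 / real (Suc N) < norm z"
          using reals_Archimedean[of "norm z"] by (auto simp: inverse_eq_divide)
        have "indicator {z. norm z \<le> 1 / real (n + 2)} z * (norm z)\<^sup>2 = 0" if "N \<le> n" for n
        proof -
          have "1 / real (n + 2) \<le> 1 / real (Suc N)" using that by (intro divide_left_mono) auto
          then show ?thesis using N by (simp add: indicator_def)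
        qed
        then show ?thesis
          by (intro tendsto_eventually) (auto simp: eventually_sequentially)
      qed simp
    qed
    show "AE z in \<mu>. norm (indicator {z. norm z \<le> 1 / real (n + 2)} z * (norm z)\<^sup>2) \<le> min ((norm z)\<^sup>2) 1" for n
    proof (rule AE_I2)
      fix z :: "real^'d"
      have "(norm z)\<^sup>2 \<le> 1" if "norm z \<le> 1 / real (n + 2)"
        using order_trans[OF that, of 1] power_le_one[of "norm z" 2] by simp
      then show "norm (indicator {z. norm z \<le> 1 / real (n + 2)} z * (norm z)\<^sup>2) \<le> min ((norm z)\<^sup>2) 1"
        by (auto simp: indicator_def)
    qed
  qed auto
  then show ?thesis by simp
qed

lemma levy_adj_measurable:
  assumes "mollifier \<omega>" shows "levy_adj \<mu> r \<omega> \<in> borel_measurable borel"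
proof -
  interpret mollifier \<omega> by fact
  have "(\<lambda>x. \<integral>z. indicator {z. norm z \<le> r} z *\<^sub>R
      (\<omega> (x - z) - \<omega> x + (z \<bullet> grad \<omega> x) * of_bool (norm z < 1)) \<partial>\<mu>) \<in> borel_measurable borel"
    by measurable
  then show ?thesis by (simp add: levy_adj_def[abs_def] set_lebesgue_integral_def)
qed

text \<open>Taylor's formula in the integrand. The constant depends on the kernel, but neither on the
radius nor on the point, so for a fixed kernel the singular part disappears as \<open>r \<rightarrow> 0\<close>. For
\<open>r < 1\<close> the gradient correction is present on the whole domain of integration.\<close>

lemma levy_adj_le_near_moment:
  assumes "mollifier \<omega>"
  shows "\<exists>C\<ge>0. \<forall>r<1. \<forall>x. \<bar>levy_adj \<mu> r \<omega> x\<bar> \<le> C * near_moment \<mu> r"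
proof -
  interpret mollifier \<omega> by fact
  obtain C where C: "C \<ge> 0" "\<And>x z. \<bar>\<omega> (x - z) - \<omega> x + z \<bullet> grad \<omega> x\<bar> \<le> C * (norm z)\<^sup>2"
    using second_order_taylor[OF smooth periodic] by blast
  have "\<bar>levy_adj \<mu> r \<omega> x\<bar> \<le> C * near_moment \<mu> r" if r: "r < 1" for r x
  proof -
    let ?h = "\<lambda>z. indicator {z. norm z \<le> r} z *\<^sub>R
      (\<omega> (x - z) - \<omega> x + (z \<bullet> grad \<omega> x) * of_bool (norm z < 1))"
    have le: "norm (?h z) \<le> C * (indicator {z. norm z \<le> r} z * (norm z)\<^sup>2)" for z
      using C(2)[of x z] r by (auto simp: indicator_def)
    have int: "integrable \<mu> (\<lambda>z. C * (indicator {z. norm z \<le> r} z * (norm z)\<^sup>2))"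
      using integrable_near_moment[OF r] by simp
    have "integrable \<mu> ?h"
    proof (rule Bochner_Integration.integrable_bound[OF int])
      show "AE z in \<mu>. norm (?h z) \<le> norm (C * (indicator {z. norm z \<le> r} z * (norm z)\<^sup>2))"
        by (rule AE_I2) (rule order_trans[OF le], simp)
    qed measurable
    then have "norm (\<integral>z. ?h z \<partial>\<mu>) \<le> (\<integral>z. C * (indicator {z. norm z \<le> r} z * (norm z)\<^sup>2) \<partial>\<mu>)"
      by (rule Bochner_Integration.integral_norm_bound_integral[OF _ int le])
    then show ?thesis by (simp add: levy_adj_def set_lebesgue_integral_def near_moment_def)
  qed
  then show ?thesis using C(1) by blast
qed

end

lemma levy_measureD:
  fixes \<mu> :: "(real^'d) measure"
  assumes "levy_measure \<mu>"
  shows "(\<lambda>z. z) \<in> measurable \<mu> borel" and "levy (distr \<mu> borel (\<lambda>z. z))"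
proof -
  have sets: "sets \<mu> = sets (restrict_space borel (- {0}))"
    and fin: "(\<integral>\<^sup>+ z. ennreal (min ((norm z)\<^sup>2) 1) \<partial>\<mu>) < \<infinity>"
    using assms by (auto simp: levy_measure_def radon_on_def)
  show id [measurable]: "(\<lambda>z. z) \<in> measurable \<mu> borel"
    unfolding measurable_cong_sets[OF sets refl] by (rule measurable_restrict_space1) simp
  have "space \<mu> = - {0}" using sets_eq_imp_space_eq[OF sets] by (simp add: space_restrict_space)
  then have "emeasure (distr \<mu> borel (\<lambda>z. z)) {0} = 0"
    by (subst emeasure_distr) auto
  then show "levy (distr \<mu> borel (\<lambda>z. z))"
    using fin by unfold_locales (auto simp: nn_integral_distr)
qed

lemma levy_operators_distr:
  fixes \<mu> :: "(real^'d) measure"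
  assumes "levy_measure \<mu>"
  defines "\<nu> \<equiv> distr \<mu> borel (\<lambda>z. z)"
  shows "g \<in> borel_measurable borel \<Longrightarrow> levy_adj \<mu> r g x = levy_adj \<nu> r g x"
    and "g \<in> borel_measurable borel \<Longrightarrow> levy_far \<mu> r g x = levy_far \<nu> r g x"
proof -
  note [measurable] = levy_measureD(1)[OF assms(1)]
  have set_int: "(LINT z:A|\<mu>. h z) = (LINT z:A|\<nu>. h z)"
    if [measurable]: "A \<in> sets borel" "h \<in> borel_measurable borel" for A and h :: "real^'d \<Rightarrow> real"
    unfolding set_lebesgue_integral_def \<nu>_def by (subst integral_distr) auto
  assume [measurable]: "g \<in> borel_measurable borel"
  show "levy_adj \<mu> r g x = levy_adj \<nu> r g x"
    unfolding levy_adj_def by (rule set_int) measurable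
  show "levy_far \<mu> r g x = levy_far \<nu> r g x"
    unfolding levy_far_def by (rule set_int) measurable
qed

section \<open>Bounded periodic representatives\<close>

lemma AE_lborel_shift:
  fixes a :: "'a::euclidean_space"
  assumes "AE x in lborel. P x" shows "AE x in lborel. P (x + a)"
proof -
  have "AE x in distr lborel borel ((+) a). P x" 
    using assms by (subst lborel_distr_plus)
  then have "AE x in lborel. P (a + x)" by (rule AE_distrD[rotated]) simp
  then show ?thesis by (simp add: add.commute)
qed

lemma ae_periodic_lattice:
  assumes "ae_periodic g" shows "AE x in lborel. g (x + lattice_vec n) = g x"
proof (induction rule: lattice_induct[where P = "\<lambda>a. AE x in lborel. g (x + a) = g x"])
  case (plus a i)
  have "AE x in lborel. g ((x + a) + axis i (2 * pi)) = g (x + a)"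
    by (rule AE_lborel_shift) (use assms in \<open>simp add: ae_periodic_def\<close>)
  then show ?case using plus by eventually_elim (simp add: add.assoc)
next
  case (minus a i)
  have "AE x in lborel. g ((x + (a - axis i (2 * pi))) + axis i (2 * pi)) = g (x + (a - axis i (2 * pi)))"
    by (rule AE_lborel_shift) (use assms in \<open>simp add: ae_periodic_def\<close>)
  then show ?case using minus by eventually_elim (simp add: algebra_simps)
qed simp

lemma ae_periodic_wrap:
  assumes "ae_periodic g" shows "AE x in lborel. g (wrap x) = g x"
proof -
  have "AE x in lborel. \<forall>n. g (x + lattice_vec n) = g x"
    by (subst AE_all_countable) (simp add: ae_periodic_lattice[OF assms])
  then show ?thesis
  proof eventually_elim
    case (elim x)
    then have "g (x + lattice_vec (- floor_vec x)) = g x" by blast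
    then show ?case by (simp add: wrap_def lattice_vec_minus)
  qed
qed

lemma Linf_norm_leD:
  assumes "Linf_norm M g \<le> ennreal c" "0 \<le> c" shows "AE x in M. \<bar>g x\<bar> \<le> c"
proof -
  have "AE x in M. ennreal \<bar>g x\<bar> \<le> Linf_norm M g" unfolding Linf_norm_def by (rule esssup_AE)
  then show ?thesis
  proof eventually_elim
    case (elim x)
    then have "ennreal \<bar>g x\<bar> \<le> ennreal c" using assms(1) by (rule order_trans)
    then show ?case using assms(2) by (simp add: ennreal_le_iff)
  qed
qed

lemma C_Linf_per_continuous:
  assumes "C_Linf_per T u" "c \<in> {0..T}" "0 < \<epsilon>"
  shows "\<exists>\<delta>>0. \<forall>t\<in>{0..T}. \<bar>t - c\<bar> < \<delta> \<longrightarrow> (AE x in lborel. \<bar>u x t - u x c\<bar> \<le> \<epsilon>)"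
proof -
  have "((\<lambda>s. Linf_norm lborel (\<lambda>x. u x s - u x c)) \<longlongrightarrow> 0) (at c within {0..T})"
    using assms by (auto simp: C_Linf_per_def)
  then have "\<forall>\<^sub>F s in at c within {0..T}. Linf_norm lborel (\<lambda>x. u x s - u x c) < ennreal \<epsilon>"
    using assms(3) by (intro order_tendstoD(2)) auto
  then obtain \<delta> where \<delta>: "0 < \<delta>" "\<And>s. s \<in> {0..T} \<Longrightarrow> s \<noteq> c \<Longrightarrow> dist s c < \<delta> \<Longrightarrow>
      Linf_norm lborel (\<lambda>x. u x s - u x c) < ennreal \<epsilon>"
    by (auto simp: eventually_at)
  have "AE x in lborel. \<bar>u x t - u x c\<bar> \<le> \<epsilon>" if "t \<in> {0..T}" "\<bar>t - c\<bar> < \<delta>" for t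
  proof (cases "t = c")
    case False
    then show ?thesis
      using \<delta>(2)[of t] that assms(3) by (intro Linf_norm_leD) (auto simp: dist_real_def)
  qed (use assms(3) in auto)
  then show ?thesis using \<delta>(1) by blast
qed

text \<open>Near each time \<open>c\<close> the solution differs from \<open>u(c)\<close> by at most \<open>1\<close>; finitely many such
neighbourhoods cover the compact interval.\<close>

lemma C_Linf_per_bounded:
  assumes u: "C_Linf_per T u"
  shows "\<exists>M\<ge>0. \<forall>t\<in>{0..T}. AE x in lborel. \<bar>u x t\<bar> \<le> M"
proof -
  have "\<forall>c\<in>{0..T}. \<exists>M. 0 \<le> M \<and> (AE x in lborel. \<bar>u x c\<bar> \<le> M)"
  proof
    fix c assume c: "c \<in> {0..T}"
    have "Linf_norm lborel (\<lambda>x. u x c) < \<infinity>" using u c by (auto simp: C_Linf_per_def in_Linf_def)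
    then obtain M where "0 \<le> M" "Linf_norm lborel (\<lambda>x. u x c) = ennreal M"
      by (cases "Linf_norm lborel (\<lambda>x. u x c)") auto
    then show "\<exists>M. 0 \<le> M \<and> (AE x in lborel. \<bar>u x c\<bar> \<le> M)"
      using Linf_norm_leD[of lborel "\<lambda>x. u x c" M] by auto
  qed
  from bchoice[OF this] obtain m where m: "\<And>c. c \<in> {0..T} \<Longrightarrow> 0 \<le> m c"
    "\<And>c. c \<in> {0..T} \<Longrightarrow> AE x in lborel. \<bar>u x c\<bar> \<le> m c"
    by blast
  have "\<forall>c\<in>{0..T}. \<exists>\<delta>>0. \<forall>t\<in>{0..T}. \<bar>t - c\<bar> < \<delta> \<longrightarrow> (AE x in lborel. \<bar>u x t - u x c\<bar> \<le> 1)"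
    using C_Linf_per_continuous[OF u, of _ 1] by simp
  from bchoice[OF this] obtain \<delta> where \<delta>: "\<And>c. c \<in> {0..T} \<Longrightarrow> 0 < \<delta> c"
    "\<And>c t. c \<in> {0..T} \<Longrightarrow> t \<in> {0..T} \<Longrightarrow> \<bar>t - c\<bar> < \<delta> c \<Longrightarrow> AE x in lborel. \<bar>u x t - u x c\<bar> \<le> 1"
    by blast
  have "{0..T} \<subseteq> (\<Union>c\<in>{0..T}. ball c (\<delta> c))" using \<delta>(1) by force
  then obtain C where C: "C \<subseteq> {0..T}" "finite C" "{0..T} \<subseteq> (\<Union>c\<in>C. ball c (\<delta> c))"
    using compactE_image[of "{0..T}" "{0..T}" "\<lambda>c. ball c (\<delta> c)"] by auto
  define M where "M = (\<Sum>c\<in>C. m c + 1)"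
  have m_le: "m c + 1 \<le> M" if "c \<in> C" for c
    unfolding M_def using C m(1) that by (intro member_le_sum) (auto intro: add_nonneg_nonneg)
  have "0 \<le> M" unfolding M_def using C m(1) by (intro sum_nonneg add_nonneg_nonneg) auto
  moreover have "AE x in lborel. \<bar>u x t\<bar> \<le> M" if t: "t \<in> {0..T}" for t
  proof -
    obtain c where c: "c \<in> C" "t \<in> ball c (\<delta> c)" using C(3) t by blast
    then have "AE x in lborel. \<bar>u x t - u x c\<bar> \<le> 1"
      using C(1) t by (intro \<delta>(2)) (auto simp: dist_real_def)
    moreover have "AE x in lborel. \<bar>u x c\<bar> \<le> m c" using m(2) C(1) c by blast
    ultimately show ?thesis
    proof eventually_elim
      case (elim x)
      then show ?case using m_le[OF c(1)] by linarith
    qed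
  qed
  ultimately show ?thesis by blast
qed

definition bounded_periodic :: "real \<Rightarrow> (real^'d \<Rightarrow> real \<Rightarrow> real) \<Rightarrow> bool" where
  "bounded_periodic M U \<longleftrightarrow> jointly_borel U \<and>
     (\<forall>x t. \<bar>U x t\<bar> \<le> M) \<and> (\<forall>t. periodic (\<lambda>x. U x t))"

lemma C_Linf_per_restrict_measurable:
  fixes u :: "real^'d \<Rightarrow> real \<Rightarrow> real"
  assumes "C_Linf_per T u"
  shows "(\<lambda>p. if snd p \<in> {0..T} then u (fst p) (snd p) else 0) \<in> borel_measurable (borel \<Otimes>\<^sub>M borel)"
proof -
  have "(\<lambda>(x, t). u x t) \<in> borel_measurable (restrict_space borel (UNIV \<times> {0..T}))"
    using assms by (simp add: C_Linf_per_def)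
  moreover have "UNIV \<times> {0..T} \<inter> space borel \<in> sets (borel :: ((real^'d) \<times> real) measure)"
    by (auto intro!: borel_closed closed_Times)
  ultimately have "(\<lambda>p. indicator (UNIV \<times> {0..T}) p *\<^sub>R (case p of (x, t) \<Rightarrow> u x t)) \<in> borel_measurable borel"
    by (simp add: borel_measurable_restrict_space_iff)
  moreover have "indicator (UNIV \<times> {0..T}) p *\<^sub>R (case p of (x, t) \<Rightarrow> u x t)
      = (if snd p \<in> {0..T} then u (fst p) (snd p) else 0)" for p
    by (auto simp: indicator_def split: prod.split)
  ultimately show ?thesis by (simp only: borel_prod)
qed

text \<open>Wrapping the space variable makes \<open>u\<close> periodic at every point, truncation makes it bounded at
every point; both change \<open>u(t)\<close> on a null set only.\<close>

lemma bounded_periodic_representative: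
  fixes u :: "real^'d \<Rightarrow> real \<Rightarrow> real"
  assumes u: "C_Linf_per T u"
  obtains M U where "bounded_periodic M U" "\<And>t. t \<in> {0..T} \<Longrightarrow> AE x in lborel. U x t = u x t"
proof -
  obtain M where M: "0 \<le> M" "\<And>t. t \<in> {0..T} \<Longrightarrow> AE x in lborel. \<bar>u x t\<bar> \<le> M"
    using C_Linf_per_bounded[OF u] by blast
  define w where "w x t = (if t \<in> {0..T} then u x t else 0)" for x t
  define U where "U x t = max (- M) (min M (w (wrap x) t))" for x t
  have [measurable]: "jointly_borel w"
    unfolding w_def by (rule C_Linf_per_restrict_measurable[OF u])
  have "(\<lambda>p. w (fst (wrap (fst p), snd p)) (snd (wrap (fst p), snd p)))
      \<in> borel_measurable (borel \<Otimes>\<^sub>M borel)"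
    by (rule measurable_compose[where g = "\<lambda>p. w (fst p) (snd p)"]) measurable
  then have "jointly_borel U"
    unfolding U_def fst_conv snd_conv
    by (intro borel_measurable_max borel_measurable_min borel_measurable_const)
  moreover have "\<bar>U x t\<bar> \<le> M" for x t using M(1) by (auto simp: U_def)
  moreover have "periodic (\<lambda>x. U x t)" for t
    using periodic_wrap[where ?'d = 'd] by (simp add: periodic_def U_def)
  ultimately have "bounded_periodic M U" by (simp add: bounded_periodic_def)
  moreover have "AE x in lborel. U x t = u x t" if t: "t \<in> {0..T}" for t
  proof -
    have "ae_periodic (\<lambda>x. u x t)" using u t by (simp add: C_Linf_per_def)
    from ae_periodic_wrap[OF this] M(2)[OF t] show ?thesis
      by eventually_elim (use t in \<open>auto simp: U_def w_def\<close>)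
  qed
  ultimately show ?thesis by (rule that)
qed

section \<open>Kernel test functions\<close>

text \<open>Precomposition with a translated coordinate projection. Since \<open>L\<close> maps a basis vector to a
basis vector or to zero, every partial derivative of the composition is again a partial
derivative of \<open>g\<close>, composed with the same map, or zero.\<close>

lemma Ck_on_compose_coordinate:
  fixes L :: "'a::euclidean_space \<Rightarrow> 'b::euclidean_space"
  assumes L: "bounded_linear L" and basis: "\<And>b. b \<in> Basis \<Longrightarrow> L b = 0 \<or> L b \<in> Basis"
    and S: "open S" and maps: "\<And>p. p \<in> S \<Longrightarrow> L p + a \<in> S'"
  shows "Ck_on k S' g \<Longrightarrow> Ck_on k S (\<lambda>p. g (L p + a))"
proof (induction k arbitrary: g)
  case 0
  have "continuous_on S (\<lambda>p. L p + a)"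
    using L by (intro continuous_intros linear_continuous_on)
  then show ?case using 0 maps by (auto intro: continuous_on_compose2)
next
  case (Suc k)
  have der: "((\<lambda>p. g (L p + a)) has_derivative (\<lambda>b. frechet_derivative g (at (L p + a)) (L b))) (at p)"
    if p: "p \<in> S" for p
  proof -
    have "((\<lambda>p. L p + a) has_derivative L) (at p)"
      using has_derivative_add[OF bounded_linear_imp_has_derivative[OF L] has_derivative_const[of a]]
      by simp
    moreover have "(g has_derivative frechet_derivative g (at (L p + a))) (at (L p + a))"
      using Suc.prems maps[OF p] by (auto simp: frechet_derivative_works[symmetric])
    ultimately show ?thesis by (rule has_derivative_compose)
  qed
  then have "(\<lambda>p. g (L p + a)) differentiable (at p)" if "p \<in> S" for p
    using that by (auto simp: differentiable_def)
  moreover have "Ck_on k S (\<lambda>p. frechet_derivative (\<lambda>p. g (L p + a)) (at p) b)" if b: "b \<in> Basis" for b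
  proof (subst Ck_on_cong[OF S])
    show "frechet_derivative (\<lambda>p. g (L p + a)) (at p) b = frechet_derivative g (at (L p + a)) (L b)"
      if "p \<in> S" for p
      by (simp add: frechet_derivative_at[OF der[OF that], symmetric])
    show "Ck_on k S (\<lambda>p. frechet_derivative g (at (L p + a)) (L b))"
    proof (cases "L b = 0")
      case True
      have "Ck_on k S (\<lambda>p. 0)" using smooth_on_const[of S 0] by (simp add: smooth_on_def)
      moreover have "frechet_derivative g (at (L p + a)) 0 = 0" if "p \<in> S" for p
        using Suc.prems maps[OF that]
        by (auto simp: frechet_derivative_works intro: linear_0 has_derivative_linear)
      ultimately show ?thesis using True by (subst Ck_on_cong[OF S, where h = "\<lambda>p. 0"]) auto
    next
      case False
      then have "L b \<in> Basis" using basis[OF b] by blast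
      then have "Ck_on k S' (\<lambda>y. frechet_derivative g (at y) (L b))" using Suc.prems by simp
      from Suc.IH[OF this] show ?thesis .
    qed
  qed
  ultimately show ?case by simp
qed

lemma smooth_on_compose_fst:
  assumes "smooth_on UNIV g"
  shows "smooth_on (UNIV \<times> {a<..<b}) (\<lambda>p :: (real^'d) \<times> real. g (fst p - y))"
  unfolding smooth_on_def
proof
  fix k
  have "Ck_on k (UNIV \<times> {a<..<b}) (\<lambda>p :: (real^'d) \<times> real. g (fst p + - y))"
    using assms unfolding smooth_on_def
    by (intro Ck_on_compose_coordinate[where S' = UNIV] bounded_linear_fst open_Times)
      (auto simp: Basis_prod_def)
  then show "Ck_on k (UNIV \<times> {a<..<b}) (\<lambda>p :: (real^'d) \<times> real. g (fst p - y))" by simp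
qed

lemma smooth_on_compose_snd:
  assumes "smooth_on {a<..<b} g"
  shows "smooth_on (UNIV \<times> {a<..<b}) (\<lambda>p :: (real^'d) \<times> real. g (snd p))"
  unfolding smooth_on_def
proof
  fix k
  have "Ck_on k (UNIV \<times> {a<..<b}) (\<lambda>p :: (real^'d) \<times> real. g (snd p + 0))"
    using assms unfolding smooth_on_def
    by (intro Ck_on_compose_coordinate[where S' = "{a<..<b}"] bounded_linear_snd open_Times)
      (auto simp: Basis_prod_def)
  then show "Ck_on k (UNIV \<times> {a<..<b}) (\<lambda>p :: (real^'d) \<times> real. g (snd p))" by simp
qed

definition time_test :: "real \<Rightarrow> (real \<Rightarrow> real) \<Rightarrow> bool" where
  "time_test T \<psi> \<longleftrightarrow> smooth_on {0<..<T} \<psi> \<and> (\<forall>t. 0 \<le> \<psi> t) \<and>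
     (\<exists>a b. 0 < a \<and> b < T \<and> (\<forall>t. t \<notin> {a..b} \<longrightarrow> \<psi> t = 0))"

context mollifier
begin

lemma entropy_test_kernel:
  assumes "time_test T \<psi>"
  shows "entropy_test T (\<lambda>x t. \<omega> (x - y) * \<psi> t)"
  unfolding entropy_test_def
proof (intro conjI allI ballI)
  have "smooth_on (UNIV \<times> {0<..<T}) (\<lambda>p. \<omega> (fst p - y) * \<psi> (snd p))"
    using assms by (intro smooth_on_mult smooth_on_compose_fst smooth_on_compose_snd smooth open_Times)
      (auto simp: time_test_def)
  then show "smooth_on (UNIV \<times> {0<..<T}) (\<lambda>(x, t). \<omega> (x - y) * \<psi> t)"
    by (simp add: case_prod_unfold)
  show "0 \<le> \<omega> (x - y) * \<psi> t" for x t using assms nonneg by (simp add: time_test_def)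
  show "\<omega> (x + axis i (2 * pi) - y) * \<psi> t = \<omega> (x - y) * \<psi> t" for x i t
  proof -
    have "\<omega> ((x - y) + axis i (2 * pi)) = \<omega> (x - y)" using periodic by (simp add: periodic_def)
    then show ?thesis by (simp add: algebra_simps)
  qed
  obtain a b where "0 < a" "b < T" "\<And>t. t \<notin> {a..b} \<Longrightarrow> \<psi> t = 0"
    using assms by (auto simp: time_test_def)
  then show "\<exists>K. compact K \<and> K \<subseteq> {0<..<T} \<and> (\<forall>x. \<forall>t\<in>{0<..<T} - K. \<omega> (x - y) * \<psi> t = 0)"
    by (intro exI[of _ "{a..b}"]) auto
qed

lemma has_derivative_translate:
  "((\<lambda>z. \<omega> (z - y) * c) has_derivative (\<lambda>b. (c *\<^sub>R grad \<omega> (x - y)) \<bullet> b)) (at x)"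
proof -
  have "((\<lambda>z. z - y) has_derivative (\<lambda>b. b)) (at x)" by (auto intro!: derivative_eq_intros)
  from has_derivative_compose[OF this has_derivative_grad[OF smooth_on_differentiable[OF smooth UNIV_I]]]
  have "((\<lambda>z. \<omega> (z - y)) has_derivative (\<lambda>b. grad \<omega> (x - y) \<bullet> b)) (at x)" .
  from has_derivative_mult_left[OF this, of c] show ?thesis by (simp add: mult.commute)
qed

lemma grad_translate: "grad (\<lambda>z. \<omega> (z - y) * c) x = c *\<^sub>R grad \<omega> (x - y)"
  by (rule grad_eqI[OF has_derivative_translate])

lemma levy_adj_translate: "levy_adj \<nu> r (\<lambda>z. \<omega> (z - y) * c) x = c * levy_adj \<nu> r \<omega> (x - y)"
proof -
  have "\<omega> (x - z - y) * c - \<omega> (x - y) * c + (z \<bullet> (c *\<^sub>R grad \<omega> (x - y))) * of_bool (norm z < 1)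
    = c * (\<omega> ((x - y) - z) - \<omega> (x - y) + (z \<bullet> grad \<omega> (x - y)) * of_bool (norm z < 1))" for z
    by (simp add: algebra_simps)
  then show ?thesis
    by (simp only: levy_adj_def grad_translate set_integral_mult_right)
qed

end

section \<open>The entropy inequality for a kernel\<close>

definition far_operator :: "(real^'d) measure \<Rightarrow> real \<Rightarrow> (real^'d \<Rightarrow> real \<Rightarrow> real) \<Rightarrow> (real^'d) \<times> real \<Rightarrow> real"
  where "far_operator \<nu> r U p = (\<integral>z. U (fst p + z) (snd p) - U (fst p) (snd p) \<partial>far_part \<nu> r)"

text \<open>The entropy integrand at \<open>p = (x, t)\<close> for the test function \<open>\<omega>(x - y) \<psi>(t)\<close>. The values
\<open>a = \<psi>(t)\<close> and \<open>a' = \<psi>'(t)\<close> are passed as numbers, because in the doubling argument they depend on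
the second time variable as well.\<close>

definition kernel_integrand ::
  "(real \<Rightarrow> real^'d) \<Rightarrow> (real^'d) measure \<Rightarrow> real \<Rightarrow> real^'d \<Rightarrow> (real^'d \<Rightarrow> real) \<Rightarrow> (real^'d \<Rightarrow> real \<Rightarrow> real)
    \<Rightarrow> real \<Rightarrow> real^'d \<Rightarrow> real \<Rightarrow> real \<Rightarrow> (real^'d) \<times> real \<Rightarrow> real" where
  "kernel_integrand f \<nu> r \<gamma> \<omega> U k y a a' p =
     \<bar>U (fst p) (snd p) - k\<bar> * (\<omega> (fst p - y) * a')
     + qflux f (U (fst p) (snd p)) k \<bullet> (a *\<^sub>R grad \<omega> (fst p - y))
     + \<bar>U (fst p) (snd p) - k\<bar> * (a * levy_adj \<nu> r \<omega> (fst p - y))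
     + sgn (U (fst p) (snd p) - k) * far_operator \<nu> r U p * (\<omega> (fst p - y) * a)
     + \<bar>U (fst p) (snd p) - k\<bar> * (\<gamma> \<bullet> (a *\<^sub>R grad \<omega> (fst p - y)))"

lemma qflux_eq: "qflux f a b = sgn (a - b) *\<^sub>R (f a - f b)"
  by (simp add: qflux_def eta'_def vec_eq_iff)

lemma qflux_measurable [measurable (raw)]:
  assumes [measurable]: "f \<in> borel_measurable borel" "g \<in> borel_measurable N" "h \<in> borel_measurable N"
  shows "(\<lambda>w. qflux f (g w) (h w)) \<in> borel_measurable N"
  unfolding qflux_eq sgn_if by measurable

lemma (in levy) far_operator_measurable:
  assumes r: "0 < r" and U: "jointly_borel U"
  shows "far_operator \<mu> r U \<in> borel_measurable (borel \<Otimes>\<^sub>M borel)"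
proof -
  interpret far: finite_measure "far_part \<mu> r" by (rule finite_measure_far_part[OF r])
  have "(\<lambda>w. U (fst (fst (fst w) + snd w, snd (fst w))) (snd (fst (fst w) + snd w, snd (fst w))))
      \<in> borel_measurable ((borel \<Otimes>\<^sub>M borel) \<Otimes>\<^sub>M far_part \<mu> r)"
    by (rule measurable_compose[OF _ U]) measurable
  moreover have "(\<lambda>w. U (fst (fst w)) (snd (fst w))) \<in> borel_measurable ((borel \<Otimes>\<^sub>M borel) \<Otimes>\<^sub>M far_part \<mu> r)"
    by (rule measurable_compose[OF _ U]) measurable
  ultimately have "(\<lambda>w. U (fst (fst w) + snd w) (snd (fst w)) - U (fst (fst w)) (snd (fst w)))
      \<in> borel_measurable ((borel \<Otimes>\<^sub>M borel) \<Otimes>\<^sub>M far_part \<mu> r)"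
    unfolding fst_conv snd_conv by (rule borel_measurable_diff)
  then show ?thesis
    unfolding far_operator_def[abs_def]
    by (intro far.borel_measurable_lebesgue_integral) (simp add: case_prod_unfold)
qed

lemma (in levy) kernel_integrand_measurable:
  assumes \<omega>: "mollifier \<omega>" and r: "0 < r"
    and U: "jointly_borel U"
    and [measurable]: "f \<in> borel_measurable borel" "k \<in> borel_measurable N" "y \<in> borel_measurable N"
      "a \<in> borel_measurable N" "a' \<in> borel_measurable N" "p \<in> measurable N (borel \<Otimes>\<^sub>M borel)"
  shows "(\<lambda>w. kernel_integrand f \<mu> r \<gamma> \<omega> U (k w) (y w) (a w) (a' w) (p w)) \<in> borel_measurable N"
proof -
  interpret mollifier \<omega> by fact
  note [measurable] = levy_adj_measurable[OF \<omega>, of r]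
  have [measurable]: "(\<lambda>w. far_operator \<mu> r U (p w)) \<in> borel_measurable N"
    by (rule measurable_compose[OF _ far_operator_measurable[OF r U]]) measurable
  have [measurable]: "(\<lambda>w. U (fst (p w)) (snd (p w))) \<in> borel_measurable N"
    by (rule measurable_compose[OF _ U]) measurable
  show ?thesis unfolding kernel_integrand_def sgn_if by measurable
qed

text \<open>The representative agrees with the solution at every time, but only almost everywhere in
space; Fubini's theorem turns this into agreement almost everywhere in space and time.\<close>

lemma AE_cylinderI:
  fixes P :: "(real^'d) \<times> real \<Rightarrow> bool"
  assumes P: "{p. P p} \<in> sets (borel \<Otimes>\<^sub>M borel)"
    and ae: "\<And>t. t \<in> {0<..<T} \<Longrightarrow> AE x in lborel. P (x, t)"
  shows "AE p in cylinder_measure T. P p"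
proof -
  have meas: "{p. snd p \<in> {0<..<T} \<longrightarrow> P p} \<in> sets (lborel \<Otimes>\<^sub>M lborel)"
  proof -
    have "{p :: (real^'d) \<times> real. snd p \<in> {0<..<T} \<longrightarrow> P p} = snd -` (- {0<..<T}) \<inter> space (borel \<Otimes>\<^sub>M borel) \<union> {p. P p}"
      by (auto simp: space_pair_measure)
    also have "\<dots> \<in> sets (borel \<Otimes>\<^sub>M borel)"
      by (intro sets.Un P measurable_sets[OF measurable_snd]) auto
    also have "\<dots> = sets (lborel \<Otimes>\<^sub>M lborel)" by (intro sets_pair_measure_cong) auto
    finally show ?thesis .
  qed
  have "AE t in lborel. AE x in lborel. snd (x, t) \<in> {0<..<T} \<longrightarrow> P (x, t)"
  proof (rule AE_I2)
    show "AE x in lborel. snd (x, t) \<in> {0<..<T} \<longrightarrow> P (x, t)" for t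
      using ae[of t] by (cases "t \<in> {0<..<T}") auto
  qed
  then have "AE x in lborel. AE t in lborel. snd (x, t) \<in> {0<..<T} \<longrightarrow> P (x, t)"
    using meas by (subst lborel_pair.AE_commute) (auto simp: space_pair_measure)
  then have "AE p in lborel \<Otimes>\<^sub>M lborel. snd p \<in> {0<..<T} \<longrightarrow> P p"
    using meas by (intro lborel_pair.AE_pair_measure) (auto simp: space_pair_measure)
  then have "AE p in lborel. snd p \<in> {0<..<T} \<longrightarrow> P p" by (subst (asm) lborel_prod)
  then have "AE p in lborel. 0 < (indicator (Lam \<times> {0<..<T}) p :: ennreal) \<longrightarrow> P p"
    by eventually_elim (auto simp: indicator_def split: if_splits)
  moreover have "indicator (Lam \<times> {0<..<T}) \<in> borel_measurable (lborel :: ((real^'d) \<times> real) measure)"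
    by (intro borel_measurable_indicator) (simp add: borel_prod[symmetric])
  ultimately show ?thesis
    unfolding cylinder_measure_eq by (subst AE_density)
qed

definition representative :: "real \<Rightarrow> real \<Rightarrow> (real^'d \<Rightarrow> real \<Rightarrow> real) \<Rightarrow> (real^'d \<Rightarrow> real \<Rightarrow> real) \<Rightarrow> bool" where
  "representative T M u U \<longleftrightarrow> bounded_periodic M U \<and> (\<forall>t\<in>{0..T}. AE x in lborel. U x t = u x t)"

text \<open>The entropy inequality for the representative. The far part of the operator evaluates \<open>u\<close> at
\<open>x + z\<close> with \<open>z\<close> distributed according to \<open>\<mu>\<close>, which may be singular; that it does not see the
change of representative for almost every \<open>x\<close> follows by exchanging \<open>x\<close> and \<open>z\<close>, since for
each \<open>z\<close> the exceptional set of \<open>x\<close> is a translate of a null set.\<close>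

lemma kernel_entropy_inequality:
  fixes u U :: "real^'d \<Rightarrow> real \<Rightarrow> real"
  assumes \<omega>: "mollifier \<omega>" and \<mu>: "levy_measure \<mu>" and f: "f \<in> borel_measurable borel"
    and u: "periodic_entropy_solution f \<mu> T u\<^sub>0 u" and U: "representative T M u U"
    and r: "0 < r" and \<psi>: "time_test T \<psi>"
    and der: "\<And>t. (\<psi> has_real_derivative \<psi>' t) (at t)" and [measurable]: "\<psi>' \<in> borel_measurable borel"
  shows "0 \<le> (\<integral>p. kernel_integrand f (distr \<mu> borel (\<lambda>z. z)) r (gamma_drift \<mu> r) \<omega> U k y
      (\<psi> (snd p)) (\<psi>' (snd p)) p \<partial>cylinder_measure T)"
proof -
  define \<nu> where "\<nu> = distr \<mu> borel (\<lambda>z. z)"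
  interpret mollifier \<omega> by fact
  interpret levy \<nu> unfolding \<nu>_def by (rule levy_measureD[OF \<mu>])
  interpret far: finite_measure "far_part \<nu> r" by (rule finite_measure_far_part[OF r])
  interpret lf: pair_sigma_finite "lborel :: (real^'d) measure" "far_part \<nu> r" ..
  have C: "C_Linf_per T u" using u by (simp add: periodic_entropy_solution_def)
  \<comment> \<open>\<open>u\<close> is jointly measurable for times in \<open>[0, T]\<close> only\<close>
  define w where "w x t = (if t \<in> {0..T} then u x t else 0)" for x t
  have w_meas: "jointly_borel w"
    unfolding w_def by (rule C_Linf_per_restrict_measurable[OF C])
  have U_meas: "jointly_borel U"
    using U by (simp add: representative_def bounded_periodic_def)
  have [measurable]: "\<psi> \<in> borel_measurable borel"
    using der by (intro borel_measurable_continuous_onI continuous_at_imp_continuous_on ballI DERIV_isCont)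
  define E where "E W p = kernel_integrand f \<nu> r (gamma_drift \<mu> r) \<omega> W k y (\<psi> (snd p)) (\<psi>' (snd p)) p" for W p
  have E_meas [measurable]: "E W \<in> borel_measurable (borel \<Otimes>\<^sub>M borel)"
    if "jointly_borel W" for W
    unfolding E_def[abs_def] by (rule kernel_integrand_measurable[OF \<omega> r that f]) measurable
  have sections [measurable]: "(\<lambda>x. w x t) \<in> borel_measurable borel" "(\<lambda>x. U x t) \<in> borel_measurable borel" for t
    using measurable_compose[OF _ w_meas, of "\<lambda>x. (x, t)"] measurable_compose[OF _ U_meas, of "\<lambda>x. (x, t)"]
    by simp_all
  define \<phi> where "\<phi> x t = \<omega> (x - y) * \<psi> t" for x t
  have "entropy_test T \<phi>" unfolding \<phi>_def[abs_def] by (rule entropy_test_kernel[OF \<psi>])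
  then have "0 \<le> (LINT (x, t):(Lam \<times> {0<..<T})|lborel. entropy_integrand f \<mu> k r \<phi> u x t)"
    using u r by (simp add: periodic_entropy_solution_def)
  also have "\<dots> = (LINT p:(Lam \<times> {0<..<T})|lborel. E w p)"
  proof (rule set_lebesgue_integral_cong)
    show "Lam \<times> {0<..<T} \<in> sets lborel" by (simp add: borel_prod[symmetric])
    have "entropy_integrand f \<mu> k r \<phi> u x t = E w (x, t)" if t: "t \<in> {0<..<T}" for x t
    proof -
      have w: "w z t = u z t" for z using t by (simp add: w_def)
      have d: "deriv (\<lambda>s. \<phi> x s) t = \<omega> (x - y) * \<psi>' t"
        unfolding \<phi>_def by (rule DERIV_imp_deriv) (intro DERIV_cmult der)
      have "(\<lambda>z. \<phi> z t) \<in> borel_measurable borel" unfolding \<phi>_def by measurable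
      then have a: "levy_adj \<mu> r (\<lambda>z. \<phi> z t) x = \<psi> t * levy_adj \<nu> r \<omega> (x - y)"
        using levy_operators_distr(1)[OF \<mu>] levy_adj_translate by (simp add: \<nu>_def \<phi>_def)
      have u_meas: "(\<lambda>z. u z t) \<in> borel_measurable borel" using sections(1)[of t] by (simp add: w)
      have b: "levy_far \<mu> r (\<lambda>z. u z t) x = far_operator \<nu> r w (x, t)"
        using levy_operators_distr(2)[OF \<mu> u_meas] levy_far_eq[OF u_meas]
        by (simp add: \<nu>_def[symmetric] far_operator_def w)
      have g: "grad (\<lambda>z. \<phi> z t) x = \<psi> t *\<^sub>R grad \<omega> (x - y)"
        unfolding \<phi>_def by (rule grad_translate)
      show ?thesis
        unfolding entropy_integrand_def E_def kernel_integrand_def d a b g eta_def eta'_def fst_conv snd_conv w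
        by (simp add: \<phi>_def)
    qed
    then show "\<forall>p. p \<in> Lam \<times> {0<..<T} \<longrightarrow> (case p of (x, t) \<Rightarrow> entropy_integrand f \<mu> k r \<phi> u x t) = E w p"
      by auto
  qed
  also have "\<dots> = integral\<^sup>L (cylinder_measure T) (E w)"
    by (rule integral_cylinder[symmetric]) (rule E_meas[OF w_meas])
  also have "\<dots> = integral\<^sup>L (cylinder_measure T) (E U)"
  proof (rule integral_cong_AE)
    show "AE p in cylinder_measure T. E w p = E U p"
    proof (rule AE_cylinderI)
      note [measurable] = E_meas[OF w_meas] E_meas[OF U_meas]
      have "{p \<in> space (borel \<Otimes>\<^sub>M borel). E w p = E U p} \<in> sets (borel \<Otimes>\<^sub>M borel)" by measurable
      then show "{p. E w p = E U p} \<in> sets (borel \<Otimes>\<^sub>M borel)" by (simp add: space_pair_measure)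
      fix t assume t: "t \<in> {0<..<T}"
      have eq: "AE x in lborel. w x t = U x t"
      proof -
        have "AE x in lborel. U x t = u x t" using U t by (auto simp: representative_def)
        then show ?thesis by eventually_elim (use t in \<open>simp add: w_def\<close>)
      qed
      have "AE z in far_part \<nu> r. AE x in lborel. w (x + z) t = U (x + z) t"
        by (rule AE_I2) (rule AE_lborel_shift[OF eq])
      moreover have "{p \<in> space (lborel \<Otimes>\<^sub>M far_part \<nu> r). w (fst p + snd p) t = U (fst p + snd p) t}
          \<in> sets (lborel \<Otimes>\<^sub>M far_part \<nu> r)"
        by measurable
      ultimately have "AE x in lborel. AE z in far_part \<nu> r. w (x + z) t = U (x + z) t"
        by (subst lf.AE_commute)
      with eq show "AE x in lborel. E w (x, t) = E U (x, t)"
      proof eventually_elim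
        case (elim x)
        have "far_operator \<nu> r w (x, t) = far_operator \<nu> r U (x, t)"
          unfolding far_operator_def fst_conv snd_conv
        proof (rule integral_cong_AE)
          show "AE z in far_part \<nu> r. w (x + z) t - w x t = U (x + z) t - U x t"
            using elim(2) by eventually_elim (simp add: elim(1))
        qed measurable
        then show ?case using elim(1) by (simp add: E_def kernel_integrand_def)
      qed
    qed
  qed (use E_meas[OF w_meas] E_meas[OF U_meas] in measurable)
  finally show ?thesis by (simp add: E_def[abs_def] \<nu>_def)
qed

section \<open>Doubling of the variables\<close>

abbreviation gap :: "('a \<Rightarrow> real \<Rightarrow> real) \<Rightarrow> ('a \<Rightarrow> real \<Rightarrow> real) \<Rightarrow> 'a \<times> real \<Rightarrow> 'a \<times> real \<Rightarrow> real" where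
  "gap U V p q \<equiv> \<bar>U (fst p) (snd p) - V (fst q) (snd q)\<bar>"

lemma bounded_periodic_compose:
  assumes "bounded_periodic M U" "a \<in> borel_measurable N" "b \<in> borel_measurable N"
  shows "(\<lambda>w. U (a w) (b w)) \<in> borel_measurable N"
  using measurable_compose[OF measurable_Pair[OF assms(2,3)], of "\<lambda>p. U (fst p) (snd p)" borel] assms(1)
  by (simp add: bounded_periodic_def)

lemma bounded_periodicD:
  assumes "bounded_periodic M U"
  shows "\<bar>U x t\<bar> \<le> M" and "U (x + axis i (2 * pi)) t = U x t"
  using assms by (auto simp: bounded_periodic_def periodic_def)

lemma measurable_compose_curried:
  assumes "jointly_borel \<psi>"
    and "a \<in> borel_measurable N" "b \<in> borel_measurable N"
  shows "(\<lambda>w. \<psi> (a w) (b w)) \<in> borel_measurable N"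
  using measurable_compose[OF measurable_Pair[OF assms(2,3)] assms(1)] by simp

lemma (in levy) far_operator_bound:
  assumes r: "0 < r" and U: "bounded_periodic M U"
  shows "\<bar>far_operator \<mu> r U p\<bar> \<le> 2 * M * measure (far_part \<mu> r) UNIV"
proof -
  interpret far: finite_measure "far_part \<mu> r" by (rule finite_measure_far_part[OF r])
  note [measurable (raw)] = bounded_periodic_compose[OF U]
  have bound: "norm (U (fst p + z) (snd p) - U (fst p) (snd p)) \<le> 2 * M" for z
    using bounded_periodicD(1)[OF U, of "fst p + z" "snd p"] bounded_periodicD(1)[OF U, of "fst p" "snd p"]
    by simp
  have "norm (far_operator \<mu> r U p) \<le> (\<integral>z. 2 * M \<partial>far_part \<mu> r)"
    unfolding far_operator_def
  proof (rule Bochner_Integration.integral_norm_bound_integral[OF _ _ bound])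
    show "integrable (far_part \<mu> r) (\<lambda>z. U (fst p + z) (snd p) - U (fst p) (snd p))"
      by (rule far.integrable_const_bound[of _ "2 * M"]) (use bound in auto)
  qed auto
  then show ?thesis by (simp add: mult_ac)
qed

lemma (in levy) kernel_integrand_bound:
  assumes \<omega>: "mollifier \<omega>" and r: "0 < r" and U: "bounded_periodic M U"
    and f: "\<And>a. \<bar>a\<bar> \<le> M \<Longrightarrow> norm (f a) \<le> F" and A: "\<And>x. \<bar>levy_adj \<mu> r \<omega> x\<bar> \<le> A"
  shows "\<exists>C. \<forall>k y a a' p. \<bar>k\<bar> \<le> M \<longrightarrow> \<bar>a\<bar> \<le> B \<longrightarrow> \<bar>a'\<bar> \<le> B \<longrightarrow>
    \<bar>kernel_integrand f \<mu> r \<gamma> \<omega> U k y a a' p\<bar> \<le> C"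
proof -
  interpret mollifier \<omega> by fact
  obtain W where W: "0 \<le> W" "\<And>x. \<bar>\<omega> x\<bar> \<le> W" using bounded by blast
  obtain G where G: "0 \<le> G" "\<And>x. norm (grad \<omega> x) \<le> G" using grad_bounded[OF smooth periodic] by blast
  have abs_le: "\<bar>e1 + e2 + e3 + e4 + e5\<bar> \<le> b1 + b2 + b3 + b4 + b5"
    if "\<bar>e1\<bar> \<le> b1" "\<bar>e2\<bar> \<le> b2" "\<bar>e3\<bar> \<le> b3" "\<bar>e4\<bar> \<le> b4" "\<bar>e5\<bar> \<le> b5"
    for e1 e2 e3 e4 e5 b1 b2 b3 b4 b5 :: real
    using that by linarith
  define N where "N = 2 * M * measure (far_part \<mu> r) UNIV"
  have "\<bar>kernel_integrand f \<mu> r \<gamma> \<omega> U k y a a' p\<bar>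
      \<le> 2 * M * (W * B) + 2 * F * (B * G) + 2 * M * (B * A) + 1 * N * (W * B) + 2 * M * (norm \<gamma> * (B * G))"
    if k: "\<bar>k\<bar> \<le> M" and a: "\<bar>a\<bar> \<le> B" and a': "\<bar>a'\<bar> \<le> B" for k y a a' p
  proof -
    have B: "0 \<le> B" using a by linarith
    have M: "0 \<le> M" using k by linarith
    have F: "0 \<le> F" using f[OF k] norm_ge_zero order_trans by blast
    have A0: "0 \<le> A" using A order_trans abs_ge_zero by blast
    define v where "v = U (fst p) (snd p)"
    have v: "\<bar>v\<bar> \<le> M" unfolding v_def by (rule bounded_periodicD[OF U])
    have vk: "\<bar>v - k\<bar> \<le> 2 * M" using v k by linarith
    have s: "\<bar>sgn (v - k)\<bar> \<le> 1" by (simp add: sgn_if)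
    have q: "norm (qflux f v k) \<le> 2 * F"
    proof -
      have "norm (qflux f v k) \<le> norm (f v - f k)"
        by (simp add: qflux_eq sgn_if)
      also have "\<dots> \<le> norm (f v) + norm (f k)" by (rule norm_triangle_ineq4)
      finally show ?thesis using f[OF v] f[OF k] by linarith
    qed
    let ?g = "a *\<^sub>R grad \<omega> (fst p - y)"
    have g: "norm ?g \<le> B * G" using mult_mono[OF a G(2) B] by simp
    have 1: "\<bar>\<bar>v - k\<bar> * (\<omega> (fst p - y) * a')\<bar> \<le> 2 * M * (W * B)"
      using vk W a' B M by (auto simp: abs_mult intro!: mult_mono)
    have 2: "\<bar>qflux f v k \<bullet> ?g\<bar> \<le> 2 * F * (B * G)"
      by (rule order_trans[OF Cauchy_Schwarz_ineq2]) (use q g F in \<open>auto intro!: mult_mono\<close>)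
    have 3: "\<bar>\<bar>v - k\<bar> * (a * levy_adj \<mu> r \<omega> (fst p - y))\<bar> \<le> 2 * M * (B * A)"
      using vk a A B M A0 by (auto simp: abs_mult intro!: mult_mono)
    have "\<bar>sgn (v - k)\<bar> * \<bar>far_operator \<mu> r U p\<bar> * (\<bar>\<omega> (fst p - y)\<bar> * \<bar>a\<bar>) \<le> 1 * N * (W * B)"
      using far_operator_bound[OF r U, of p] s W a
      by (intro mult_mono) (auto simp: N_def M intro!: mult_nonneg_nonneg)
    then have 4: "\<bar>sgn (v - k) * far_operator \<mu> r U p * (\<omega> (fst p - y) * a)\<bar> \<le> 1 * N * (W * B)"
      by (simp only: abs_mult)
    have "\<bar>\<gamma> \<bullet> ?g\<bar> \<le> norm \<gamma> * (B * G)"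
      by (rule order_trans[OF Cauchy_Schwarz_ineq2]) (use g in \<open>auto intro!: mult_mono\<close>)
    then have 5: "\<bar>\<bar>v - k\<bar> * (\<gamma> \<bullet> ?g)\<bar> \<le> 2 * M * (norm \<gamma> * (B * G))"
      using vk M unfolding abs_mult abs_abs by (intro mult_mono) auto
    show ?thesis
      unfolding kernel_integrand_def v_def[symmetric] by (rule abs_le[OF 1 2 3 4 5])
  qed
  then show ?thesis by blast
qed

text \<open>Shift one space variable after the other.\<close>

lemma double_cylinder_shift:
  fixes h :: "((real^'d) \<times> real) \<times> ((real^'d) \<times> real) \<Rightarrow> real"
  assumes [measurable]: "h \<in> borel_measurable ((borel \<Otimes>\<^sub>M borel) \<Otimes>\<^sub>M (borel \<Otimes>\<^sub>M borel))"
    and h: "\<And>w. 0 \<le> h w" "\<And>w. h w \<le> C"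
    and per: "\<And>t q. periodic (\<lambda>x. h ((x, t), q))" "\<And>p s. periodic (\<lambda>y. h (p, (y, s)))"
  shows "(\<integral>w. h ((fst (fst w) + z, snd (fst w)), (fst (snd w) + z, snd (snd w)))
      \<partial>doubled_measure T)
    = integral\<^sup>L (doubled_measure T) h"
proof -
  let ?c = "cylinder_measure T :: ((real^'d) \<times> real) measure"
  note fub = fubini_bounded[OF finite_measure_cylinder finite_measure_cylinder, where C = C]
  have bound: "\<bar>h w\<bar> \<le> C" for w using h[of w] by simp
  have "(\<integral>w. h ((fst (fst w) + z, snd (fst w)), (fst (snd w) + z, snd (snd w))) \<partial>(?c \<Otimes>\<^sub>M ?c))
    = (\<integral>p. \<integral>q. h ((fst p + z, snd p), (fst q + z, snd q)) \<partial>?c \<partial>?c)"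
    using fub(2)[where g = "\<lambda>w. h ((fst (fst w) + z, snd (fst w)), (fst (snd w) + z, snd (snd w)))"] bound
    by simp
  also have "\<dots> = (\<integral>p. \<integral>q. h ((fst p + z, snd p), q) \<partial>?c \<partial>?c)"
    using integral_cylinder_shift[where g = "\<lambda>q. h ((fst p + z, snd p), q)" and z = z for p] h per by simp
  also have "\<dots> = (\<integral>q. \<integral>p. h ((fst p + z, snd p), q) \<partial>?c \<partial>?c)"
    using fub(2,3)[where g = "\<lambda>w. h ((fst (fst w) + z, snd (fst w)), snd w)"] bound by simp
  also have "\<dots> = (\<integral>q. \<integral>p. h (p, q) \<partial>?c \<partial>?c)"
    using integral_cylinder_shift[where g = "\<lambda>p. h (p, q)" and z = z for q] h per
      measurable_Pair2[OF assms(1)] by (simp add: space_pair_measure)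
  also have "\<dots> = integral\<^sup>L (?c \<Otimes>\<^sub>M ?c) h"
    using fub(3)[where g = h] bound by simp
  finally show ?thesis .
qed

text \<open>The cancellation of the fluxes and of the drift terms: \<open>qflux\<close> is symmetric in its two states,
while the gradients at \<open>x - y\<close> and \<open>y - x\<close> are opposite.\<close>

lemma doubled_pointwise:
  assumes \<omega>: "mollifier \<omega>" and sym: "a = b"
  shows "kernel_integrand f \<nu> r \<gamma> \<omega> U (V (fst q) (snd q)) (fst q) a a' p
     + kernel_integrand f \<nu> r \<gamma> \<omega> V (U (fst p) (snd p)) (fst p) b b' q
   = gap U V p q * \<omega> (fst p - fst q) * (a' + b')
     + gap U V p q * a * (levy_adj \<nu> r \<omega> (fst p - fst q) + levy_adj \<nu> r \<omega> (fst q - fst p))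
     + a * \<omega> (fst p - fst q) * (sgn (U (fst p) (snd p) - V (fst q) (snd q)) * (far_operator \<nu> r U p - far_operator \<nu> r V q))"
proof -
  interpret mollifier \<omega> by fact
  define u v where "u = U (fst p) (snd p)" and "v = V (fst q) (snd q)"
  have 1: "\<omega> (fst q - fst p) = \<omega> (fst p - fst q)" using even[of "fst p - fst q"] by simp
  have 2: "grad \<omega> (fst q - fst p) = - grad \<omega> (fst p - fst q)" using grad_odd[of "fst p - fst q"] by simp
  have 3: "qflux f v u = qflux f u v"
    by (simp add: qflux_eq sgn_if)
  have 4: "\<bar>v - u\<bar> = \<bar>u - v\<bar>" by (rule abs_minus_commute)
  have 5: "sgn (v - u) = - sgn (u - v)" by (simp add: sgn_if)
  show ?thesis
    unfolding kernel_integrand_def u_def[symmetric] v_def[symmetric] 1 2 3 4 5 sym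
    by (simp add: algebra_simps)
qed

text \<open>Kato's inequality: \<open>sgn a * a = |a|\<close> and \<open>sgn a * b \<le> |b|\<close>.\<close>

lemma (in levy) far_operator_kato:
  assumes r: "0 < r" and U: "bounded_periodic M U" and V: "bounded_periodic M V"
  shows "sgn (U (fst p) (snd p) - V (fst q) (snd q)) * (far_operator \<mu> r U p - far_operator \<mu> r V q)
    \<le> (\<integral>z. \<bar>U (fst p + z) (snd p) - V (fst q + z) (snd q)\<bar> - gap U V p q \<partial>far_part \<mu> r)"
proof -
  interpret far: finite_measure "far_part \<mu> r" by (rule finite_measure_far_part[OF r])
  note [measurable (raw)] = bounded_periodic_compose[OF U] bounded_periodic_compose[OF V]
  note bU = bounded_periodicD(1)[OF U] and bV = bounded_periodicD(1)[OF V]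
  define u v where "u = U (fst p) (snd p)" and "v = V (fst q) (snd q)"
  have int: "integrable (far_part \<mu> r) g" if "g \<in> borel_measurable borel" "\<And>z. \<bar>g z\<bar> \<le> 4 * M" for g
    using that by (intro far.integrable_const_bound[of _ "4 * M"]) auto
  have iU: "integrable (far_part \<mu> r) (\<lambda>z. U (fst p + z) (snd p) - u)"
  proof (rule int)
    show "\<bar>U (fst p + z) (snd p) - u\<bar> \<le> 4 * M" for z
      using bU[of "fst p + z" "snd p"] bU[of "fst p" "snd p"] unfolding u_def by linarith
  qed measurable
  have iV: "integrable (far_part \<mu> r) (\<lambda>z. V (fst q + z) (snd q) - v)"
  proof (rule int)
    show "\<bar>V (fst q + z) (snd q) - v\<bar> \<le> 4 * M" for z
      using bV[of "fst q + z" "snd q"] bV[of "fst q" "snd q"] unfolding v_def by linarith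
  qed measurable
  have iUV: "integrable (far_part \<mu> r) (\<lambda>z. \<bar>U (fst p + z) (snd p) - V (fst q + z) (snd q)\<bar> - \<bar>u - v\<bar>)"
  proof (rule int)
    show "\<bar>\<bar>U (fst p + z) (snd p) - V (fst q + z) (snd q)\<bar> - \<bar>u - v\<bar>\<bar> \<le> 4 * M" for z
      using bU[of "fst p + z" "snd p"] bU[of "fst p" "snd p"] bV[of "fst q + z" "snd q"] bV[of "fst q" "snd q"]
      unfolding u_def v_def by linarith
  qed measurable
  have "sgn (u - v) * (far_operator \<mu> r U p - far_operator \<mu> r V q)
    = (\<integral>z. sgn (u - v) * ((U (fst p + z) (snd p) - u) - (V (fst q + z) (snd q) - v)) \<partial>far_part \<mu> r)"
    using iU iV by (simp add: far_operator_def u_def v_def)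
  also have "\<dots> \<le> (\<integral>z. \<bar>U (fst p + z) (snd p) - V (fst q + z) (snd q)\<bar> - \<bar>u - v\<bar> \<partial>far_part \<mu> r)"
  proof (rule integral_mono)
    show "integrable (far_part \<mu> r) (\<lambda>z. sgn (u - v) * ((U (fst p + z) (snd p) - u) - (V (fst q + z) (snd q) - v)))"
      using iU iV by simp
    show "sgn (u - v) * ((U (fst p + z) (snd p) - u) - (V (fst q + z) (snd q) - v))
      \<le> \<bar>U (fst p + z) (snd p) - V (fst q + z) (snd q)\<bar> - \<bar>u - v\<bar>" for z
      by (auto simp: sgn_if abs_if)
  qed (rule iUV)
  finally show ?thesis by (simp add: u_def v_def)
qed

text \<open>For each \<open>z\<close> the two terms of the inner integral have the same integral over the doubled
cylinder, by \<open>double_cylinder_shift\<close>: the shift by \<open>(z, z)\<close> leaves the weight \<open>\<omega>(x - y)\<close> alone.\<close>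

lemma (in levy) doubled_far_integral_eq_0:
  assumes \<omega>: "mollifier \<omega>" and r: "0 < r" and U: "bounded_periodic M U" and V: "bounded_periodic M V"
    and \<psi>_meas: "jointly_borel \<psi>"
    and \<psi>: "\<And>t s :: real. 0 \<le> \<psi> t s" "\<And>t s. \<psi> t s \<le> B"
  defines "g \<equiv> \<lambda>w :: ((real^'d) \<times> real) \<times> (real^'d) \<times> real.
    \<psi> (snd (fst w)) (snd (snd w)) * \<omega> (fst (fst w) - fst (snd w)) *
    (\<integral>z. \<bar>U (fst (fst w) + z) (snd (fst w)) - V (fst (snd w) + z) (snd (snd w))\<bar>
       - gap U V (fst w) (snd w) \<partial>far_part \<mu> r)"
  shows "integrable (doubled_measure T) g"
    and "integral\<^sup>L (doubled_measure T) g = 0"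
proof -
  interpret mollifier \<omega> by fact
  interpret far: finite_measure "far_part \<mu> r" by (rule finite_measure_far_part[OF r])
  let ?D = "doubled_measure T :: (((real^'d) \<times> real) \<times> (real^'d) \<times> real) measure"
  have fin_D: "finite_measure ?D" by (intro finite_measure_pair_measure finite_measure_cylinder)
  note [measurable (raw)] = bounded_periodic_compose[OF U] bounded_periodic_compose[OF V]
    measurable_compose_curried[OF \<psi>_meas]
  obtain W where W: "0 \<le> W" "\<And>x. \<bar>\<omega> x\<bar> \<le> W" using bounded by blast
  have B: "0 \<le> B" using \<psi>[of 0 0] by linarith
  have M: "0 \<le> M" using bounded_periodicD(1)[OF U, of 0 0] by simp
  define h where "h w = \<psi> (snd (fst w)) (snd (snd w)) * \<omega> (fst (fst w) - fst (snd w)) *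
      gap U V (fst w) (snd w)" for w
  have h_meas [measurable]: "h \<in> borel_measurable ((borel \<Otimes>\<^sub>M borel) \<Otimes>\<^sub>M (borel \<Otimes>\<^sub>M borel))"
    unfolding h_def by measurable
  have h_nonneg: "0 \<le> h w" for w
    unfolding h_def using \<psi> nonneg by (intro mult_nonneg_nonneg) auto
  have h_bound: "h w \<le> B * W * (2 * M)" for w
  proof -
    have "gap U V (fst w) (snd w) \<le> 2 * M"
      using bounded_periodicD(1)[OF U, of "fst (fst w)" "snd (fst w)"]
        bounded_periodicD(1)[OF V, of "fst (snd w)" "snd (snd w)"] by linarith
    moreover have "\<omega> (fst (fst w) - fst (snd w)) \<le> W" using W(2) abs_le_D1 by blast
    ultimately show ?thesis
      unfolding h_def using \<psi> nonneg B W(1) by (intro mult_mono mult_nonneg_nonneg) auto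
  qed
  have periodic_diff: "\<omega> (x + axis i (2 * pi) - y) = \<omega> (x - y)" "\<omega> (x - (y + axis i (2 * pi))) = \<omega> (x - y)" for x y i
  proof -
    have *: "\<omega> (v + axis i (2 * pi)) = \<omega> v" for v using periodic by (simp add: periodic_def)
    show "\<omega> (x + axis i (2 * pi) - y) = \<omega> (x - y)" using *[of "x - y"] by (simp add: algebra_simps)
    show "\<omega> (x - (y + axis i (2 * pi))) = \<omega> (x - y)"
      using *[of "x - (y + axis i (2 * pi))"] by (simp add: algebra_simps)
  qed
  define k where "k w z = h ((fst (fst w) + z, snd (fst w)), (fst (snd w) + z, snd (snd w))) - h w" for w z
  have k_meas: "(\<lambda>a. k (fst a) (snd a)) \<in> borel_measurable (?D \<Otimes>\<^sub>M far_part \<mu> r)"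
    unfolding k_def by measurable
  have k_bound: "\<bar>k w z\<bar> \<le> B * W * (2 * M)" for w z
    using h_nonneg[of w] h_bound[of w]
      h_nonneg[of "((fst (fst w) + z, snd (fst w)), (fst (snd w) + z, snd (snd w)))"]
      h_bound[of "((fst (fst w) + z, snd (fst w)), (fst (snd w) + z, snd (snd w)))"]
    unfolding k_def by linarith
  have g_eq: "g w = (\<integral>z. k w z \<partial>far_part \<mu> r)" for w
  proof -
    have "k w z = (\<psi> (snd (fst w)) (snd (snd w)) * \<omega> (fst (fst w) - fst (snd w))) *
      (\<bar>U (fst (fst w) + z) (snd (fst w)) - V (fst (snd w) + z) (snd (snd w))\<bar>
       - gap U V (fst w) (snd w))" for z
      by (simp add: k_def h_def right_diff_distrib)
    then show ?thesis by (simp add: g_def)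
  qed
  note fub = fubini_bounded[OF fin_D far.finite_measure_axioms k_meas k_bound]
  have "integrable ?D (\<lambda>w. \<integral>z. k w z \<partial>far_part \<mu> r)"
  proof -
    interpret D: finite_measure ?D by (rule fin_D)
    interpret DF: pair_sigma_finite ?D "far_part \<mu> r" ..
    show ?thesis using DF.integrable_fst'[OF fub(1)] by simp
  qed
  then show "integrable ?D g" by (simp add: g_eq[abs_def])
  have "integral\<^sup>L ?D g = (\<integral>z. \<integral>w. k w z \<partial>?D \<partial>far_part \<mu> r)"
    using fub(2,3) by (simp add: g_eq[abs_def])
  moreover have "(\<integral>w. k w z \<partial>?D) = 0" for z
  proof -
    interpret D: finite_measure ?D by (rule fin_D)
    have "integrable ?D h" "integrable ?D (\<lambda>w. h ((fst (fst w) + z, snd (fst w)), (fst (snd w) + z, snd (snd w))))"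
      using h_nonneg h_bound by (auto intro!: D.integrable_const_bound[of _ "B * W * (2 * M)"])
    moreover have "(\<integral>w. h ((fst (fst w) + z, snd (fst w)), (fst (snd w) + z, snd (snd w))) \<partial>?D) = integral\<^sup>L ?D h"
    proof (rule double_cylinder_shift[OF h_meas h_nonneg h_bound])
      show "periodic (\<lambda>x. h ((x, t), q))" "periodic (\<lambda>y. h (p, (y, s)))" for t q p s
        using bounded_periodicD(2)[OF U] bounded_periodicD(2)[OF V]
        by (simp_all add: periodic_def h_def periodic_diff)
    qed
    ultimately show ?thesis by (simp add: k_def)
  qed
  ultimately show "integral\<^sup>L ?D g = 0" by simp
qed

text \<open>\<open>A\<close> bounds the singular part of the operator on the kernel; the second summand is the only trace
of it and vanishes in the limit \<open>r \<rightarrow> 0\<close>.\<close>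

lemma (in levy) doubling_inequality:
  fixes U V :: "real^'d \<Rightarrow> real \<Rightarrow> real"
  assumes \<omega>: "mollifier \<omega>" and r: "0 < r" and U: "bounded_periodic M U" and V: "bounded_periodic M V"
    and f_meas: "f \<in> borel_measurable borel" and f: "\<And>a. \<bar>a\<bar> \<le> M \<Longrightarrow> norm (f a) \<le> F"
    and A: "\<And>x. \<bar>levy_adj \<mu> r \<omega> x\<bar> \<le> A"
    and \<psi>_meas: "jointly_borel \<psi>"
      "jointly_borel \<psi>'"
    and \<psi>: "\<And>t s. 0 \<le> \<psi> t s" "\<And>t s. \<psi> t s \<le> B" "\<And>t s. \<psi> t s = \<psi> s t" "\<And>t s. \<bar>\<psi>' t s\<bar> \<le> B"
    and ent_U: "\<And>k y s. 0 \<le> (\<integral>p. kernel_integrand f \<mu> r \<gamma> \<omega> U k y (\<psi> (snd p) s) (\<psi>' (snd p) s) p \<partial>cylinder_measure T)"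
    and ent_V: "\<And>k y s. 0 \<le> (\<integral>p. kernel_integrand f \<mu> r \<gamma> \<omega> V k y (\<psi> (snd p) s) (\<psi>' (snd p) s) p \<partial>cylinder_measure T)"
  shows "0 \<le> (\<integral>w. gap U V (fst w) (snd w)
        * \<omega> (fst (fst w) - fst (snd w)) * (\<psi>' (snd (fst w)) (snd (snd w)) + \<psi>' (snd (snd w)) (snd (fst w)))
        \<partial>doubled_measure T)
      + 4 * M * B * A * measure (doubled_measure T :: (((real^'d) \<times> real) \<times> (real^'d) \<times> real) measure) UNIV"
proof -
  interpret mollifier \<omega> by fact
  let ?c = "cylinder_measure T :: ((real^'d) \<times> real) measure"
  let ?D = "?c \<Otimes>\<^sub>M ?c"
  have fin_D: "finite_measure ?D" by (intro finite_measure_pair_measure finite_measure_cylinder)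
  interpret D: finite_measure ?D by (rule fin_D)
  note [measurable (raw)] = bounded_periodic_compose[OF U] bounded_periodic_compose[OF V]
    measurable_compose_curried[OF \<psi>_meas(1)] measurable_compose_curried[OF \<psi>_meas(2)]
  have U_meas: "jointly_borel U"
    and V_meas: "jointly_borel V"
    using U V by (simp_all add: bounded_periodic_def)
  obtain W where W: "0 \<le> W" "\<And>x. \<bar>\<omega> x\<bar> \<le> W" using bounded by blast
  have B: "0 \<le> B" using \<psi>(1,2)[of 0 0] by linarith
  have \<psi>_abs: "\<bar>\<psi> t s\<bar> \<le> B" for t s using \<psi>(1,2)[of t s] by simp
  have M: "0 \<le> M" using bounded_periodicD(1)[OF U, of 0 0] by simp
  have A0: "0 \<le> A" using A order_trans abs_ge_zero by blast
  define KU where "KU w = kernel_integrand f \<mu> r \<gamma> \<omega> U (V (fst (snd w)) (snd (snd w))) (fst (snd w))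
      (\<psi> (snd (fst w)) (snd (snd w))) (\<psi>' (snd (fst w)) (snd (snd w))) (fst w)" for w
  define KV where "KV w = kernel_integrand f \<mu> r \<gamma> \<omega> V (U (fst (fst w)) (snd (fst w))) (fst (fst w))
      (\<psi> (snd (snd w)) (snd (fst w))) (\<psi>' (snd (snd w)) (snd (fst w))) (snd w)" for w
  have KU_meas: "KU \<in> borel_measurable ?D"
    unfolding KU_def by (rule kernel_integrand_measurable[OF \<omega> r U_meas f_meas]) measurable
  have KV_meas: "KV \<in> borel_measurable ?D"
    unfolding KV_def by (rule kernel_integrand_measurable[OF \<omega> r V_meas f_meas]) measurable
  obtain CU where bound_U: "\<And>k y a a' p. \<bar>k\<bar> \<le> M \<Longrightarrow> \<bar>a\<bar> \<le> B \<Longrightarrow> \<bar>a'\<bar> \<le> B \<Longrightarrow>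
      \<bar>kernel_integrand f \<mu> r \<gamma> \<omega> U k y a a' p\<bar> \<le> CU"
    using kernel_integrand_bound[where f = f and B = B and \<gamma> = \<gamma>, OF \<omega> r U f A] by blast
  have CU: "\<bar>KU w\<bar> \<le> CU" for w
    unfolding KU_def by (intro bound_U bounded_periodicD(1)[OF V] \<psi>_abs \<psi>(4))
  obtain CV where bound_V: "\<And>k y a a' p. \<bar>k\<bar> \<le> M \<Longrightarrow> \<bar>a\<bar> \<le> B \<Longrightarrow> \<bar>a'\<bar> \<le> B \<Longrightarrow>
      \<bar>kernel_integrand f \<mu> r \<gamma> \<omega> V k y a a' p\<bar> \<le> CV"
    using kernel_integrand_bound[where f = f and B = B and \<gamma> = \<gamma>, OF \<omega> r V f A] by blast
  have CV: "\<bar>KV w\<bar> \<le> CV" for w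
    unfolding KV_def by (intro bound_V bounded_periodicD(1)[OF U] \<psi>_abs \<psi>(4))
  note fubU = fubini_bounded[OF finite_measure_cylinder finite_measure_cylinder KU_meas CU]
    and fubV = fubini_bounded[OF finite_measure_cylinder finite_measure_cylinder KV_meas CV]
  have "0 \<le> (\<integral>q. \<integral>p. KU (p, q) \<partial>?c \<partial>?c)"
    unfolding KU_def fst_conv snd_conv by (rule Bochner_Integration.integral_nonneg) (rule ent_U)
  then have "0 \<le> integral\<^sup>L ?D KU" using fubU(3) by simp
  moreover have "0 \<le> (\<integral>p. \<integral>q. KV (p, q) \<partial>?c \<partial>?c)"
    unfolding KV_def fst_conv snd_conv by (rule Bochner_Integration.integral_nonneg) (rule ent_V)
  then have "0 \<le> integral\<^sup>L ?D KV" using fubV(2) by simp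
  ultimately have "0 \<le> (\<integral>w. KU w + KV w \<partial>?D)"
    using fubU(1) fubV(1) by simp
  also have "\<dots> \<le> (\<integral>w. gap U V (fst w) (snd w)
        * \<omega> (fst (fst w) - fst (snd w)) * (\<psi>' (snd (fst w)) (snd (snd w)) + \<psi>' (snd (snd w)) (snd (fst w)))
      + 4 * M * B * A + \<psi> (snd (fst w)) (snd (snd w)) * \<omega> (fst (fst w) - fst (snd w)) *
    (\<integral>z. \<bar>U (fst (fst w) + z) (snd (fst w)) - V (fst (snd w) + z) (snd (snd w))\<bar>
       - gap U V (fst w) (snd w) \<partial>far_part \<mu> r) \<partial>?D)"
    (is "_ \<le> (\<integral>w. ?main w + _ + ?far w \<partial>?D)")
  proof (rule integral_mono)
    have diff: "\<bar>U x t - V y s\<bar> \<le> 2 * M" for x t y s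
      using bounded_periodicD(1)[OF U, of x t] bounded_periodicD(1)[OF V, of y s] by linarith
    have "\<bar>?main w\<bar> \<le> 2 * M * W * (2 * B)" for w
      unfolding abs_mult abs_abs using diff W M B
        \<psi>(4)[of "snd (fst w)" "snd (snd w)"] \<psi>(4)[of "snd (snd w)" "snd (fst w)"]
      by (intro mult_mono) auto
    then show "integrable ?D (\<lambda>w. ?main w + 4 * M * B * A + ?far w)"
      by (intro Bochner_Integration.integrable_add D.integrable_const
          doubled_far_integral_eq_0(1)[OF \<omega> r U V \<psi>_meas(1) \<psi>(1,2)]
          D.integrable_const_bound[of _ "2 * M * W * (2 * B)"]) auto
    show "integrable ?D (\<lambda>w. KU w + KV w)" using fubU(1) fubV(1) by simp
    fix w :: "((real^'d) \<times> real) \<times> (real^'d) \<times> real"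
    define p q where "p = fst w" and "q = snd w"
    have "gap U V p q * \<psi> (snd p) (snd q) *
        (levy_adj \<mu> r \<omega> (fst p - fst q) + levy_adj \<mu> r \<omega> (fst q - fst p)) \<le> (2 * M) * B * (2 * A)"
    proof -
      have "levy_adj \<mu> r \<omega> (fst p - fst q) + levy_adj \<mu> r \<omega> (fst q - fst p) \<le> 2 * A"
        using A[of "fst p - fst q"] A[of "fst q - fst p"] by linarith
      then have "gap U V p q * \<psi> (snd p) (snd q) *
        (levy_adj \<mu> r \<omega> (fst p - fst q) + levy_adj \<mu> r \<omega> (fst q - fst p))
        \<le> gap U V p q * \<psi> (snd p) (snd q) * (2 * A)"
        using \<psi>(1) by (intro mult_left_mono) auto
      also have "\<dots> \<le> (2 * M) * B * (2 * A)"
        using diff \<psi>(1,2) A0 M by (intro mult_right_mono mult_mono) auto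
      finally show ?thesis .
    qed
    moreover have "\<psi> (snd p) (snd q) * \<omega> (fst p - fst q) *
        (sgn (U (fst p) (snd p) - V (fst q) (snd q)) * (far_operator \<mu> r U p - far_operator \<mu> r V q)) \<le> ?far w"
      unfolding p_def[symmetric] q_def[symmetric]
      using \<psi>(1) nonneg by (intro mult_left_mono far_operator_kato[OF r U V]) auto
    ultimately show "KU w + KV w \<le> ?main w + 4 * M * B * A + ?far w"
      unfolding KU_def KV_def p_def[symmetric] q_def[symmetric] doubled_pointwise[OF \<omega> \<psi>(3)]
      by linarith
  qed
  also have "\<dots> = integral\<^sup>L ?D ?main + 4 * M * B * A * measure ?D UNIV"
  proof -
    have diff: "\<bar>U x t - V y s\<bar> \<le> 2 * M" for x t y s
      using bounded_periodicD(1)[OF U, of x t] bounded_periodicD(1)[OF V, of y s] by linarith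
    have "\<bar>?main w\<bar> \<le> 2 * M * W * (2 * B)" for w
      unfolding abs_mult abs_abs using diff W M B
        \<psi>(4)[of "snd (fst w)" "snd (snd w)"] \<psi>(4)[of "snd (snd w)" "snd (fst w)"]
      by (intro mult_mono) auto
    then have "integrable ?D ?main"
      by (intro D.integrable_const_bound[of _ "2 * M * W * (2 * B)"]) auto
    then show ?thesis
      using doubled_far_integral_eq_0[OF \<omega> r U V \<psi>_meas(1) \<psi>(1,2), of T]
      by (simp add: space_pair_measure mult_ac)
  qed
  finally show ?thesis .
qed

section \<open>Time test functions\<close>

lemma smooth_on_ident: "smooth_on S (\<lambda>t::real. t)"
  using smooth_on_inner[of S "1 :: real"] by simp

lemma smooth_on_antiderivative:
  assumes "open S" "\<And>x. x \<in> S \<Longrightarrow> (G has_real_derivative g x) (at x)" "smooth_on S g"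
  shows "smooth_on S G"
proof -
  have der: "(G has_derivative (\<lambda>b. g x * b)) (at x)" if "x \<in> S" for x
    using assms(2)[OF that] by (simp add: has_field_derivative_def)
  have fd: "frechet_derivative G (at x) b = g x" if "x \<in> S" "b \<in> Basis" for x b
    using that by (simp add: frechet_derivative_at[OF der[OF that(1)], symmetric])
  have "smooth_on S (\<lambda>x. frechet_derivative G (at x) b)" if "b \<in> Basis" for b
    using smooth_on_cong[OF assms(1), of "\<lambda>x. frechet_derivative G (at x) b" g] fd that assms(3) by blast
  then show ?thesis
    using der by (subst smooth_on_Suc_iff) (auto simp: differentiable_def)
qed

text \<open>Back from Frechet derivatives to derivatives of functions of one real variable.\<close>

lemma smooth_on_DERIV:
  assumes "smooth_on UNIV g"
  obtains g' where "\<And>x :: real. (g has_real_derivative g' x) (at x)" "continuous_on UNIV g'"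
proof
  show "(g has_real_derivative frechet_derivative g (at x) 1) (at x)" for x
  proof -
    have d: "(g has_derivative frechet_derivative g (at x)) (at x)"
      using smooth_on_differentiable[OF assms] by (simp add: frechet_derivative_works[symmetric])
    have "frechet_derivative g (at x) b = frechet_derivative g (at x) 1 * b" for b
      using linear_cmul[OF has_derivative_linear[OF d], of b 1] by (simp add: mult.commute)
    then have "frechet_derivative g (at x) = (*) (frechet_derivative g (at x) 1)" by (rule ext)
    with d show ?thesis by (simp add: has_field_derivative_def)
  qed
  show "continuous_on UNIV (\<lambda>x. frechet_derivative g (at x) 1)"
    by (rule smooth_on_continuous_on[OF smooth_on_partial[OF assms]]) simp
qed

definition bump :: "real \<Rightarrow> real \<Rightarrow> real" where
  "bump \<delta> t = cutoff (\<delta>\<^sup>2 - t * t)"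

lemma bump_nonneg: "0 \<le> bump \<delta> t" and bump_even: "bump \<delta> (- t) = bump \<delta> t"
  by (simp_all add: bump_def cutoff_nonneg)

lemma bump_eq_0_iff:
  assumes "0 < \<delta>" shows "bump \<delta> t = 0 \<longleftrightarrow> \<delta> \<le> \<bar>t\<bar>"
proof -
  have "\<delta>\<^sup>2 - t * t \<le> 0 \<longleftrightarrow> \<delta>\<^sup>2 \<le> \<bar>t\<bar>\<^sup>2" by (simp add: power2_eq_square)
  also have "\<dots> \<longleftrightarrow> \<delta> \<le> \<bar>t\<bar>" using assms by (simp only: power_mono_iff abs_ge_zero less_imp_le zero_less_numeral)
  finally show ?thesis by (simp add: bump_def cutoff_eq_0_iff)
qed

lemma smooth_on_bump:
  assumes "open S" "smooth_on S h" shows "smooth_on S (\<lambda>x. bump \<delta> (h x))"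
proof -
  have "smooth_on S (\<lambda>x. cutoff (\<delta>\<^sup>2 + (- 1) * (h x * h x)))"
    using assms by (intro smooth_on_cutoff smooth_on_add smooth_on_mult smooth_on_const)
  then show ?thesis by (simp add: bump_def)
qed

lemma bump_continuous: "continuous_on UNIV (bump \<delta>)"
  using smooth_on_continuous_on[OF smooth_on_bump[OF open_UNIV smooth_on_ident]] by simp

lemma bump_measurable [measurable]: "bump \<delta> \<in> borel_measurable borel"
  by (rule borel_measurable_continuous_onI[OF bump_continuous])

lemma bounded_if_compact_support:
  fixes g :: "real \<Rightarrow> real"
  assumes "continuous_on UNIV g" "\<And>t. \<delta> < \<bar>t\<bar> \<Longrightarrow> g t = 0"
  shows "\<exists>C\<ge>0. \<forall>t. \<bar>g t\<bar> \<le> C"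
proof -
  have "compact (g ` {-\<delta>..\<delta>})"
    using assms(1) by (intro compact_continuous_image) (auto intro: continuous_on_subset)
  then obtain C where C: "\<And>y. y \<in> g ` {-\<delta>..\<delta>} \<Longrightarrow> norm y \<le> C"
    by (meson bounded_iff compact_imp_bounded)
  have "\<bar>g t\<bar> \<le> max C 0" for t
  proof (cases "\<delta> < \<bar>t\<bar>")
    case False
    then have "g t \<in> g ` {-\<delta>..\<delta>}" by (intro imageI) auto
    from C[OF this] show ?thesis by simp
  qed (simp add: assms(2))
  then show ?thesis by (intro exI[of _ "max C 0"]) simp
qed

lemma bump_bounded: "0 < \<delta> \<Longrightarrow> \<exists>C\<ge>0. \<forall>t. \<bar>bump \<delta> t\<bar> \<le> C"
  by (rule bounded_if_compact_support[where \<delta> = \<delta>, OF bump_continuous]) (simp add: bump_eq_0_iff)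

lemma bump_derivative:
  assumes "0 < \<delta>"
  obtains b' where "\<And>t. (bump \<delta> has_real_derivative b' t) (at t)" "continuous_on UNIV b'"
    "\<And>t. b' (- t) = - b' t" "\<exists>C\<ge>0. \<forall>t. \<bar>b' t\<bar> \<le> C"
proof -
  have "smooth_on UNIV (bump \<delta>)" using smooth_on_bump[OF open_UNIV smooth_on_ident] by simp
  then obtain b' where b': "\<And>t. (bump \<delta> has_real_derivative b' t) (at t)" "continuous_on UNIV b'"
    by (rule smooth_on_DERIV) blast
  have odd: "b' (- t) = - b' t" for t
  proof -
    have "((\<lambda>t. bump \<delta> (- t)) has_real_derivative b' (- t) * - 1) (at t)"
      by (rule DERIV_chain2[OF b'(1)]) (auto intro!: derivative_eq_intros)
    then have "(bump \<delta> has_real_derivative - b' (- t)) (at t)" by (simp add: bump_even)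
    from DERIV_unique[OF this b'(1)] show ?thesis by simp
  qed
  have "b' t = 0" if "\<delta> < \<bar>t\<bar>" for t
  proof -
    have "((\<lambda>t. 0) has_real_derivative b' t) (at t)"
    proof (rule has_field_derivative_transform_within[OF b'(1)[of t]])
      show "0 < \<bar>t\<bar> - \<delta>" using that by simp
      show "bump \<delta> x = 0" if "dist x t < \<bar>t\<bar> - \<delta>" for x
        using that by (simp add: bump_eq_0_iff[OF assms] dist_real_def)
    qed simp
    from DERIV_unique[OF this DERIV_const] show ?thesis .
  qed
  then have "\<exists>C\<ge>0. \<forall>t. \<bar>b' t\<bar> \<le> C" by (rule bounded_if_compact_support[OF b'(2)])
  with b' odd show ?thesis by (rule that)
qed

text \<open>A smooth step: constant on either side of the support of the bump.\<close>

lemma bump_antiderivative: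
  assumes "0 < \<delta>"
  obtains F where "\<And>t. (F has_real_derivative bump \<delta> t) (at t)" "mono F"
    "\<And>t. \<delta> \<le> t \<Longrightarrow> F t = F \<delta>" "\<And>t. t \<le> - \<delta> \<Longrightarrow> F t = F (- \<delta>)"
proof -
  have "\<exists>F. \<forall>t. (F has_real_derivative bump \<delta> t) (at t)"
    using einterval_antiderivative[of "-\<infinity>" "\<infinity>" "bump \<delta>"] bump_continuous[of \<delta>]
    by (auto simp: continuous_on_eq_continuous_at has_real_derivative_iff_has_vector_derivative)
  then obtain F where F: "\<And>t. (F has_real_derivative bump \<delta> t) (at t)" by blast
  have mono: "mono F"
  proof (rule monoI)
    fix x y :: real assume "x \<le> y"
    then show "F x \<le> F y"
    proof (rule DERIV_nonneg_imp_nondecreasing)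
      show "\<exists>d. (F has_real_derivative d) (at t) \<and> 0 \<le> d" for t
        using F[of t] bump_nonneg[of \<delta> t] by blast
    qed
  qed
  have const: "F a = F b" if "a \<le> b" "\<And>t. a < t \<Longrightarrow> t < b \<Longrightarrow> bump \<delta> t = 0" for a b
  proof (cases "a = b")
    case False
    then have "a < b" using that by simp
    moreover have "continuous_on {a..b} F"
      using F by (intro continuous_at_imp_continuous_on ballI DERIV_isCont)
    moreover have "(F has_real_derivative 0) (at t)" if "a < t" "t < b" for t
      using F[of t] that \<open>\<And>t. a < t \<Longrightarrow> t < b \<Longrightarrow> bump \<delta> t = 0\<close>[of t] by simp
    ultimately have "F b = F a" by (rule DERIV_isconst_end)
    then show ?thesis by simp
  qed simp
  have "F t = F \<delta>" if "\<delta> \<le> t" for t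
    using const[OF that] assms by (simp add: bump_eq_0_iff)
  moreover have "F t = F (- \<delta>)" if "t \<le> - \<delta>" for t
    using const[OF that] assms by (simp add: bump_eq_0_iff)
  ultimately show ?thesis using F mono that by blast
qed

text \<open>Take \<open>\<psi>(t, s) = bump(t - s) \<zeta>(t + s)\<close>, where \<open>\<zeta>\<close> climbs by a step at \<open>2 * c\<^sub>1\<close> and descends by the same
step at \<open>2 * c\<^sub>2\<close>. Differentiation along the diagonal does not see the first factor, so that only the
two steps remain, as bumps of opposite sign; they are localised in both variables together with
the first factor. Equal steps make \<open>\<zeta>\<close> vanish outside of \<open>[2 * c\<^sub>1 - \<delta>, 2 * c\<^sub>2 + \<delta>]\<close>.\<close>

lemma diagonal_time_test:
  assumes \<delta>: "0 < \<delta>" "0 < c\<^sub>1 - \<delta>" "c\<^sub>1 \<le> c\<^sub>2" "c\<^sub>2 + \<delta> < T"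
  obtains \<psi> B \<psi>' where "\<And>t s. \<psi> t s = \<psi> s t" "\<And>t s. 0 \<le> \<psi> t s" "\<And>t s. \<psi> t s \<le> B" "\<And>t s. \<bar>\<psi>' t s\<bar> \<le> B"
    "jointly_borel \<psi>"
    "jointly_borel \<psi>'"
    "\<And>s. time_test T (\<lambda>t. \<psi> t s)" "\<And>t s. ((\<lambda>t. \<psi> t s) has_real_derivative \<psi>' t s) (at t)"
    "\<And>t s. \<psi>' t s + \<psi>' s t = 2 * (bump \<delta> (t - s) * bump \<delta> (t + s - 2 * c\<^sub>1) - bump \<delta> (t - s) * bump \<delta> (t + s - 2 * c\<^sub>2))"
proof -
  obtain F where F: "\<And>t. (F has_real_derivative bump \<delta> t) (at t)" "mono F"
    "\<And>t. \<delta> \<le> t \<Longrightarrow> F t = F \<delta>" "\<And>t. t \<le> - \<delta> \<Longrightarrow> F t = F (- \<delta>)"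
    using bump_antiderivative[OF \<delta>(1)] by blast
  obtain b' where b': "\<And>t. (bump \<delta> has_real_derivative b' t) (at t)" "continuous_on UNIV b'"
    "\<And>t. b' (- t) = - b' t" and "\<exists>C\<ge>0. \<forall>t. \<bar>b' t\<bar> \<le> C"
    using bump_derivative[OF \<delta>(1)] by blast
  then obtain C' where C': "0 \<le> C'" "\<And>t. \<bar>b' t\<bar> \<le> C'" by blast
  obtain C where C: "0 \<le> C" "\<And>t. \<bar>bump \<delta> t\<bar> \<le> C" using bump_bounded[OF \<delta>(1)] by blast
  have [measurable]: "b' \<in> borel_measurable borel" "F \<in> borel_measurable borel"
    using b'(2) F(1) by (auto intro!: borel_measurable_continuous_onI continuous_at_imp_continuous_on DERIV_isCont)
  define \<zeta> where "\<zeta> \<tau> = F (\<tau> - 2 * c\<^sub>1) - F (\<tau> - 2 * c\<^sub>2)" for \<tau>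
  define \<zeta>' where "\<zeta>' \<tau> = bump \<delta> (\<tau> - 2 * c\<^sub>1) - bump \<delta> (\<tau> - 2 * c\<^sub>2)" for \<tau>
  have [measurable]: "\<zeta> \<in> borel_measurable borel" "\<zeta>' \<in> borel_measurable borel"
    unfolding \<zeta>_def \<zeta>'_def by measurable
  have der_\<zeta>: "((\<lambda>t. \<zeta> (t + s)) has_real_derivative \<zeta>' (t + s)) (at t)" for t s
    unfolding \<zeta>_def \<zeta>'_def
    by (auto intro!: derivative_eq_intros DERIV_chain2[OF F(1)])
  have \<zeta>_nonneg: "0 \<le> \<zeta> \<tau>" for \<tau>
    using monoD[OF F(2), of "\<tau> - 2 * c\<^sub>2" "\<tau> - 2 * c\<^sub>1"] \<delta>(3) by (simp add: \<zeta>_def)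
  have F_range: "F (- \<delta>) \<le> F t" "F t \<le> F \<delta>" for t
  proof -
    show "F (- \<delta>) \<le> F t"
    proof (cases "t \<le> - \<delta>")
      case True then show ?thesis using F(4)[OF True] by linarith
    qed (simp add: monoD[OF F(2)])
    show "F t \<le> F \<delta>"
    proof (cases "\<delta> \<le> t")
      case True then show ?thesis using F(3)[OF True] by linarith
    qed (simp add: monoD[OF F(2)])
  qed
  have \<zeta>_le: "\<bar>\<zeta> \<tau>\<bar> \<le> F \<delta> - F (- \<delta>)" for \<tau>
    using \<zeta>_nonneg[of \<tau>] F_range[of "\<tau> - 2 * c\<^sub>1"] F_range[of "\<tau> - 2 * c\<^sub>2"] by (simp add: \<zeta>_def)
  have \<zeta>_support: "\<zeta> \<tau> = 0" if "\<tau> \<le> 2 * c\<^sub>1 - \<delta> \<or> 2 * c\<^sub>2 + \<delta> \<le> \<tau>" for \<tau>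
    using that
  proof
    assume "\<tau> \<le> 2 * c\<^sub>1 - \<delta>"
    then have "F (\<tau> - 2 * c\<^sub>1) = F (- \<delta>)" "F (\<tau> - 2 * c\<^sub>2) = F (- \<delta>)"
      using \<delta>(3) by (intro F(4); simp)+
    then show ?thesis by (simp only: \<zeta>_def diff_self)
  next
    assume "2 * c\<^sub>2 + \<delta> \<le> \<tau>"
    then have "F (\<tau> - 2 * c\<^sub>1) = F \<delta>" "F (\<tau> - 2 * c\<^sub>2) = F \<delta>"
      using \<delta>(3) by (intro F(3); simp)+
    then show ?thesis by (simp only: \<zeta>_def diff_self)
  qed
  have \<zeta>'_le: "\<bar>\<zeta>' \<tau>\<bar> \<le> 2 * C" for \<tau>
    using C(2)[of "\<tau> - 2 * c\<^sub>1"] C(2)[of "\<tau> - 2 * c\<^sub>2"] by (simp add: \<zeta>'_def)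
  define \<psi> where "\<psi> t s = bump \<delta> (t - s) * \<zeta> (t + s)" for t s
  define \<psi>' where "\<psi>' t s = b' (t - s) * \<zeta> (t + s) + bump \<delta> (t - s) * \<zeta>' (t + s)" for t s
  define K where "K = F \<delta> - F (- \<delta>)"
  have K: "0 \<le> K" using F_range[of 0] by (simp add: K_def)
  define B where "B = C * K + (C' * K + C * (2 * C))"
  show ?thesis
  proof
    show "\<psi> t s = \<psi> s t" for t s
      using bump_even[of \<delta> "t - s"] by (simp add: \<psi>_def add.commute)
    show "0 \<le> \<psi> t s" for t s by (simp add: \<psi>_def bump_nonneg \<zeta>_nonneg)
    have "\<bar>bump \<delta> (t - s)\<bar> * \<bar>\<zeta> (t + s)\<bar> \<le> C * K" for t s
      using C \<zeta>_le K unfolding K_def by (intro mult_mono) auto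
    then have \<psi>_le: "\<psi> t s \<le> C * K" for t s
      unfolding \<psi>_def abs_mult[symmetric] by (rule order_trans[OF abs_ge_self])
    have "0 \<le> C' * K + C * (2 * C)" "0 \<le> C * K" using C C' K by auto
    then show "\<psi> t s \<le> B" for t s unfolding B_def using \<psi>_le[of t s] by linarith
    show "\<bar>\<psi>' t s\<bar> \<le> B" for t s
    proof -
      have "\<bar>b' (t - s) * \<zeta> (t + s)\<bar> \<le> C' * K"
        unfolding abs_mult using C' \<zeta>_le K unfolding K_def by (intro mult_mono) auto
      moreover have "\<bar>bump \<delta> (t - s) * \<zeta>' (t + s)\<bar> \<le> C * (2 * C)"
        unfolding abs_mult using C \<zeta>'_le by (intro mult_mono) auto
      ultimately show ?thesis using \<open>0 \<le> C * K\<close> unfolding \<psi>'_def B_def by linarith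
    qed
    show "jointly_borel \<psi>"
      "jointly_borel \<psi>'"
      unfolding \<psi>_def \<psi>'_def by measurable
    show der: "((\<lambda>t. \<psi> t s) has_real_derivative \<psi>' t s) (at t)" for t s
    proof -
      have "((\<lambda>t. bump \<delta> (t - s)) has_real_derivative b' (t - s)) (at t)"
      proof -
        have "((\<lambda>t. t - s) has_real_derivative 1) (at t)" by (auto intro!: derivative_eq_intros)
        from DERIV_chain2[OF b'(1) this] show ?thesis by simp
      qed
      from DERIV_mult[OF this der_\<zeta>[of s t]] show ?thesis
        by (simp add: \<psi>_def \<psi>'_def add.commute mult.commute)
    qed
    show "time_test T (\<lambda>t. \<psi> t s)" for s
      unfolding time_test_def
    proof (intro conjI allI)
      show "smooth_on {0<..<T} (\<lambda>t. \<psi> t s)"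
        unfolding \<psi>_def
      proof (intro smooth_on_mult open_greaterThanLessThan)
        have shift: "smooth_on {0<..<T} (\<lambda>t. bump \<delta> (t + a))" for a
          by (intro smooth_on_bump smooth_on_add smooth_on_ident smooth_on_const open_greaterThanLessThan)
        show "smooth_on {0<..<T} (\<lambda>t. bump \<delta> (t - s))" using shift[of "- s"] by simp
        have "smooth_on {0<..<T} (\<lambda>t. bump \<delta> (t + (s - 2 * c\<^sub>1)) + (- 1) * bump \<delta> (t + (s - 2 * c\<^sub>2)))"
          by (intro smooth_on_add smooth_on_mult smooth_on_const shift open_greaterThanLessThan)
        then have "smooth_on {0<..<T} (\<lambda>t. \<zeta>' (t + s))"
          by (simp add: \<zeta>'_def algebra_simps)
        then show "smooth_on {0<..<T} (\<lambda>t. \<zeta> (t + s))"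
          by (rule smooth_on_antiderivative[OF open_greaterThanLessThan der_\<zeta>])
      qed
      show "0 \<le> \<psi> t s" for t by (simp add: \<psi>_def bump_nonneg \<zeta>_nonneg)
      show "\<exists>a b. 0 < a \<and> b < T \<and> (\<forall>t. t \<notin> {a..b} \<longrightarrow> \<psi> t s = 0)"
      proof (intro exI conjI allI impI)
        \<comment> \<open>\<open>|t - s| < \<delta>\<close> and \<open>2 * c\<^sub>1 - \<delta> < t + s < 2 * c\<^sub>2 + \<delta>\<close> confine \<open>t\<close> to this interval\<close>
      show "0 < c\<^sub>1 - \<delta>" "c\<^sub>2 + \<delta> < T" by fact+
        fix t assume t: "t \<notin> {c\<^sub>1 - \<delta>..c\<^sub>2 + \<delta>}"
        show "\<psi> t s = 0"
        proof (rule ccontr)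
          assume "\<psi> t s \<noteq> 0"
          then have "bump \<delta> (t - s) \<noteq> 0" "\<zeta> (t + s) \<noteq> 0" by (auto simp: \<psi>_def)
          then have "\<bar>t - s\<bar> < \<delta>" "\<not> (t + s \<le> 2 * c\<^sub>1 - \<delta> \<or> 2 * c\<^sub>2 + \<delta> \<le> t + s)"
            using \<zeta>_support[of "t + s"] by (auto simp: bump_eq_0_iff[OF \<delta>(1)])
          then show False using t by auto
        qed
      qed
    qed
    show "\<psi>' t s + \<psi>' s t = 2 * (bump \<delta> (t - s) * bump \<delta> (t + s - 2 * c\<^sub>1) - bump \<delta> (t - s) * bump \<delta> (t + s - 2 * c\<^sub>2))" for t s
    proof -
      have 1: "b' (s - t) = - b' (t - s)" "bump \<delta> (s - t) = bump \<delta> (t - s)" "s + t = t + s"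
        using b'(3)[of "t - s"] bump_even[of \<delta> "t - s"] by (simp_all add: add.commute)
      show ?thesis
        unfolding \<psi>'_def \<zeta>'_def 1 by (simp add: right_diff_distrib)
    qed
  qed
qed

section \<open>Localisation in time\<close>

lemma finite_measure_integral_bound:
  fixes g :: "'a \<Rightarrow> real"
  assumes "finite_measure N" "g \<in> borel_measurable N" "\<And>x. \<bar>g x\<bar> \<le> C"
  shows "\<bar>integral\<^sup>L N g\<bar> \<le> C * measure N (space N)"
proof -
  interpret finite_measure N by fact
  have "norm (integral\<^sup>L N g) \<le> (\<integral>x. C \<partial>N)"
  proof -
    have "integrable N g" by (rule integrable_const_bound[of _ C]) (use assms in auto)
    then show ?thesis
      using assms(3) by (intro integral_norm_bound[THEN order_trans] integral_mono integrable_norm) auto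
  qed
  then show ?thesis by (simp add: mult.commute)
qed

lemma integral_cylinder_product:
  fixes a :: "real^'d \<Rightarrow> real" and b :: "real \<Rightarrow> real"
  assumes [measurable]: "a \<in> borel_measurable borel" "b \<in> borel_measurable borel"
    and bound: "\<And>x. \<bar>a x\<bar> \<le> C" "\<And>t. \<bar>b t\<bar> \<le> C'"
  shows "(\<integral>p. a (fst p) * b (snd p) \<partial>cylinder_measure T) = (\<integral>x. a x \<partial>cell_measure) * (\<integral>t. b t \<partial>time_measure T)"
proof -
  have "\<bar>a (fst p) * b (snd p)\<bar> \<le> C * C'" for p
    unfolding abs_mult using bound order_trans[OF abs_ge_zero bound(1)] by (intro mult_mono) auto
  from fubini_bounded(2)[where g = "\<lambda>p. a (fst p) * b (snd p)",
      OF finite_measure_cell finite_measure_time[of T] _ this]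
  show ?thesis by (simp add: cylinder_measure_def)
qed

text \<open>Separation of the space variables from the time variables.\<close>

lemma integral_double_cylinder_product:
  fixes F :: "real^'d \<Rightarrow> real^'d \<Rightarrow> real" and G :: "real \<Rightarrow> real \<Rightarrow> real"
  assumes F: "jointly_borel F" "\<And>x y. \<bar>F x y\<bar> \<le> C"
    and G: "jointly_borel G" "\<And>t s. \<bar>G t s\<bar> \<le> C'"
  shows "(\<integral>w. F (fst (fst w)) (fst (snd w)) * G (snd (fst w)) (snd (snd w)) \<partial>doubled_measure T)
    = (\<integral>x. \<integral>y. F x y \<partial>cell_measure \<partial>cell_measure) * (\<integral>t. \<integral>s. G t s \<partial>time_measure T \<partial>time_measure T)"
proof -
  note [measurable (raw)] = measurable_compose_curried[OF F(1)] measurable_compose_curried[OF G(1)]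
  let ?c = "cylinder_measure T :: ((real^'d) \<times> real) measure"
  have C: "0 \<le> C" using F(2) abs_ge_zero order_trans by blast
  have bound: "\<bar>F (fst (fst w)) (fst (snd w)) * G (snd (fst w)) (snd (snd w))\<bar> \<le> C * C'" for w
    unfolding abs_mult using F(2) G(2) C by (intro mult_mono) auto
  have "(\<integral>w. F (fst (fst w)) (fst (snd w)) * G (snd (fst w)) (snd (snd w)) \<partial>(?c \<Otimes>\<^sub>M ?c))
    = (\<integral>p. \<integral>q. F (fst p) (fst q) * G (snd p) (snd q) \<partial>?c \<partial>?c)"
    using fubini_bounded(2)[where g = "\<lambda>w. F (fst (fst w)) (fst (snd w)) * G (snd (fst w)) (snd (snd w))",
        OF finite_measure_cylinder[of T] finite_measure_cylinder[of T] _ bound] by simp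
  also have "\<dots> = (\<integral>p. (\<integral>y. F (fst p) y \<partial>cell_measure) * (\<integral>s. G (snd p) s \<partial>time_measure T) \<partial>?c)"
    by (intro Bochner_Integration.integral_cong refl integral_cylinder_product[where C = C and C' = C'] F(2) G(2)) measurable
  also have "\<dots> = (\<integral>x. \<integral>y. F x y \<partial>cell_measure \<partial>cell_measure) * (\<integral>t. \<integral>s. G t s \<partial>time_measure T \<partial>time_measure T)"
  proof (rule integral_cylinder_product)
    have "(\<lambda>y. F x y) \<in> borel_measurable cell_measure" for x by measurable
    from finite_measure_integral_bound[OF finite_measure_cell this F(2)]
    show "\<bar>\<integral>y. F x y \<partial>cell_measure\<bar> \<le> C * measure cell_measure (space (cell_measure :: (real^'d) measure))" for x .
    have "(\<lambda>s. G t s) \<in> borel_measurable (time_measure T)" for t by measurable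
    from finite_measure_integral_bound[OF finite_measure_time this G(2)]
    show "\<bar>\<integral>s. G t s \<partial>time_measure T\<bar> \<le> C' * measure (time_measure T) (space (time_measure T))" for t .
  qed measurable
  finally show ?thesis .
qed

lemma cutoff_mono: "x \<le> y \<Longrightarrow> cutoff x \<le> cutoff y"
  by (auto simp: cutoff_def flat_exp_def divide_simps)

definition diagonal_bump :: "real \<Rightarrow> real \<Rightarrow> real \<Rightarrow> real \<Rightarrow> real" where
  "diagonal_bump \<delta> c t s = bump \<delta> (t - s) * bump \<delta> (t + s - 2 * c)"

lemma diagonal_bump_measurable [measurable (raw)]:
  assumes [measurable]: "a \<in> borel_measurable N" "b \<in> borel_measurable N"
  shows "(\<lambda>w. diagonal_bump \<delta> c (a w) (b w)) \<in> borel_measurable N"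
  unfolding diagonal_bump_def by measurable

lemma diagonal_bump_nonneg: "0 \<le> diagonal_bump \<delta> c t s"
  by (simp add: diagonal_bump_def bump_nonneg)

lemma diagonal_bump_bounded: "0 < \<delta> \<Longrightarrow> \<exists>B\<ge>0. \<forall>c t s. \<bar>diagonal_bump \<delta> c t s\<bar> \<le> B"
proof -
  assume "0 < \<delta>"
  then obtain C where C: "0 \<le> C" "\<And>t. \<bar>bump \<delta> t\<bar> \<le> C" using bump_bounded by blast
  have "\<bar>diagonal_bump \<delta> c t s\<bar> \<le> C * C" for c t s
    unfolding diagonal_bump_def abs_mult using C by (intro mult_mono) auto
  then show ?thesis using C(1) by (intro exI[of _ "C * C"]) auto
qed

lemma diagonal_bump_support:
  assumes "0 < \<delta>" "diagonal_bump \<delta> c t s \<noteq> 0"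
  shows "\<bar>t - c\<bar> < \<delta>" "\<bar>s - c\<bar> < \<delta>"
proof -
  have "\<bar>t - s\<bar> < \<delta>" "\<bar>t + s - 2 * c\<bar> < \<delta>"
    using assms(2) by (auto simp: diagonal_bump_def bump_eq_0_iff[OF assms(1)] not_le)
  then show "\<bar>t - c\<bar> < \<delta>" "\<bar>s - c\<bar> < \<delta>" by linarith+
qed

lemma integral_time_eq_lborel:
  fixes g :: "real \<Rightarrow> real"
  assumes [measurable]: "g \<in> borel_measurable borel" and "\<And>t. g t \<noteq> 0 \<Longrightarrow> t \<in> {0<..<T}"
  shows "(\<integral>t. g t \<partial>time_measure T) = (\<integral>t. g t \<partial>lborel)"
proof -
  have "(\<integral>t. g t \<partial>density lborel (\<lambda>t. ennreal (indicat_real {0<..<T} t)))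
      = (\<integral>t. indicat_real {0<..<T} t *\<^sub>R g t \<partial>lborel)"
    by (rule integral_density) auto
  moreover have "(\<lambda>t. indicat_real {0<..<T} t *\<^sub>R g t) = g"
  proof
    show "indicat_real {0<..<T} t *\<^sub>R g t = g t" for t
      using assms(2)[of t] by (cases "g t = 0") auto
  qed
  moreover have "(\<lambda>t. ennreal (indicat_real {0<..<T} t)) = indicator {0<..<T}"
    by (simp add: fun_eq_iff ennreal_indicator)
  ultimately show ?thesis by (simp add: time_measure_def)
qed

lemma lborel_integral_shift: "(\<integral>t. g (t + c) \<partial>lborel) = (\<integral>t. g t \<partial>lborel)" for g :: "real \<Rightarrow> real"
  using lborel_integral_real_affine[of 1 g c] by (simp add: add.commute)

text \<open>The mass does not depend on \<open>c\<close>, as long as the bump stays inside of \<open>(0, T)\<sup>2\<close>: it is a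
translate of the bump at the origin.\<close>

lemma diagonal_bump_mass:
  assumes \<delta>: "0 < \<delta>" "0 < c - \<delta>" "c + \<delta> < T"
  shows "(\<integral>t. \<integral>s. diagonal_bump \<delta> c t s \<partial>time_measure T \<partial>time_measure T)
    = (\<integral>t. \<integral>s. diagonal_bump \<delta> 0 t s \<partial>lborel \<partial>lborel)"
proof -
  have in_range: "t \<in> {0<..<T}" if "\<bar>t - c\<bar> < \<delta>" for t using that \<delta> by auto
  define k where "k t = (\<integral>s. diagonal_bump \<delta> 0 t s \<partial>lborel)" for t
  have [measurable]: "k \<in> borel_measurable borel" unfolding k_def by measurable
  have inner: "(\<integral>s. diagonal_bump \<delta> c t s \<partial>time_measure T) = k (t - c)" for t
  proof -
    have "(\<integral>s. diagonal_bump \<delta> c t s \<partial>time_measure T) = (\<integral>s. diagonal_bump \<delta> c t s \<partial>lborel)"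
      using diagonal_bump_support(2)[OF \<delta>(1)] in_range by (intro integral_time_eq_lborel) auto
    also have "\<dots> = (\<integral>s. diagonal_bump \<delta> c t (s + c) \<partial>lborel)" by (rule lborel_integral_shift[symmetric])
    also have "\<dots> = k (t - c)"
    proof -
      have "diagonal_bump \<delta> c t (s + c) = diagonal_bump \<delta> 0 (t - c) s" for s
      proof -
        have "t - (s + c) = t - c - s" "t + (s + c) - 2 * c = t - c + s - 2 * 0" by simp_all
        then show ?thesis by (simp only: diagonal_bump_def)
      qed
      then show ?thesis by (simp only: k_def)
    qed
    finally show ?thesis .
  qed
  have "k (t - c) = 0" if "\<not> \<bar>t - c\<bar> < \<delta>" for t
    using that diagonal_bump_support(1)[OF \<delta>(1), of 0 "t - c"] by (auto simp: k_def intro!: integral_eq_zero_AE)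
  then have "t \<in> {0<..<T}" if "k (t - c) \<noteq> 0" for t using in_range that by blast
  then have "(\<integral>t. k (t - c) \<partial>time_measure T) = (\<integral>t. k (t - c) \<partial>lborel)"
    by (intro integral_time_eq_lborel) auto
  also have "\<dots> = (\<integral>t. k t \<partial>lborel)" using lborel_integral_shift[of k "- c"] by simp
  finally show ?thesis by (simp add: inner k_def)
qed

text \<open>On the square of half-width \<open>\<delta> / 4\<close> around \<open>(c, c)\<close> both arguments of the two factors are at most
\<open>\<delta> / 2\<close>, where the bump is bounded below by its value at \<open>\<delta> / 2\<close>.\<close>

lemma diagonal_bump_mass_pos:
  assumes \<delta>: "0 < \<delta>" "0 < c - \<delta>" "c + \<delta> < T"
  shows "0 < (\<integral>t. \<integral>s. diagonal_bump \<delta> c t s \<partial>time_measure T \<partial>time_measure T)"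
proof -
  define J where "J = {c - \<delta> / 4<..<c + \<delta> / 4}"
  define m where "m = bump \<delta> (\<delta> / 2) * bump \<delta> (\<delta> / 2)"
  obtain B where B: "0 \<le> B" "\<And>c t s. \<bar>diagonal_bump \<delta> c t s\<bar> \<le> B"
    using diagonal_bump_bounded[OF \<delta>(1)] by blast
  have [measurable]: "J \<in> sets borel" by (simp add: J_def)
  have "bump \<delta> (\<delta> / 2) \<noteq> 0" using \<delta> by (simp add: bump_eq_0_iff)
  then have m: "0 < m" using bump_nonneg[of \<delta> "\<delta> / 2"] by (simp add: m_def less_le)
  have half: "bump \<delta> (\<delta> / 2) \<le> bump \<delta> t" if "\<bar>t\<bar> \<le> \<delta> / 2" for t
  proof -
    have "\<bar>t\<bar>\<^sup>2 \<le> (\<delta> / 2)\<^sup>2" by (rule power_mono[OF that]) simp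
    then show ?thesis unfolding bump_def by (intro cutoff_mono) (simp add: power2_eq_square)
  qed
  have lower: "m * indicat_real J t * indicat_real J s \<le> diagonal_bump \<delta> c t s" for t s
  proof (cases "t \<in> J \<and> s \<in> J")
    case True
    then have "c - \<delta> / 4 < t" "t < c + \<delta> / 4" "c - \<delta> / 4 < s" "s < c + \<delta> / 4" by (auto simp: J_def)
    then have "\<bar>t - s\<bar> \<le> \<delta> / 2" "\<bar>t + s - 2 * c\<bar> \<le> \<delta> / 2" by linarith+
    then have "m \<le> diagonal_bump \<delta> c t s"
      unfolding m_def diagonal_bump_def using half bump_nonneg by (intro mult_mono) auto
    then show ?thesis using True by simp
  qed (auto simp: diagonal_bump_nonneg)
  define j where "j = (\<integral>t. indicat_real J t \<partial>time_measure T)"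
  have "j = (\<integral>t. indicat_real J t \<partial>lborel)"
    unfolding j_def using \<delta> by (intro integral_time_eq_lborel) (auto simp: J_def indicator_def)
  also have "\<dots> = \<delta> / 2" using \<delta> by (simp add: J_def)
  finally have j: "0 < j" using \<delta> by simp
  have int: "integrable (time_measure T) g" if "g \<in> borel_measurable borel" "\<And>t. \<bar>g t\<bar> \<le> K" for g :: "real \<Rightarrow> real" and K
    using that by (intro time.integrable_const_bound[of _ K]) auto
  have ind: "\<bar>m * indicat_real J t * indicat_real J s\<bar> \<le> m" for t s
    using m by (auto simp: indicator_def)
  have "m * j * j = (\<integral>t. \<integral>s. m * indicat_real J t * indicat_real J s \<partial>time_measure T \<partial>time_measure T)"
    by (simp add: j_def mult_ac)
  also have "\<dots> \<le> (\<integral>t. \<integral>s. diagonal_bump \<delta> c t s \<partial>time_measure T \<partial>time_measure T)"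
  proof (rule integral_mono)
    have "\<bar>\<integral>s. m * indicat_real J t * indicat_real J s \<partial>time_measure T\<bar> \<le> m * measure (time_measure T) (space (time_measure T))" for t
      by (rule finite_measure_integral_bound[OF finite_measure_time _ ind]) measurable
    then show "integrable (time_measure T) (\<lambda>t. \<integral>s. m * indicat_real J t * indicat_real J s \<partial>time_measure T)"
      by (intro int) measurable
    have "\<bar>\<integral>s. diagonal_bump \<delta> c t s \<partial>time_measure T\<bar> \<le> B * measure (time_measure T) (space (time_measure T))" for t
      by (rule finite_measure_integral_bound[OF finite_measure_time _ B(2)]) measurable
    then show "integrable (time_measure T) (\<lambda>t. \<integral>s. diagonal_bump \<delta> c t s \<partial>time_measure T)"
      by (intro int) measurable
    show "(\<integral>s. m * indicat_real J t * indicat_real J s \<partial>time_measure T) \<le> (\<integral>s. diagonal_bump \<delta> c t s \<partial>time_measure T)" for t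
    proof (rule integral_mono[OF _ _ lower])
      show "integrable (time_measure T) (\<lambda>s. m * indicat_real J t * indicat_real J s)"
        by (rule int[OF _ ind]) measurable
      show "integrable (time_measure T) (diagonal_bump \<delta> c t)"
        by (rule int[OF _ B(2)]) measurable
    qed
  qed
  finally have "m * j * j \<le> (\<integral>t. \<integral>s. diagonal_bump \<delta> c t s \<partial>time_measure T \<partial>time_measure T)" .
  moreover have "0 < m * j * j" using m j by (intro mult_pos_pos)
  ultimately show ?thesis by (rule less_le_trans[rotated])
qed

definition kernel_distance :: "(real^'d \<Rightarrow> real) \<Rightarrow> (real^'d \<Rightarrow> real) \<Rightarrow> (real^'d \<Rightarrow> real) \<Rightarrow> real" where
  "kernel_distance \<omega> g h = (\<integral>x. \<integral>y. \<bar>g x - h y\<bar> * \<omega> (x - y) \<partial>cell_measure \<partial>cell_measure)"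

interpretation cylinder_pair: pair_sigma_finite "cylinder_measure T" "cylinder_measure T" for T ..

lemma AE_cylinder_close:
  fixes U :: "real^'d \<Rightarrow> real \<Rightarrow> real"
  assumes U: "bounded_periodic M U"
    and close: "\<And>t. t \<in> {0<..<T} \<Longrightarrow> \<bar>t - c\<bar> < \<delta> \<Longrightarrow> AE x in lborel. \<bar>U x t - U x c\<bar> \<le> \<epsilon>"
  shows "AE p in cylinder_measure T. \<bar>snd p - c\<bar> < \<delta> \<longrightarrow> \<bar>U (fst p) (snd p) - U (fst p) c\<bar> \<le> \<epsilon>"
proof (rule AE_cylinderI)
  note [measurable (raw)] = bounded_periodic_compose[OF U]
  have "{p \<in> space (borel \<Otimes>\<^sub>M borel). \<bar>snd p - c\<bar> < \<delta> \<longrightarrow>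
      \<bar>U (fst p) (snd p) - U (fst p) c\<bar> \<le> \<epsilon>} \<in> sets (borel \<Otimes>\<^sub>M borel)"
    by measurable
  then show "{p. \<bar>snd p - c\<bar> < \<delta> \<longrightarrow> \<bar>U (fst p) (snd p) - U (fst p) c\<bar> \<le> \<epsilon>}
      \<in> sets (borel \<Otimes>\<^sub>M borel)"
    by (simp add: space_pair_measure)
  show "AE x in lborel. \<bar>snd (x, t) - c\<bar> < \<delta> \<longrightarrow> \<bar>U (fst (x, t)) (snd (x, t)) - U (fst (x, t)) c\<bar> \<le> \<epsilon>"
    if "t \<in> {0<..<T}" for t
    using close[OF that] by (cases "\<bar>t - c\<bar> < \<delta>") auto
qed

text \<open>On the support of the diagonal bump both times are within \<open>\<delta>\<close> of \<open>c\<close>, where \<open>u\<close> and \<open>v\<close> may be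
replaced by their values at time \<open>c\<close> with an error \<open>2 * \<epsilon>\<close>; then the space variables separate
from the time variables.\<close>

lemma localise_on_diagonal:
  fixes U V :: "real^'d \<Rightarrow> real \<Rightarrow> real"
  assumes \<omega>: "mollifier \<omega>" and U: "bounded_periodic M U" and V: "bounded_periodic M V"
    and \<delta>: "0 < \<delta>" "0 < c - \<delta>" "c + \<delta> < T"
    and close_U: "\<And>t. t \<in> {0<..<T} \<Longrightarrow> \<bar>t - c\<bar> < \<delta> \<Longrightarrow> AE x in lborel. \<bar>U x t - U x c\<bar> \<le> \<epsilon>"
    and close_V: "\<And>t. t \<in> {0<..<T} \<Longrightarrow> \<bar>t - c\<bar> < \<delta> \<Longrightarrow> AE x in lborel. \<bar>V x t - V x c\<bar> \<le> \<epsilon>"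
    and \<epsilon>: "0 \<le> \<epsilon>"
  defines "g \<equiv> \<lambda>w :: ((real^'d) \<times> real) \<times> (real^'d) \<times> real.
    gap U V (fst w) (snd w) * \<omega> (fst (fst w) - fst (snd w))
      * diagonal_bump \<delta> c (snd (fst w)) (snd (snd w))"
    and "\<beta> \<equiv> \<integral>t. \<integral>s. diagonal_bump \<delta> c t s \<partial>time_measure T \<partial>time_measure T"
  shows "integrable (doubled_measure T) g"
    and "\<bar>integral\<^sup>L (doubled_measure T) g
        - kernel_distance \<omega> (\<lambda>x. U x c) (\<lambda>x. V x c) * \<beta>\<bar>
      \<le> 2 * \<epsilon> * (\<integral>x. \<integral>y. \<omega> (x - y) \<partial>cell_measure \<partial>cell_measure) * \<beta>"
proof -
  interpret mollifier \<omega> by fact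
  let ?c = "cylinder_measure T :: ((real^'d) \<times> real) measure"
  let ?D = "?c \<Otimes>\<^sub>M ?c"
  have fin_D: "finite_measure ?D" by (intro finite_measure_pair_measure finite_measure_cylinder)
  interpret D: finite_measure ?D by (rule fin_D)
  note [measurable (raw)] = bounded_periodic_compose[OF U] bounded_periodic_compose[OF V]
  obtain W where W: "0 \<le> W" "\<And>x. \<bar>\<omega> x\<bar> \<le> W" using bounded by blast
  obtain B where B: "0 \<le> B" "\<And>c t s. \<bar>diagonal_bump \<delta> c t s\<bar> \<le> B"
    using diagonal_bump_bounded[OF \<delta>(1)] by blast
  have M: "0 \<le> M" using bounded_periodicD(1)[OF U, of 0 0] by simp
  have diff: "\<bar>U x t - V y s\<bar> \<le> 2 * M" for x t y s
    using bounded_periodicD(1)[OF U, of x t] bounded_periodicD(1)[OF V, of y s] by linarith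
  define g\<^sub>0 where "g\<^sub>0 w = \<bar>U (fst (fst w)) c - V (fst (snd w)) c\<bar> * \<omega> (fst (fst w) - fst (snd w))
      * diagonal_bump \<delta> c (snd (fst w)) (snd (snd w))" for w :: "((real^'d) \<times> real) \<times> (real^'d) \<times> real"
  define e where "e w = 2 * \<epsilon> * \<omega> (fst (fst w) - fst (snd w)) * diagonal_bump \<delta> c (snd (fst w)) (snd (snd w))"
    for w :: "((real^'d) \<times> real) \<times> (real^'d) \<times> real"
  have [measurable]: "g \<in> borel_measurable ?D" "g\<^sub>0 \<in> borel_measurable ?D" "e \<in> borel_measurable ?D"
    unfolding g_def g\<^sub>0_def e_def by measurable
  have F_bound: "\<bar>\<bar>U x c - V y c\<bar> * \<omega> (x - y)\<bar> \<le> 2 * M * W" for x y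
    unfolding abs_mult abs_abs using diff W M by (intro mult_mono) auto
  have e_bound: "\<bar>2 * \<epsilon> * \<omega> (x - y)\<bar> \<le> 2 * \<epsilon> * W" for x y
    unfolding abs_mult using W \<epsilon> by (intro mult_mono) auto
  have int_g: "integrable ?D g"
  proof (rule D.integrable_const_bound)
    have "\<bar>g w\<bar> \<le> 2 * M * W * B" for w
      unfolding g_def abs_mult abs_abs using diff W M B by (intro mult_mono) auto
    then show "AE w in ?D. norm (g w) \<le> 2 * M * W * B" by simp
  qed measurable
  then show "integrable ?D g" .
  have int_g\<^sub>0: "integrable ?D g\<^sub>0"
  proof (rule D.integrable_const_bound)
    have "\<bar>g\<^sub>0 w\<bar> \<le> 2 * M * W * B" for w
      unfolding g\<^sub>0_def abs_mult abs_abs using diff W M B by (intro mult_mono) auto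
    then show "AE w in ?D. norm (g\<^sub>0 w) \<le> 2 * M * W * B" by simp
  qed measurable
  have int_e: "integrable ?D e"
  proof (rule D.integrable_const_bound)
    have "\<bar>e w\<bar> \<le> \<bar>2\<bar> * \<epsilon> * W * B" for w
      unfolding e_def abs_mult using W \<epsilon> B by (intro mult_mono) auto
    then show "AE w in ?D. norm (e w) \<le> \<bar>2\<bar> * \<epsilon> * W * B" by simp
  qed measurable
  have I_g\<^sub>0: "integral\<^sup>L ?D g\<^sub>0 = kernel_distance \<omega> (\<lambda>x. U x c) (\<lambda>x. V x c) * \<beta>"
    unfolding g\<^sub>0_def kernel_distance_def \<beta>_def
    by (rule integral_double_cylinder_product[OF _ F_bound _ B(2)]) measurable
  have I_e: "integral\<^sup>L ?D e = (\<integral>x. \<integral>y. 2 * \<epsilon> * \<omega> (x - y) \<partial>cell_measure \<partial>cell_measure) * \<beta>"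
    unfolding e_def \<beta>_def
    by (rule integral_double_cylinder_product[OF _ e_bound _ B(2)]) measurable
  have ae_U: "AE p in ?c. \<bar>snd p - c\<bar> < \<delta> \<longrightarrow> \<bar>U (fst p) (snd p) - U (fst p) c\<bar> \<le> \<epsilon>"
    using AE_cylinder_close[OF U] close_U by blast
  have ae_V: "AE p in ?c. \<bar>snd p - c\<bar> < \<delta> \<longrightarrow> \<bar>V (fst p) (snd p) - V (fst p) c\<bar> \<le> \<epsilon>"
    using AE_cylinder_close[OF V] close_V by blast
  have ae: "AE w in ?D. norm (g w - g\<^sub>0 w) \<le> e w"
  proof (rule cylinder_pair.AE_pair_measure)
    show "{w \<in> space ?D. norm (g w - g\<^sub>0 w) \<le> e w} \<in> sets ?D" by measurable
    show "AE p in ?c. AE q in ?c. norm (g (p, q) - g\<^sub>0 (p, q)) \<le> e (p, q)"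
      using ae_U
    proof eventually_elim
      case (elim p)
      show ?case
        using ae_V
      proof eventually_elim
        case (elim q)
        define k where "k = \<omega> (fst p - fst q) * diagonal_bump \<delta> c (snd p) (snd q)"
        have k: "0 \<le> k" unfolding k_def by (intro mult_nonneg_nonneg nonneg diagonal_bump_nonneg)
        have eq: "g (p, q) - g\<^sub>0 (p, q)
            = (gap U V p q - \<bar>U (fst p) c - V (fst q) c\<bar>) * k"
          "e (p, q) = 2 * \<epsilon> * k"
          by (simp_all add: g_def g\<^sub>0_def e_def k_def algebra_simps)
        show ?case
        proof (cases "diagonal_bump \<delta> c (snd p) (snd q) = 0")
          case True
          then show ?thesis unfolding eq by (simp add: k_def)
        next
          case False
          from diagonal_bump_support[OF \<delta>(1) this]
          have "\<bar>U (fst p) (snd p) - U (fst p) c\<bar> \<le> \<epsilon>" "\<bar>V (fst q) (snd q) - V (fst q) c\<bar> \<le> \<epsilon>"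
            using elim \<open>\<bar>snd p - c\<bar> < \<delta> \<longrightarrow> \<bar>U (fst p) (snd p) - U (fst p) c\<bar> \<le> \<epsilon>\<close> by auto
          then have "\<bar>gap U V p q - \<bar>U (fst p) c - V (fst q) c\<bar>\<bar> \<le> 2 * \<epsilon>"
            by linarith
          then show ?thesis unfolding eq real_norm_def abs_mult abs_of_nonneg[OF k]
            using k by (rule mult_right_mono)
        qed
      qed
    qed
  qed
  have "\<bar>integral\<^sup>L ?D g - integral\<^sup>L ?D g\<^sub>0\<bar> = norm (\<integral>w. g w - g\<^sub>0 w \<partial>?D)"
    using int_g int_g\<^sub>0 by simp
  also have "\<dots> \<le> (\<integral>w. norm (g w - g\<^sub>0 w) \<partial>?D)" by (rule integral_norm_bound)
  also have "\<dots> \<le> integral\<^sup>L ?D e"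
    by (rule integral_mono_AE[OF _ int_e ae]) (use int_g int_g\<^sub>0 in simp)
  finally show "\<bar>integral\<^sup>L ?D g - kernel_distance \<omega> (\<lambda>x. U x c) (\<lambda>x. V x c) * \<beta>\<bar>
      \<le> 2 * \<epsilon> * (\<integral>x. \<integral>y. \<omega> (x - y) \<partial>cell_measure \<partial>cell_measure) * \<beta>"
    by (simp add: I_g\<^sub>0 I_e)
qed

definition Linf_continuous :: "real \<Rightarrow> (real^'d \<Rightarrow> real \<Rightarrow> real) \<Rightarrow> bool" where
  "Linf_continuous T U \<longleftrightarrow> (\<forall>c\<in>{0<..<T}. \<forall>\<epsilon>>0. \<exists>\<delta>>0. \<forall>t\<in>{0<..<T}. \<bar>t - c\<bar> < \<delta> \<longrightarrow>
     (AE x in lborel. \<bar>U x t - U x c\<bar> \<le> \<epsilon>))"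

lemma Linf_continuousD:
  assumes "Linf_continuous T U" "c \<in> {0<..<T}" "0 < \<epsilon>"
  obtains \<delta> where "0 < \<delta>"
    "\<And>t. t \<in> {0<..<T} \<Longrightarrow> \<bar>t - c\<bar> < \<delta> \<Longrightarrow> AE x in lborel. \<bar>U x t - U x c\<bar> \<le> \<epsilon>"
  using assms unfolding Linf_continuous_def by blast

text \<open>Both diagonal bumps have the same positive mass \<open>\<beta>\<close>, by which the localised inequality is
divided. The kernel is fixed throughout, so the error \<open>4 * \<epsilon> * W\<close> can be made arbitrarily small.\<close>

lemma time_localisation:
  fixes U V :: "real^'d \<Rightarrow> real \<Rightarrow> real"
  assumes \<omega>: "mollifier \<omega>" and U: "bounded_periodic M U" and V: "bounded_periodic M V"
    and contU: "Linf_continuous T U" and contV: "Linf_continuous T V"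
    and c: "0 < c\<^sub>1" "c\<^sub>1 \<le> c\<^sub>2" "c\<^sub>2 < T"
    and main: "\<And>\<delta>. 0 < \<delta> \<Longrightarrow> 0 < c\<^sub>1 - \<delta> \<Longrightarrow> c\<^sub>2 + \<delta> < T \<Longrightarrow>
      0 \<le> (\<integral>w. gap U V (fst w) (snd w) * \<omega> (fst (fst w) - fst (snd w))
        * (2 * (diagonal_bump \<delta> c\<^sub>1 (snd (fst w)) (snd (snd w)) - diagonal_bump \<delta> c\<^sub>2 (snd (fst w)) (snd (snd w))))
        \<partial>doubled_measure T)"
  shows "kernel_distance \<omega> (\<lambda>x. U x c\<^sub>2) (\<lambda>x. V x c\<^sub>2) \<le> kernel_distance \<omega> (\<lambda>x. U x c\<^sub>1) (\<lambda>x. V x c\<^sub>1)"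
    (is "?\<Phi> c\<^sub>2 \<le> ?\<Phi> c\<^sub>1")
proof (rule field_le_epsilon)
  fix e :: real assume e: "0 < e"
  let ?D = "doubled_measure T :: (((real^'d) \<times> real) \<times> (real^'d) \<times> real) measure"
  define W where "W = (\<integral>x. \<integral>y. \<omega> (x - y) \<partial>cell_measure \<partial>cell_measure)"
  have W: "0 \<le> W"
    unfolding W_def using mollifier.nonneg[OF \<omega>] by (intro Bochner_Integration.integral_nonneg) auto
  \<comment> \<open>chosen so that \<open>4 * \<epsilon> * W \<le> e\<close>, also if \<open>W = 0\<close>\<close>
  define \<epsilon> where "\<epsilon> = e / (4 * W + 1)"
  have \<epsilon>: "0 < \<epsilon>" unfolding \<epsilon>_def using e W by (intro divide_pos_pos) auto
  have "4 * \<epsilon> * W \<le> e"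
  proof -
    have "4 * \<epsilon> * W = e * (4 * W / (4 * W + 1))" by (simp add: \<epsilon>_def)
    also have "\<dots> \<le> e * 1" using e W by (intro mult_left_mono) (auto simp: divide_simps)
    finally show ?thesis by simp
  qed
  have "c\<^sub>1 \<in> {0<..<T}" "c\<^sub>2 \<in> {0<..<T}" using c by auto
  note c_in = this
  obtain d\<^sub>1 where d1: "0 < d\<^sub>1"
    and U1: "\<And>t. t \<in> {0<..<T} \<Longrightarrow> \<bar>t - c\<^sub>1\<bar> < d\<^sub>1 \<Longrightarrow> AE x in lborel. \<bar>U x t - U x c\<^sub>1\<bar> \<le> \<epsilon>"
    using Linf_continuousD[OF contU c_in(1) \<epsilon>] by blast
  obtain d\<^sub>2 where d2: "0 < d\<^sub>2"
    and V1: "\<And>t. t \<in> {0<..<T} \<Longrightarrow> \<bar>t - c\<^sub>1\<bar> < d\<^sub>2 \<Longrightarrow> AE x in lborel. \<bar>V x t - V x c\<^sub>1\<bar> \<le> \<epsilon>"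
    using Linf_continuousD[OF contV c_in(1) \<epsilon>] by blast
  obtain d\<^sub>3 where d3: "0 < d\<^sub>3"
    and U2: "\<And>t. t \<in> {0<..<T} \<Longrightarrow> \<bar>t - c\<^sub>2\<bar> < d\<^sub>3 \<Longrightarrow> AE x in lborel. \<bar>U x t - U x c\<^sub>2\<bar> \<le> \<epsilon>"
    using Linf_continuousD[OF contU c_in(2) \<epsilon>] by blast
  obtain d\<^sub>4 where d4: "0 < d\<^sub>4"
    and V2: "\<And>t. t \<in> {0<..<T} \<Longrightarrow> \<bar>t - c\<^sub>2\<bar> < d\<^sub>4 \<Longrightarrow> AE x in lborel. \<bar>V x t - V x c\<^sub>2\<bar> \<le> \<epsilon>"
    using Linf_continuousD[OF contV c_in(2) \<epsilon>] by blast
  note d = d1 d2 d3 d4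
  define \<delta> where "\<delta> = min (min (min d\<^sub>1 d\<^sub>2) (min d\<^sub>3 d\<^sub>4)) (min (c\<^sub>1 / 2) ((T - c\<^sub>2) / 2))"
  have \<delta>_le: "\<delta> \<le> d\<^sub>1" "\<delta> \<le> d\<^sub>2" "\<delta> \<le> d\<^sub>3" "\<delta> \<le> d\<^sub>4" "\<delta> \<le> c\<^sub>1 / 2" "\<delta> \<le> (T - c\<^sub>2) / 2"
    unfolding \<delta>_def by (simp_all only: min_le_iff_disj order_refl simp_thms)
  have \<delta>_pos: "0 < \<delta>" using d c by (simp add: \<delta>_def)
  have \<delta>: "0 < c\<^sub>1 - \<delta>" "c\<^sub>1 + \<delta> < T" "0 < c\<^sub>2 - \<delta>" "c\<^sub>2 + \<delta> < T"
    using \<delta>_le(5,6) c by auto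
  define \<beta> where "\<beta> c = (\<integral>t. \<integral>s. diagonal_bump \<delta> c t s \<partial>time_measure T \<partial>time_measure T)" for c
  have \<beta>: "\<beta> c\<^sub>2 = \<beta> c\<^sub>1" "0 < \<beta> c\<^sub>1"
    unfolding \<beta>_def
    using diagonal_bump_mass[OF \<delta>_pos \<delta>(1,2)] diagonal_bump_mass[OF \<delta>_pos \<delta>(3,4)]
      diagonal_bump_mass_pos[OF \<delta>_pos \<delta>(1,2)] by simp_all
  define g where "g c w = gap U V (fst w) (snd w) * \<omega> (fst (fst w) - fst (snd w))
      * diagonal_bump \<delta> c (snd (fst w)) (snd (snd w))" for c and w :: "((real^'d) \<times> real) \<times> (real^'d) \<times> real"
  have U1': "AE x in lborel. \<bar>U x t - U x c\<^sub>1\<bar> \<le> \<epsilon>" if "t \<in> {0<..<T}" "\<bar>t - c\<^sub>1\<bar> < \<delta>" for t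
    using U1[OF that(1)] that(2) \<delta>_le(1) by linarith
  have V1': "AE x in lborel. \<bar>V x t - V x c\<^sub>1\<bar> \<le> \<epsilon>" if "t \<in> {0<..<T}" "\<bar>t - c\<^sub>1\<bar> < \<delta>" for t
    using V1[OF that(1)] that(2) \<delta>_le(2) by linarith
  have U2': "AE x in lborel. \<bar>U x t - U x c\<^sub>2\<bar> \<le> \<epsilon>" if "t \<in> {0<..<T}" "\<bar>t - c\<^sub>2\<bar> < \<delta>" for t
    using U2[OF that(1)] that(2) \<delta>_le(3) by linarith
  have V2': "AE x in lborel. \<bar>V x t - V x c\<^sub>2\<bar> \<le> \<epsilon>" if "t \<in> {0<..<T}" "\<bar>t - c\<^sub>2\<bar> < \<delta>" for t
    using V2[OF that(1)] that(2) \<delta>_le(4) by linarith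
  note at1 = localise_on_diagonal[OF \<omega> U V \<delta>_pos \<delta>(1,2) U1' V1' less_imp_le[OF \<epsilon>], folded g_def \<beta>_def W_def]
  note at2 = localise_on_diagonal[OF \<omega> U V \<delta>_pos \<delta>(3,4) U2' V2' less_imp_le[OF \<epsilon>], folded g_def \<beta>_def W_def]
  have "0 \<le> (\<integral>w. 2 * (g c\<^sub>1 w - g c\<^sub>2 w) \<partial>?D)"
    using main[OF \<delta>_pos \<delta>(1,4)] by (simp add: g_def algebra_simps)
  then have "integral\<^sup>L ?D (g c\<^sub>2) \<le> integral\<^sup>L ?D (g c\<^sub>1)"
    using at1(1) at2(1) by simp
  moreover have "integral\<^sup>L ?D (g c\<^sub>1) \<le> (?\<Phi> c\<^sub>1 + 2 * \<epsilon> * W) * \<beta> c\<^sub>1"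
    using at1(2) unfolding distrib_right by linarith
  moreover have "(?\<Phi> c\<^sub>2 - 2 * \<epsilon> * W) * \<beta> c\<^sub>1 \<le> integral\<^sup>L ?D (g c\<^sub>2)"
    using at2(2) unfolding left_diff_distrib \<beta>(1) by linarith
  ultimately have "(?\<Phi> c\<^sub>2 - 2 * \<epsilon> * W) * \<beta> c\<^sub>1 \<le> (?\<Phi> c\<^sub>1 + 2 * \<epsilon> * W) * \<beta> c\<^sub>1" by linarith
  then have "?\<Phi> c\<^sub>2 - 2 * \<epsilon> * W \<le> ?\<Phi> c\<^sub>1 + 2 * \<epsilon> * W"
    using \<beta>(2) by (simp only: mult_le_cancel_right_pos)
  then show "?\<Phi> c\<^sub>2 \<le> ?\<Phi> c\<^sub>1 + e" using \<open>4 * \<epsilon> * W \<le> e\<close> by linarith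
qed

section \<open>Localisation in space\<close>

lemma open_AE_notin_empty:
  fixes S :: "'a::euclidean_space set"
  assumes "open S" "AE x in lborel. x \<notin> S" shows "S = {}"
proof -
  have "S \<in> null_sets lborel"
    using assms by (subst AE_iff_null_sets) auto
  then have "negligible S" by (simp add: negligible_iff_null_sets null_sets_completionI)
  then show ?thesis using open_not_negligible[OF assms(1)] by blast
qed

lemma AE_cell_iff:
  "(AE x in cell_measure. P x) \<longleftrightarrow> (AE x in lborel. x \<in> Lam \<longrightarrow> P x)"
  unfolding cell_measure_def by (subst AE_density) (auto simp: indicator_def)

text \<open>The kernel \<open>cos_kernel \<delta>\<close> concentrates at the corners of the cell. Shifting by the centre of the
cell moves all of its mass to a single point inside.\<close>

definition half_period :: "real^'d" where "half_period = (\<chi> i. pi)"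

lemma mollifier_shifted_mass_pos:
  fixes \<omega> :: "real^'d \<Rightarrow> real"
  assumes "mollifier \<omega>" "0 < \<omega> 0"
  shows "0 < (\<integral>h. \<omega> (h - half_period) \<partial>cell_measure)"
proof -
  interpret mollifier \<omega> by fact
  obtain W where W: "0 \<le> W" "\<And>x. \<bar>\<omega> x\<bar> \<le> W" using bounded by blast
  have int: "integrable cell_measure (\<lambda>h. \<omega> (h - half_period))"
    by (rule cell.integrable_const_bound[of _ W]) (auto simp: W)
  have "(\<integral>h. \<omega> (h - half_period) \<partial>cell_measure) \<noteq> 0"
  proof
    assume "(\<integral>h. \<omega> (h - half_period) \<partial>cell_measure) = 0"
    then have "AE h in cell_measure. \<omega> (h - half_period) = 0"
      using integral_nonneg_eq_0_iff_AE[OF int] nonneg by simp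
    then have "AE h in lborel. h \<notin> Lam \<inter> {h. 0 < \<omega> (h - half_period)}"
      unfolding AE_cell_iff by eventually_elim auto
    moreover have "open (Lam \<inter> {h. 0 < \<omega> (h - half_period)})"
      unfolding Lam_eq_box
      by (intro open_Int open_box open_Collect_less continuous_intros continuous_on_compose2[OF continuous]) auto
    ultimately have "Lam \<inter> {h. 0 < \<omega> (h - half_period)} = {}" by (intro open_AE_notin_empty)
    moreover have "half_period \<in> Lam \<inter> {h. 0 < \<omega> (h - half_period)}"
      using assms(2) by (simp add: Lam_def half_period_def)
    ultimately show False by blast
  qed
  moreover have "0 \<le> (\<integral>h. \<omega> (h - half_period) \<partial>cell_measure)"
    using nonneg by (intro Bochner_Integration.integral_nonneg)
  ultimately show ?thesis by linarith
qed

text \<open>Substitute \<open>y = x + (h - half_period)\<close>, with \<open>h\<close> running through the cell, and exchange the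
integrals: the double integral becomes an average over small translations.\<close>

lemma kernel_distance_eq:
  fixes g k :: "real^'d \<Rightarrow> real"
  assumes \<omega>: "mollifier \<omega>" and [measurable]: "g \<in> borel_measurable borel" "k \<in> borel_measurable borel"
    and bound: "\<And>x. \<bar>g x\<bar> \<le> M" "\<And>x. \<bar>k x\<bar> \<le> M" and k: "periodic k"
  shows "kernel_distance \<omega> g k = (\<integral>h. \<omega> (h - half_period)
      * (\<integral>x. \<bar>g x - k (x + (h - half_period))\<bar> \<partial>cell_measure) \<partial>cell_measure)"
proof -
  interpret mollifier \<omega> by fact
  obtain W where W: "0 \<le> W" "\<And>x. \<bar>\<omega> x\<bar> \<le> W" using bounded by blast
  have M: "0 \<le> M" using bound(1)[of 0] by simp
  have inner: "(\<integral>y. \<bar>g x - k y\<bar> * \<omega> (x - y) \<partial>cell_measure)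
      = (\<integral>h. \<bar>g x - k (x + (h - half_period))\<bar> * \<omega> (h - half_period) \<partial>cell_measure)" for x
  proof -
    have "periodic (\<lambda>y. \<bar>g x - k y\<bar> * \<omega> (y - x))"
    proof -
      have "\<omega> (y + axis i (2 * pi) - x) = \<omega> (y - x)" for y i
      proof -
        have "\<omega> ((y - x) + axis i (2 * pi)) = \<omega> (y - x)" using periodic by (simp add: periodic_def)
        then show ?thesis by (simp add: algebra_simps)
      qed
      then show ?thesis using k by (simp add: periodic_def)
    qed
    from integral_cell_shift[OF _ this, of "x - half_period"]
    have "(\<integral>h. \<bar>g x - k (h + (x - half_period))\<bar> * \<omega> (h + (x - half_period) - x) \<partial>cell_measure)
        = (\<integral>y. \<bar>g x - k y\<bar> * \<omega> (y - x) \<partial>cell_measure)"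
      using nonneg by simp
    moreover have "h + (x - half_period) = x + (h - half_period)" "x + (h - half_period) - x = h - half_period" for h
      by simp_all
    moreover have "\<omega> (y - x) = \<omega> (x - y)" for y using even[of "x - y"] by simp
    ultimately show ?thesis by (simp only:)
  qed
  have "\<bar>\<bar>g (fst w) - k (fst w + (snd w - half_period))\<bar> * \<omega> (snd w - half_period)\<bar> \<le> 2 * M * W" for w :: "(real^'d) \<times> (real^'d)"
  proof -
    have "\<bar>g (fst w) - k (fst w + (snd w - half_period))\<bar> \<le> 2 * M"
      using bound(1)[of "fst w"] bound(2)[of "fst w + (snd w - half_period)"] by linarith
    then show ?thesis unfolding abs_mult abs_abs using W M by (intro mult_mono) auto
  qed
  note fub = fubini_bounded[where g = "\<lambda>w. \<bar>g (fst w) - k (fst w + (snd w - half_period))\<bar> * \<omega> (snd w - half_period)",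
      OF finite_measure_cell finite_measure_cell _ this]
  have "kernel_distance \<omega> g k
      = (\<integral>h. \<integral>x. \<bar>g x - k (x + (h - half_period))\<bar> * \<omega> (h - half_period) \<partial>cell_measure \<partial>cell_measure)"
    unfolding kernel_distance_def inner using fub(2,3) by simp
  then show ?thesis by (simp add: mult.commute)
qed

text \<open>In \<open>kernel_distance_eq\<close> the weight is carried by small \<open>h - half_period\<close>, and there the inner
integral differs from its value without translation by at most \<open>\<epsilon>\<close>. Both sides are left
unnormalised, since only the positivity of the mass of the kernel matters later.\<close>

lemma kernel_distance_concentrates:
  fixes g k :: "real^'d \<Rightarrow> real"
  assumes [measurable]: "g \<in> borel_measurable borel" "k \<in> borel_measurable borel"
    and bound: "\<And>x. \<bar>g x\<bar> \<le> M" "\<And>x. \<bar>k x\<bar> \<le> M" and k: "periodic k" and \<epsilon>: "0 < \<epsilon>"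
  shows "\<exists>\<delta>\<^sub>0>0. \<forall>\<delta>. 0 < \<delta> \<longrightarrow> \<delta> < \<delta>\<^sub>0 \<longrightarrow> \<bar>kernel_distance (cos_kernel \<delta>) g k
      - (\<integral>h. cos_kernel \<delta> (h - half_period) \<partial>(cell_measure :: (real^'d) measure)) * (\<integral>x. \<bar>g x - k x\<bar> \<partial>cell_measure)\<bar>
      \<le> \<epsilon> * (\<integral>h. cos_kernel \<delta> (h - half_period) \<partial>(cell_measure :: (real^'d) measure))"
proof -
  obtain d where d: "0 < d" "\<And>h. norm h < d \<Longrightarrow> (\<integral>x. \<bar>k (x + h) - k x\<bar> \<partial>cell_measure) \<le> \<epsilon>"
    using translation_continuous_L1[where V = k, OF _ bound(2) \<epsilon>] by auto
  \<comment> \<open>the Euclidean norm is at most the sum of the \<open>CARD('d)\<close> coordinates, each below \<open>\<delta>\<close>\<close>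
  define \<delta>\<^sub>0 where "\<delta>\<^sub>0 = min pi (d / real CARD('d))"
  define J where "J h = (\<integral>x. \<bar>g x - k (x + h)\<bar> \<partial>cell_measure)" for h
  have J_meas [measurable]: "J \<in> borel_measurable borel" unfolding J_def by measurable
  have diff: "\<bar>\<bar>g x - k y\<bar>\<bar> \<le> 2 * M" for x y
    using bound(1)[of x] bound(2)[of y] by simp
  have J_bound: "\<bar>J h\<bar> \<le> 2 * M * measure cell_measure (space (cell_measure :: (real^'d) measure))" for h
    unfolding J_def by (rule finite_measure_integral_bound[OF finite_measure_cell _ diff]) measurable
  have J_close: "\<bar>J h - J 0\<bar> \<le> \<epsilon>" if "norm h < d" for h
  proof -
    have int: "integrable cell_measure (\<lambda>x. \<bar>g x - k (x + h)\<bar>)" for h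
      by (rule cell.integrable_const_bound[of _ "2 * M"]) (use diff in auto)
    have "\<bar>J h - J 0\<bar> = norm (\<integral>x. \<bar>g x - k (x + h)\<bar> - \<bar>g x - k x\<bar> \<partial>cell_measure)"
      unfolding J_def using int[of h] int[of 0] by simp
    also have "\<dots> \<le> (\<integral>x. norm (\<bar>g x - k (x + h)\<bar> - \<bar>g x - k x\<bar>) \<partial>cell_measure)"
      by (rule integral_norm_bound)
    also have "\<dots> \<le> (\<integral>x. \<bar>k (x + h) - k x\<bar> \<partial>cell_measure)"
    proof (rule integral_mono)
      show "integrable cell_measure (\<lambda>x. norm (\<bar>g x - k (x + h)\<bar> - \<bar>g x - k x\<bar>))"
        using int[of h] int[of 0] by simp
      show "integrable cell_measure (\<lambda>x. \<bar>k (x + h) - k x\<bar>)"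
      proof (rule cell.integrable_const_bound[of _ "2 * M"])
        have "\<bar>k (x + h) - k x\<bar> \<le> 2 * M" for x using bound(2)[of x] bound(2)[of "x + h"] by linarith
        then show "AE x in cell_measure. norm \<bar>k (x + h) - k x\<bar> \<le> 2 * M" by simp
      qed measurable
    qed auto
    finally show ?thesis using d(2)[OF that] by linarith
  qed
  have "\<bar>kernel_distance (cos_kernel \<delta>) g k - (\<integral>h. cos_kernel \<delta> (h - half_period) \<partial>(cell_measure :: (real^'d) measure)) * J 0\<bar>
      \<le> \<epsilon> * (\<integral>h. cos_kernel \<delta> (h - half_period) \<partial>(cell_measure :: (real^'d) measure))"
    if \<delta>: "0 < \<delta>" "\<delta> < \<delta>\<^sub>0" for \<delta>
  proof -
    interpret mollifier "cos_kernel \<delta> :: real^'d \<Rightarrow> real" by (rule mollifier_cos_kernel)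
    obtain W where W: "0 \<le> W" "\<And>x::real^'d. \<bar>cos_kernel \<delta> x\<bar> \<le> W" using bounded by blast
    let ?w = "\<lambda>h::real^'d. cos_kernel \<delta> (h - half_period)"
    have int_w: "integrable cell_measure ?w"
      by (rule cell.integrable_const_bound[of _ W]) (auto simp: W)
    have int_wJ: "integrable cell_measure (\<lambda>h. ?w h * J (h - half_period))"
    proof (rule cell.integrable_const_bound)
      have "\<bar>?w h * J (h - half_period)\<bar> \<le> W * (2 * M * measure cell_measure (space (cell_measure :: (real^'d) measure)))" for h
        unfolding abs_mult using W J_bound by (intro mult_mono) auto
      then show "AE h in cell_measure. norm (?w h * J (h - half_period))
          \<le> W * (2 * M * measure cell_measure (space (cell_measure :: (real^'d) measure)))" by simp
    qed measurable
    have close: "\<bar>?w h * J (h - half_period) - ?w h * J 0\<bar> \<le> \<epsilon> * ?w h" if "h \<in> Lam" for h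
    proof (cases "?w h = 0")
      case False
      have "\<bar>(h - half_period) $ i\<bar> < \<delta>" for i
      proof (rule cos_kernel_support[OF \<delta>(1) _ False])
        show "\<delta> < pi" using \<delta>(2) by (simp add: \<delta>\<^sub>0_def)
        have "0 < h $ i" "h $ i < 2 * pi" using that by (auto simp: Lam_def)
        then show "\<bar>(h - half_period) $ i\<bar> \<le> pi" by (simp add: half_period_def abs_le_iff)
      qed
      then have "(\<Sum>i\<in>UNIV. \<bar>(h - half_period) $ i\<bar>) \<le> (\<Sum>i\<in>(UNIV :: 'd set). \<delta>)"
        by (intro sum_mono less_imp_le)
      then have "norm (h - half_period) \<le> real CARD('d) * \<delta>"
        using norm_le_l1_cart[of "h - half_period"] by simp
      also have "\<dots> < real CARD('d) * (d / real CARD('d))"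
        using \<delta>(2) by (intro mult_strict_left_mono) (auto simp: \<delta>\<^sub>0_def)
      finally have "\<bar>J (h - half_period) - J 0\<bar> \<le> \<epsilon>" by (intro J_close) simp
      moreover have "\<bar>?w h * J (h - half_period) - ?w h * J 0\<bar> = ?w h * \<bar>J (h - half_period) - J 0\<bar>"
        using nonneg[of "h - half_period"] by (simp add: abs_mult right_diff_distrib[symmetric])
      ultimately show ?thesis
        using mult_left_mono[OF _ nonneg[of "h - half_period"]] by (simp only: mult.commute[of \<epsilon>])
    qed simp
    have "kernel_distance (cos_kernel \<delta>) g k = (\<integral>h. ?w h * J (h - half_period) \<partial>cell_measure)"
      unfolding J_def by (rule kernel_distance_eq[OF mollifier_cos_kernel _ _ bound k]) measurable
    then have "\<bar>kernel_distance (cos_kernel \<delta>) g k - (\<integral>h. ?w h \<partial>cell_measure) * J 0\<bar>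
        = norm (\<integral>h. ?w h * J (h - half_period) - ?w h * J 0 \<partial>cell_measure)"
      using int_w int_wJ by simp
    also have "\<dots> \<le> (\<integral>h. norm (?w h * J (h - half_period) - ?w h * J 0) \<partial>cell_measure)"
      by (rule integral_norm_bound)
    also have "\<dots> \<le> (\<integral>h. \<epsilon> * ?w h \<partial>cell_measure)"
    proof (rule integral_mono_AE)
      show "AE h in cell_measure. norm (?w h * J (h - half_period) - ?w h * J 0) \<le> \<epsilon> * ?w h"
        unfolding AE_cell_iff using close by (auto intro: AE_I2)
    qed (use int_w int_wJ in auto)
    finally show ?thesis by simp
  qed
  moreover have "0 < \<delta>\<^sub>0" using d by (simp add: \<delta>\<^sub>0_def)
  moreover have "J 0 = (\<integral>x. \<bar>g x - k x\<bar> \<partial>cell_measure)" by (simp add: J_def)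
  ultimately show ?thesis by auto
qed

section \<open>The contraction\<close>

lemma bounded_periodic_mono: "bounded_periodic M U \<Longrightarrow> M \<le> M' \<Longrightarrow> bounded_periodic M' U"
  unfolding bounded_periodic_def by (meson order_trans)

lemma representative_mono: "representative T M u U \<Longrightarrow> M \<le> M' \<Longrightarrow> representative T M' u U"
  unfolding representative_def using bounded_periodic_mono by blast

lemma representative_exists:
  assumes "C_Linf_per T u" shows "\<exists>M U. representative T M u U"
proof (rule bounded_periodic_representative[OF assms])
  fix M U
  assume "bounded_periodic M U" "\<And>t. t \<in> {0..T} \<Longrightarrow> AE x in lborel. U x t = u x t"
  then have "representative T M u U" by (simp add: representative_def)
  then show ?thesis by blast
qed

lemma continuous_flux:
  assumes "\<And>j. Ck_on s UNIV (\<lambda>a. f a $ j)"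
  shows "continuous_on UNIV (f :: real \<Rightarrow> real^'d)"
proof -
  have "continuous_on UNIV (\<lambda>a. f a $ j)" for j using Ck_on_antimono[OF assms, of 0 j] by simp
  then have "continuous_on UNIV (\<lambda>a. \<chi> j. f a $ j)" by (intro continuous_on_vec_lambda)
  then show ?thesis by simp
qed

text \<open>The doubling inequality holds for every radius, with the same kernel and the same time test
function; letting the radius tend to zero removes the singular part, and the diagonal time test
function brings the result into the form required by \<open>time_localisation\<close>.\<close>

lemma kernel_contraction:
  fixes u v U V :: "real^'d \<Rightarrow> real \<Rightarrow> real"
  assumes f: "continuous_on UNIV f" and \<mu>: "levy_measure \<mu>"
    and u: "periodic_entropy_solution f \<mu> T u\<^sub>0 u" and v: "periodic_entropy_solution f \<mu> T v\<^sub>0 v"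
    and rep_U: "representative T M u U" and rep_V: "representative T M v V"
    and cont: "Linf_continuous T U" "Linf_continuous T V"
    and \<omega>: "mollifier \<omega>" and c: "0 < c\<^sub>1" "c\<^sub>1 \<le> c\<^sub>2" "c\<^sub>2 < T"
  shows "kernel_distance \<omega> (\<lambda>x. U x c\<^sub>2) (\<lambda>x. V x c\<^sub>2) \<le> kernel_distance \<omega> (\<lambda>x. U x c\<^sub>1) (\<lambda>x. V x c\<^sub>1)"
proof -
  have U: "bounded_periodic M U" and V: "bounded_periodic M V"
    using rep_U rep_V by (simp_all add: representative_def)
  show ?thesis
  proof (rule time_localisation[OF \<omega> U V cont c])
    fix \<delta> assume \<delta>: "0 < \<delta>" "0 < c\<^sub>1 - \<delta>" "c\<^sub>2 + \<delta> < T"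
    let ?D = "doubled_measure T :: (((real^'d) \<times> real) \<times> (real^'d) \<times> real) measure"
    define \<nu> where "\<nu> = distr \<mu> borel (\<lambda>z. z)"
    interpret levy \<nu> unfolding \<nu>_def by (rule levy_measureD[OF \<mu>])
    have f_meas: "f \<in> borel_measurable borel" by (rule borel_measurable_continuous_onI[OF f])
    have "compact (f ` {-M..M})"
      using f by (intro compact_continuous_image) (auto intro: continuous_on_subset)
    then obtain F where "\<And>y. y \<in> f ` {-M..M} \<Longrightarrow> norm y \<le> F" by (meson bounded_iff compact_imp_bounded)
    then have F: "norm (f a) \<le> F" if "\<bar>a\<bar> \<le> M" for a using that by (simp add: abs_le_iff)
    show "0 \<le> (\<integral>w. gap U V (fst w) (snd w) * \<omega> (fst (fst w) - fst (snd w))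
        * (2 * (diagonal_bump \<delta> c\<^sub>1 (snd (fst w)) (snd (snd w)) - diagonal_bump \<delta> c\<^sub>2 (snd (fst w)) (snd (snd w)))) \<partial>?D)"
    proof (rule diagonal_time_test[OF \<delta>(1,2) c(2) \<delta>(3)])
      fix \<psi> \<psi>' :: "real \<Rightarrow> real \<Rightarrow> real" and B
      assume \<psi>: "\<And>t s. \<psi> t s = \<psi> s t" "\<And>t s. 0 \<le> \<psi> t s" "\<And>t s. \<psi> t s \<le> B" "\<And>t s. \<bar>\<psi>' t s\<bar> \<le> B"
        and \<psi>_meas: "jointly_borel \<psi>"
          "jointly_borel \<psi>'"
        and test: "\<And>s. time_test T (\<lambda>t. \<psi> t s)" and der: "\<And>t s. ((\<lambda>t. \<psi> t s) has_real_derivative \<psi>' t s) (at t)"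
        and sum: "\<And>t s. \<psi>' t s + \<psi>' s t
          = 2 * (bump \<delta> (t - s) * bump \<delta> (t + s - 2 * c\<^sub>1) - bump \<delta> (t - s) * bump \<delta> (t + s - 2 * c\<^sub>2))"
      have meas: "(\<lambda>t. \<psi>' t s) \<in> borel_measurable borel" for s
        by (rule measurable_compose_curried[OF \<psi>_meas(2)]) auto
      obtain C where C: "\<And>r x. r < 1 \<Longrightarrow> \<bar>levy_adj \<nu> r \<omega> x\<bar> \<le> C * near_moment \<nu> r"
        using levy_adj_le_near_moment[OF \<omega>] by blast
      define X where "X = (\<integral>w. gap U V (fst w) (snd w)
          * \<omega> (fst (fst w) - fst (snd w)) * (\<psi>' (snd (fst w)) (snd (snd w)) + \<psi>' (snd (snd w)) (snd (fst w))) \<partial>?D)"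
      have "0 \<le> X + 4 * M * B * (C * near_moment \<nu> (1 / real (n + 2))) * measure ?D UNIV" for n
      proof -
        let ?r = "1 / real (n + 2)"
        have r: "0 < ?r" "?r < 1" by simp_all
        show ?thesis
          unfolding X_def
          using kernel_entropy_inequality[OF \<omega> \<mu> f_meas u rep_U r(1) test der meas]
            kernel_entropy_inequality[OF \<omega> \<mu> f_meas v rep_V r(1) test der meas]
          by (intro doubling_inequality[where f = f and F = F and \<psi> = \<psi> and \<gamma> = "gamma_drift \<mu> ?r",
                OF \<omega> r(1) U V f_meas F C[OF r(2)] \<psi>_meas \<psi>(2,3,1,4)])
            (simp_all add: \<nu>_def)
      qed
      moreover have "(\<lambda>n. X + 4 * M * B * (C * near_moment \<nu> (1 / real (n + 2))) * measure ?D UNIV)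
          \<longlonglongrightarrow> X + 4 * M * B * (C * 0) * measure ?D UNIV"
        by (intro tendsto_intros near_moment_tendsto_0)
      ultimately have "0 \<le> X + 4 * M * B * (C * 0) * measure ?D UNIV"
        by (intro LIMSEQ_le_const) auto
      then show ?thesis
        by (simp only: X_def sum diagonal_bump_def mult_zero_right mult_zero_left add_0_right)
    qed
  qed
qed

text \<open>The same kernel occurs at both times, so that its positive mass cancels.\<close>

lemma L1_cell_contraction:
  fixes u v U V :: "real^'d \<Rightarrow> real \<Rightarrow> real"
  assumes f: "continuous_on UNIV f" and \<mu>: "levy_measure \<mu>"
    and u: "periodic_entropy_solution f \<mu> T u\<^sub>0 u" and v: "periodic_entropy_solution f \<mu> T v\<^sub>0 v"
    and rep_U: "representative T M u U" and rep_V: "representative T M v V"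
    and cont: "Linf_continuous T U" "Linf_continuous T V"
    and c: "0 < c\<^sub>1" "c\<^sub>1 \<le> c\<^sub>2" "c\<^sub>2 < T"
  shows "(\<integral>x. \<bar>U x c\<^sub>2 - V x c\<^sub>2\<bar> \<partial>cell_measure) \<le> (\<integral>x. \<bar>U x c\<^sub>1 - V x c\<^sub>1\<bar> \<partial>cell_measure)"
    (is "?D c\<^sub>2 \<le> ?D c\<^sub>1")
proof (rule field_le_epsilon)
  fix e :: real assume e: "0 < e"
  have U: "bounded_periodic M U" and V: "bounded_periodic M V"
    using rep_U rep_V by (simp_all add: representative_def)
  note [measurable (raw)] = bounded_periodic_compose[OF U] bounded_periodic_compose[OF V]
  have conc: "\<exists>\<delta>\<^sub>0>0. \<forall>\<delta>. 0 < \<delta> \<longrightarrow> \<delta> < \<delta>\<^sub>0 \<longrightarrow> \<bar>kernel_distance (cos_kernel \<delta>) (\<lambda>x. U x t) (\<lambda>x. V x t)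
      - (\<integral>h. cos_kernel \<delta> (h - half_period) \<partial>(cell_measure :: (real^'d) measure)) * ?D t\<bar>
      \<le> e / 2 * (\<integral>h. cos_kernel \<delta> (h - half_period) \<partial>(cell_measure :: (real^'d) measure))" for t
    using e V by (intro kernel_distance_concentrates[OF _ _ bounded_periodicD(1)[OF U] bounded_periodicD(1)[OF V]])
      (auto simp: bounded_periodic_def)
  obtain \<delta>\<^sub>1 where \<delta>\<^sub>1: "0 < \<delta>\<^sub>1" "\<And>\<delta>. 0 < \<delta> \<Longrightarrow> \<delta> < \<delta>\<^sub>1 \<Longrightarrow> \<bar>kernel_distance (cos_kernel \<delta>) (\<lambda>x. U x c\<^sub>1) (\<lambda>x. V x c\<^sub>1)
      - (\<integral>h. cos_kernel \<delta> (h - half_period) \<partial>(cell_measure :: (real^'d) measure)) * ?D c\<^sub>1\<bar>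
      \<le> e / 2 * (\<integral>h. cos_kernel \<delta> (h - half_period) \<partial>(cell_measure :: (real^'d) measure))"
    using conc[of c\<^sub>1] by blast
  obtain \<delta>\<^sub>2 where \<delta>\<^sub>2: "0 < \<delta>\<^sub>2" "\<And>\<delta>. 0 < \<delta> \<Longrightarrow> \<delta> < \<delta>\<^sub>2 \<Longrightarrow> \<bar>kernel_distance (cos_kernel \<delta>) (\<lambda>x. U x c\<^sub>2) (\<lambda>x. V x c\<^sub>2)
      - (\<integral>h. cos_kernel \<delta> (h - half_period) \<partial>(cell_measure :: (real^'d) measure)) * ?D c\<^sub>2\<bar>
      \<le> e / 2 * (\<integral>h. cos_kernel \<delta> (h - half_period) \<partial>(cell_measure :: (real^'d) measure))"
    using conc[of c\<^sub>2] by blast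
  define \<delta> where "\<delta> = min (min \<delta>\<^sub>1 \<delta>\<^sub>2) pi / 2"
  have \<delta>: "0 < \<delta>" "\<delta> < \<delta>\<^sub>1" "\<delta> < \<delta>\<^sub>2" "\<delta> < pi"
    using \<delta>\<^sub>1(1) \<delta>\<^sub>2(1) pi_gt_zero by (auto simp: \<delta>_def min_def)
  define W where "W = (\<integral>h. cos_kernel \<delta> (h - half_period) \<partial>(cell_measure :: (real^'d) measure))"
  have W: "0 < W"
    unfolding W_def by (rule mollifier_shifted_mass_pos[OF mollifier_cos_kernel cos_kernel_pos[OF \<delta>(1,4)]])
  have "kernel_distance (cos_kernel \<delta>) (\<lambda>x. U x c\<^sub>2) (\<lambda>x. V x c\<^sub>2)
      \<le> kernel_distance (cos_kernel \<delta>) (\<lambda>x. U x c\<^sub>1) (\<lambda>x. V x c\<^sub>1)"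
    by (rule kernel_contraction[OF f \<mu> u v rep_U rep_V cont mollifier_cos_kernel c])
  moreover have "W * ?D c\<^sub>2 - e / 2 * W \<le> kernel_distance (cos_kernel \<delta>) (\<lambda>x. U x c\<^sub>2) (\<lambda>x. V x c\<^sub>2)"
    using \<delta>\<^sub>2(2)[OF \<delta>(1,3)] unfolding W_def[symmetric] by linarith
  moreover have "kernel_distance (cos_kernel \<delta>) (\<lambda>x. U x c\<^sub>1) (\<lambda>x. V x c\<^sub>1) \<le> W * ?D c\<^sub>1 + e / 2 * W"
    using \<delta>\<^sub>1(2)[OF \<delta>(1,2)] unfolding W_def[symmetric] by linarith
  ultimately have "W * ?D c\<^sub>2 - e / 2 * W \<le> W * ?D c\<^sub>1 + e / 2 * W" by linarith
  then have "W * ?D c\<^sub>2 \<le> W * (?D c\<^sub>1 + e)" by (simp add: distrib_left mult.commute)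
  then show "?D c\<^sub>2 \<le> ?D c\<^sub>1 + e" using W by (simp only: mult_le_cancel_left_pos)
qed

lemma L1_norm_Lam_eq:
  fixes g :: "real^'d \<Rightarrow> real"
  assumes "g \<in> borel_measurable borel"
  shows "L1_norm (lebesgue_on Lam) g = (\<integral>\<^sup>+ x. ennreal \<bar>g x\<bar> \<partial>cell_measure)"
proof -
  have "L1_norm (lebesgue_on Lam) g = (\<integral>\<^sup>+ x. ennreal \<bar>g x\<bar> * indicator Lam x \<partial>lebesgue)"
    unfolding L1_norm_def by (rule nn_integral_restrict_space) simp
  also have "\<dots> = (\<integral>\<^sup>+ x. ennreal \<bar>g x\<bar> * indicator Lam x \<partial>lborel)"
    by (rule nn_integral_completion)
  also have "\<dots> = (\<integral>\<^sup>+ x. ennreal \<bar>g x\<bar> \<partial>cell_measure)"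
    unfolding cell_measure_def using assms by (subst nn_integral_density) (auto simp: mult.commute)
  finally show ?thesis .
qed

lemma L1_norm_triangle:
  assumes [measurable]: "g \<in> borel_measurable N" "h \<in> borel_measurable N" "k \<in> borel_measurable N"
  shows "L1_norm N (\<lambda>x. g x - k x) \<le> L1_norm N (\<lambda>x. g x - h x) + L1_norm N (\<lambda>x. h x - k x)"
proof -
  have "ennreal \<bar>g x - k x\<bar> \<le> ennreal \<bar>g x - h x\<bar> + ennreal \<bar>h x - k x\<bar>" for x
  proof -
    have "ennreal \<bar>g x - k x\<bar> \<le> ennreal (\<bar>g x - h x\<bar> + \<bar>h x - k x\<bar>)" by (intro ennreal_leI) linarith
    then show ?thesis by simp
  qed
  then have "L1_norm N (\<lambda>x. g x - k x) \<le> (\<integral>\<^sup>+ x. ennreal \<bar>g x - h x\<bar> + ennreal \<bar>h x - k x\<bar> \<partial>N)"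
    unfolding L1_norm_def by (intro nn_integral_mono)
  then show ?thesis unfolding L1_norm_def by (subst (asm) nn_integral_add) auto
qed

lemma L1_norm_minus_commute: "L1_norm N (\<lambda>x. g x - h x) = L1_norm N (\<lambda>x. h x - g x)"
  unfolding L1_norm_def by (simp add: abs_minus_commute)

lemma at_0_within_nontrivial:
  fixes T :: real
  assumes "0 < T" "N \<in> null_sets lborel"
  shows "at 0 within ({0<..<T} - N) \<noteq> bot"
proof -
  have "0 islimpt ({0<..<T} - N)"
    unfolding islimpt_approachable
  proof (intro allI impI)
    fix e :: real assume e: "0 < e"
    have "\<exists>x\<in>{0<..<min T e}. x \<notin> N"
    proof (rule ccontr)
      assume "\<not> ?thesis"
      then have "AE x in lborel. x \<notin> {0<..<min T e}"
        by (intro AE_mp[OF AE_not_in[OF assms(2)] AE_I2]) blast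
      then have "{0<..<min T e} = {}" by (intro open_AE_notin_empty) auto
      then show False using assms e by simp
    qed
    then show "\<exists>x\<in>{0<..<T} - N. x \<noteq> 0 \<and> dist x 0 < e" by (auto simp: dist_real_def)
  qed
  then show ?thesis by (simp add: trivial_limit_within)
qed

lemma representative_continuous:
  assumes "C_Linf_per T u" "representative T M u U" shows "Linf_continuous T U"
  unfolding Linf_continuous_def
proof (intro ballI allI impI)
  fix c \<epsilon> :: real assume c: "c \<in> {0<..<T}" and \<epsilon>: "0 < \<epsilon>"
  have eq: "AE x in lborel. U x t = u x t" if "t \<in> {0<..<T}" for t
    using assms(2) that by (auto simp: representative_def)
  have "c \<in> {0..T}" using c by simp
  from C_Linf_per_continuous[OF assms(1) this \<epsilon>]
  obtain \<delta> where \<delta>: "0 < \<delta>" "\<And>t. t \<in> {0..T} \<Longrightarrow> \<bar>t - c\<bar> < \<delta> \<Longrightarrow> AE x in lborel. \<bar>u x t - u x c\<bar> \<le> \<epsilon>"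
    by blast
  have "AE x in lborel. \<bar>U x t - U x c\<bar> \<le> \<epsilon>" if t: "t \<in> {0<..<T}" "\<bar>t - c\<bar> < \<delta>" for t
  proof -
    have "AE x in lborel. \<bar>u x t - u x c\<bar> \<le> \<epsilon>" using t by (intro \<delta>(2)) auto
    with eq[OF t(1)] eq[OF c] show ?thesis by eventually_elim simp
  qed
  then show "\<exists>\<delta>>0. \<forall>t\<in>{0<..<T}. \<bar>t - c\<bar> < \<delta> \<longrightarrow> (AE x in lborel. \<bar>U x t - U x c\<bar> \<le> \<epsilon>)"
    using \<delta>(1) by blast
qed

theorem theorem2p2:
  fixes T :: real and s :: nat
    and f :: "real \<Rightarrow> real^'d"
    and \<mu> :: "(real^'d) measure"
    and u\<^sub>0 v\<^sub>0 :: "real^'d \<Rightarrow> real"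
    and u v :: "real^'d \<Rightarrow> real \<Rightarrow> real"
  assumes "T > 0"
    and "s > 4 + CARD('d) div 2"
    and "\<And>j. Ck_on s UNIV (\<lambda>a. f a $ j)"
    and "levy_measure \<mu>"
    and "initial_datum u\<^sub>0"
    and "initial_datum v\<^sub>0"
    and "periodic_entropy_solution f \<mu> T u\<^sub>0 u"
    and "periodic_entropy_solution f \<mu> T v\<^sub>0 v"
  shows "AE t\<in>{0<..<T} in lborel.
           L1_norm (lebesgue_on Lam) (\<lambda>x. u x t - v x t)
             \<le> L1_norm (lebesgue_on Lam) (\<lambda>x. u\<^sub>0 x - v\<^sub>0 x)"
proof (intro AE_I2 impI)
  fix t assume t: "t \<in> {0<..<T}"
  let ?L = "lebesgue_on Lam :: (real^'d) measure"
  have Cu: "C_Linf_per T u" and Cv: "C_Linf_per T v"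
    using assms(7,8) by (simp_all add: periodic_entropy_solution_def)
  obtain M\<^sub>u U where U: "representative T M\<^sub>u u U" using representative_exists[OF Cu] by blast
  obtain M\<^sub>v V where V: "representative T M\<^sub>v v V" using representative_exists[OF Cv] by blast
  define M where "M = max M\<^sub>u M\<^sub>v"
  have rep: "representative T M u U" "representative T M v V"
    by (rule representative_mono[OF U], simp add: M_def) (rule representative_mono[OF V], simp add: M_def)
  note contraction = L1_cell_contraction[OF continuous_flux[OF assms(3)] assms(4,7,8) rep
      representative_continuous[OF Cu rep(1)] representative_continuous[OF Cv rep(2)]]
  have sections: "(\<lambda>x. u x \<tau>) \<in> borel_measurable borel" "(\<lambda>x. v x \<tau>) \<in> borel_measurable borel"
    if "\<tau> \<in> {0<..<T}" for \<tau>
    using Cu Cv that by (auto simp: C_Linf_per_def in_Linf_def)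
  have "bounded_periodic M U" "bounded_periodic M V" using rep by (simp_all add: representative_def)
  note [measurable (raw)] = this[THEN bounded_periodic_compose]
    and bound = this[THEN bounded_periodicD(1)]
  have L1_eq: "L1_norm ?L (\<lambda>x. u x \<tau> - v x \<tau>) = ennreal (\<integral>x. \<bar>U x \<tau> - V x \<tau>\<bar> \<partial>cell_measure)"
    if \<tau>: "\<tau> \<in> {0<..<T}" for \<tau>
  proof -
    note [measurable] = sections[OF \<tau>]
    have "AE x in lborel. U x \<tau> = u x \<tau>" "AE x in lborel. V x \<tau> = v x \<tau>"
      using U V \<tau> by (auto simp: representative_def)
    then have "AE x in lborel. x \<in> Lam \<longrightarrow> ennreal \<bar>u x \<tau> - v x \<tau>\<bar> = ennreal \<bar>U x \<tau> - V x \<tau>\<bar>"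
      by eventually_elim simp
    then have "(\<integral>\<^sup>+ x. ennreal \<bar>u x \<tau> - v x \<tau>\<bar> \<partial>cell_measure) = (\<integral>\<^sup>+ x. ennreal \<bar>U x \<tau> - V x \<tau>\<bar> \<partial>cell_measure)"
      by (intro nn_integral_cong_AE) (simp only: AE_cell_iff)
    also have "\<dots> = ennreal (\<integral>x. \<bar>U x \<tau> - V x \<tau>\<bar> \<partial>cell_measure)"
    proof (intro nn_integral_eq_integral cell.integrable_const_bound[of _ "2 * M"] AE_I2)
      show "norm \<bar>U x \<tau> - V x \<tau>\<bar> \<le> 2 * M" for x using bound(1)[of x \<tau>] bound(2)[of x \<tau>] by simp
    qed auto
    finally show ?thesis by (simp add: L1_norm_Lam_eq)
  qed
  have decreasing: "L1_norm ?L (\<lambda>x. u x t - v x t) \<le> L1_norm ?L (\<lambda>x. u x \<tau> - v x \<tau>)"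
    if \<tau>: "\<tau> \<in> {0<..<T}" "\<tau> \<le> t" for \<tau>
    using contraction[of \<tau> t] \<tau> t by (simp add: L1_eq ennreal_leI)
  obtain N\<^sub>u N\<^sub>v where N: "N\<^sub>u \<in> null_sets lborel" "N\<^sub>v \<in> null_sets lborel"
    and lim_u: "((\<lambda>\<tau>. L1_norm ?L (\<lambda>x. u x \<tau> - u\<^sub>0 x)) \<longlongrightarrow> 0) (at 0 within ({0<..<T} - N\<^sub>u))"
    and lim_v: "((\<lambda>\<tau>. L1_norm ?L (\<lambda>x. v x \<tau> - v\<^sub>0 x)) \<longlongrightarrow> 0) (at 0 within ({0<..<T} - N\<^sub>v))"
    using assms(7,8) by (auto simp: periodic_entropy_solution_def ess_tendsto_0_def)
  define S where "S = {0<..<T} - (N\<^sub>u \<union> N\<^sub>v)"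
  have meas_0: "u\<^sub>0 \<in> borel_measurable ?L" "v\<^sub>0 \<in> borel_measurable ?L"
    using assms(5,6) by (simp_all add: initial_datum_def in_Linf_def)
  let ?A = "L1_norm ?L (\<lambda>x. u\<^sub>0 x - v\<^sub>0 x)"
  have "((\<lambda>\<tau>. L1_norm ?L (\<lambda>x. u x \<tau> - u\<^sub>0 x) + (?A + L1_norm ?L (\<lambda>x. v x \<tau> - v\<^sub>0 x))) \<longlongrightarrow> 0 + (?A + 0)) (at 0 within S)"
    unfolding S_def
    by (intro tendsto_add tendsto_const tendsto_within_subset[OF lim_u] tendsto_within_subset[OF lim_v]) auto
  moreover have "\<forall>\<^sub>F \<tau> in at 0 within S. L1_norm ?L (\<lambda>x. u x t - v x t)
      \<le> L1_norm ?L (\<lambda>x. u x \<tau> - u\<^sub>0 x) + (?A + L1_norm ?L (\<lambda>x. v x \<tau> - v\<^sub>0 x))"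
    unfolding eventually_at
  proof (intro exI conjI ballI impI)
    show "0 < t" using t by simp
    fix \<tau> assume "\<tau> \<in> S" "\<tau> \<noteq> 0 \<and> dist \<tau> 0 < t"
    then have \<tau>: "\<tau> \<in> {0<..<T}" "\<tau> \<le> t" by (auto simp: S_def dist_real_def)
    have meas: "(\<lambda>x. u x \<tau>) \<in> borel_measurable ?L" "(\<lambda>x. v x \<tau>) \<in> borel_measurable ?L"
      using sections[OF \<tau>(1)] by (auto intro!: measurable_restrict_space1 measurable_completion)
    have "L1_norm ?L (\<lambda>x. u x t - v x t) \<le> L1_norm ?L (\<lambda>x. u x \<tau> - v x \<tau>)" by (rule decreasing[OF \<tau>])
    also have "\<dots> \<le> L1_norm ?L (\<lambda>x. u x \<tau> - u\<^sub>0 x) + L1_norm ?L (\<lambda>x. u\<^sub>0 x - v x \<tau>)"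
      by (rule L1_norm_triangle[OF meas(1) meas_0(1) meas(2)])
    also have "\<dots> \<le> L1_norm ?L (\<lambda>x. u x \<tau> - u\<^sub>0 x) + (?A + L1_norm ?L (\<lambda>x. v\<^sub>0 x - v x \<tau>))"
      by (intro add_left_mono L1_norm_triangle[OF meas_0 meas(2)])
    finally show "L1_norm ?L (\<lambda>x. u x t - v x t)
      \<le> L1_norm ?L (\<lambda>x. u x \<tau> - u\<^sub>0 x) + (?A + L1_norm ?L (\<lambda>x. v x \<tau> - v\<^sub>0 x))"
      by (simp only: L1_norm_minus_commute[of _ v\<^sub>0])
  qed
  moreover have "at 0 within S \<noteq> bot"
    unfolding S_def using N by (intro at_0_within_nontrivial[OF assms(1)] null_sets.Un)
  ultimately show "L1_norm ?L (\<lambda>x. u x t - v x t) \<le> ?A"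
    by (intro tendsto_lowerbound[where F = "at 0 within S"]) simp_all
qed

end
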